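(* Let $\mathbb{K}$ be a field, $q\in\mathbb{K}^\times$ a primitive third root of unity. For $d_1,d_2\ge0$ define $\mu_B^{(d_1,d_2)}:B_{d_1}\otimes B_{d_2}\to B_{d_1+d_2}$ by $$\mu_B^{(d_1,d_2)}(a\otimes b)=q^{(|a_2|+|a_3|)|b_1|}\sum a_1\,r_2(r_1(b_1))\otimes r_2(a_2)\,r_3(b_2)\otimes r_3(r_1(a_3))\,b_3$$ for $a=a_1\otimes a_2\otimes a_3$, $b=b_1\otimes b_2\otimes b_3$. Then $\mu_B$ defines an associative product on $B_*=(B_d)_{d\ge0}$, making it a graded differential $\mathcal{P}_q$-algebra and a graded exponential functor. In particular, $\mu_B^{(d_1,d_2)}$ is surjective and $$\mu_B^{(d_1,d_2)}\circ\delta_{B_{d_1}\otimes B_{d_2}}=\delta\circ\mu_B^{(d_1,d_2)},$$ where $\delta_{B_{d_1}\otimes B_{d_2}}$ is given on $B_{d_1}^i\otimes B_{d_2}^j$ by $\delta\otimes1+q^{2i}(1\otimes\delta)$.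
   Context: Quantum polynomial functors. Let $V_n=\mathbb{K}^n$ with basis $e_1,\dots,e_n$. The Hecke algebra $\mathcal{H}_d$ has generators $T_1,\dots,T_{d-1}$ subject to the braid relations and $(T_i-q)(T_i+q^{-1})=0$. It acts on the right on $V_n^{\otimes d}$, $T_i$ acting on the factors $i,i+1$ by $(e_a\otimes e_b)T=e_b\otimes e_a$ if $a<b$, $q\,e_a\otimes e_a$ if $a=b$, $e_b\otimes e_a+(q-q^{-1})e_a\otimes e_b$ if $a>b$. Let $\Gamma^d_q\mathcal{V}$ be the category with objects $V_n^{\otimes d}$ ($n\ge0$) and morphisms the $\mathcal{H}_d$-linear maps. $\mathcal{P}^d_q$ is the category of $\mathbb{K}$-linear functors from $\Gamma^d_q\mathcal{V}$ to finite-dimensional $\mathbb{K}$-vector spaces, and $\mathcal{P}_q=\bigoplus_{d\ge0}\mathcal{P}_q^d$. Write $F(n)=F(V_n^{\otimes d})$. Tensor product: $(F\otimes G)(n)=F(n)\otimes G(n)$ for $F\in\mathcal P_q^d$, $G\in\mathcal P_q^e$, functorial through $\mathrm{Hom}_{\mathcal{H}_{d+e}}(V_n^{\otimes d+e},V_m^{\otimes d+e})\subset\mathrm{Hom}_{\mathcal{H}_d}(V_n^{\otimes d},V_m^{\otimes d})\otimes\mathrm{Hom}_{\mathcal{H}_e}(V_n^{\otimes e},V_m^{\otimes e})$. Symmetric powers: $S^d_q(n)=V_n^{\otimes d}/\sum_i V_n^{\otimes d}(T_i-q)$; for $x\in S^d_q$ write $|x|=d$. The product $\mu^{(i,j)}:S^i_q\otimes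 S^j_q\to S^{i+j}_q$, $x\otimes y\mapsto xy$, is induced by the identity of $V_n^{\otimes i+j}$. The coproduct $\Delta^{(d-1,1)}:S^d_q\to S^{d-1}_q\otimes S^1_q$ is induced by the right action of $\sum_{i=1}^d q^{d-i}T_iT_{i+1}\cdots T_{d-1}$ on $V_n^{\otimes d}$ (the $i=d$ term being $1$). The switch $R^{(d,e)}:S^d_q\otimes S^e_q\to S^e_q\otimes S^d_q$ is the braiding, induced on quotients by the right action on $V_n^{\otimes d+e}$ of $(T_dT_{d-1}\cdots T_1)(T_{d+1}T_d\cdots T_2)\cdots(T_{d+e-1}\cdots T_e)$. Write $R^{(d,e)}(x\otimes y)=\sum r(y)\otimes r(x)$; indices on $r$ indicate the order in which switches are applied. Thus, in the formula for $\mu_B$: start from $a_1\otimes a_2\otimes a_3\otimes b_1\otimes b_2\otimes b_3$, switch $a_3$ and $b_1$ ($r_1$), then $a_2$ and $b_1$ ($r_2$), then $a_3$ and $b_2$ ($r_3$), to arrive in the order $a_1,b_1,a_2,b_2,a_3,b_3$, and then multiply the consecutive pairs. The functor $B_d=\bigoplus_{\alpha_1+\alpha_2+\alpha_3=d}S^{\alpha_1}_q\otimes S^{\alpha_2}_q\otimes S^{\alpha_3}_q$ (sum over triples of non-negative integers) is graded with the summand $\alpha$ in degree $\alpha_2+2\alpha_3$; $B_d^i$ is the degree $i$ part. The degree $1$ map $\delta:B_d\to B_d$ is $\delta=\delta_1+(q^2)^{\alpha_2}\delta_2$ on the summand $\alpha$, where $$\delta_1=(1\otimes\mu^{(1,\alpha_2)}\otimes1)(\Delta^{(\alpha_1-1,1)}\otimes1\otimes1),\qquad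 \delta_2=(1\otimes1\otimes\mu^{(1,\alpha_3)})(1\otimes\Delta^{(\alpha_2-1,1)}\otimes1)$$ (zero when $\alpha_1=0$, respectively $\alpha_2=0$). A $\mathcal{P}_q$-algebra is a family $F=(F_d)_{d\ge0}$, $F_d\in\mathcal{P}_q^d$, with natural transformations $\mu_F^{d_1,d_2}:F_{d_1}\otimes F_{d_2}\to F_{d_1+d_2}$ (product) and $\eta_F:\mathbb{K}\to F_0$ (unit), associative and unital. It is an exponential functor if for all $n,m,d\ge0$ the map $$\bigoplus_{d_1+d_2=d}F_{d_1}(n)\otimes F_{d_2}(m)\to\bigoplus_{d_1+d_2=d}F_{d_1}(n+m)\otimes F_{d_2}(n+m)\xrightarrow{\mu_F}F_d(n+m)$$ is an isomorphism, the first map being $F_{d_1}(\iota)\otimes F_{d_2}(\iota')$ with $\iota:V_n^{\otimes d_1}\to V_{n+m}^{\otimes d_1}$ and $\iota':V_m^{\otimes d_2}\to V_{n+m}^{\otimes d_2}$ induced by $e_i\mapsto e_i$ and $e_i\mapsto e_{n+i}$. Graded means that each $F_d$ is graded and the product and unit preserve degrees. Graded differential means that moreover the product commutes with the differentials as displayed in the claim. The unit of $B_*$ is $1\otimes1\otimes1\in B_0$. *)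

theory Defs
  imports Complex_Main "HOL-Library.Poly_Mapping"
begin

section \<open>Free vector spaces\<close>

text \<open>The type \<open>'i \<Rightarrow>\<^sub>0 'k\<close> is the vector space with basis \<open>'i\<close>; \<open>bas i\<close> is a basis vector.\<close>

definition scale :: "'k::field \<Rightarrow> ('i \<Rightarrow>\<^sub>0 'k) \<Rightarrow> ('i \<Rightarrow>\<^sub>0 'k)" (infixr "*\<^sub>v" 75)
  where "c *\<^sub>v x = Poly_Mapping.map (\<lambda>a. c * a) x"

lemma lookup_scale: "Poly_Mapping.lookup (c *\<^sub>v x) i = c * Poly_Mapping.lookup x i"
  unfolding scale_def by (simp add: Poly_Mapping.map.rep_eq when_def)

global_interpretation pm: vector_space "scale :: 'k::field \<Rightarrow> ('i \<Rightarrow>\<^sub>0 'k) \<Rightarrow> ('i \<Rightarrow>\<^sub>0 'k)"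
  by unfold_locales
    (auto intro!: poly_mapping_eqI simp: lookup_scale lookup_add algebra_simps)

abbreviation lin :: "(('i \<Rightarrow>\<^sub>0 'k::field) \<Rightarrow> ('j \<Rightarrow>\<^sub>0 'k)) \<Rightarrow> bool"
  where "lin \<equiv> Vector_Spaces.linear scale scale"

definition bas :: "'i \<Rightarrow> ('i \<Rightarrow>\<^sub>0 'k::field)"
  where "bas i = Poly_Mapping.single i 1"

definition lext :: "('i \<Rightarrow> ('j \<Rightarrow>\<^sub>0 'k::field)) \<Rightarrow> ('i \<Rightarrow>\<^sub>0 'k) \<Rightarrow> ('j \<Rightarrow>\<^sub>0 'k)"
  where "lext f x = (\<Sum>i\<in>Poly_Mapping.keys x. Poly_Mapping.lookup x i *\<^sub>v f i)"

definition free :: "'i set \<Rightarrow> ('i \<Rightarrow>\<^sub>0 'k::field) set"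
  where "free A = {x. Poly_Mapping.keys x \<subseteq> A}"

definition tens :: "('i \<Rightarrow>\<^sub>0 'k::field) \<Rightarrow> ('j \<Rightarrow>\<^sub>0 'k) \<Rightarrow> ('i \<times> 'j \<Rightarrow>\<^sub>0 'k)" (infixl "\<otimes>" 70)
  where "x \<otimes> y = lext (\<lambda>i. lext (\<lambda>j. bas (i, j)) y) x"

definition tens_map ::
  "(('i \<Rightarrow>\<^sub>0 'k::field) \<Rightarrow> ('a \<Rightarrow>\<^sub>0 'k)) \<Rightarrow> (('j \<Rightarrow>\<^sub>0 'k) \<Rightarrow> ('b \<Rightarrow>\<^sub>0 'k)) \<Rightarrow>
   ('i \<times> 'j \<Rightarrow>\<^sub>0 'k) \<Rightarrow> ('a \<times> 'b \<Rightarrow>\<^sub>0 'k)"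
  where "tens_map f g = lext (\<lambda>(i, j). f (bas i) \<otimes> g (bas j))"

definition dinj :: "'a \<Rightarrow> ('i \<Rightarrow>\<^sub>0 'k::field) \<Rightarrow> ('a \<times> 'i \<Rightarrow>\<^sub>0 'k)"
  where "dinj a = lext (\<lambda>i. bas (a, i))"


section \<open>Finite-dimensional vector spaces\<close>

text \<open>A finite-dimensional vector space is given as a quotient \<open>free (gens X) / rels X\<close> with
  \<open>gens X\<close> finite. Its elements are represented by elements of \<open>free (gens X)\<close>, and two of these
  are equal in the quotient iff they are related by \<open>eqv X\<close>. A linear map between quotients is
  given by a linear map between the free spaces that respects the relations (every linear map
  between the quotients lifts to such a map); maps are compared modulo \<open>eqv\<close> of the target.\<close>

record (overloaded) ('i, 'k) space =
  gens :: "'i set"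
  rels :: "('i \<Rightarrow>\<^sub>0 'k) set"

abbreviation elems :: "('i, 'k::field) space \<Rightarrow> ('i \<Rightarrow>\<^sub>0 'k) set"
  where "elems X \<equiv> free (gens X)"

definition is_space :: "('i, 'k::field) space \<Rightarrow> bool"
  where "is_space X \<longleftrightarrow> finite (gens X) \<and> pm.subspace (rels X) \<and> rels X \<subseteq> elems X"

definition eqv :: "('i, 'k::field) space \<Rightarrow> ('i \<Rightarrow>\<^sub>0 'k) \<Rightarrow> ('i \<Rightarrow>\<^sub>0 'k) \<Rightarrow> bool"
  where "eqv X x y \<longleftrightarrow> x - y \<in> rels X"

definition is_map ::
  "('i, 'k::field) space \<Rightarrow> ('j, 'k) space \<Rightarrow> (('i \<Rightarrow>\<^sub>0 'k) \<Rightarrow> ('j \<Rightarrow>\<^sub>0 'k)) \<Rightarrow> bool"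
  where "is_map X Y f \<longleftrightarrow> lin f \<and> f ` elems X \<subseteq> elems Y \<and> f ` rels X \<subseteq> rels Y"

definition inj_map ::
  "('i, 'k::field) space \<Rightarrow> ('j, 'k) space \<Rightarrow> (('i \<Rightarrow>\<^sub>0 'k) \<Rightarrow> ('j \<Rightarrow>\<^sub>0 'k)) \<Rightarrow> bool"
  where "inj_map X Y f \<longleftrightarrow> (\<forall>x\<in>elems X. \<forall>y\<in>elems X. eqv Y (f x) (f y) \<longrightarrow> eqv X x y)"

definition surj_map ::
  "('i, 'k::field) space \<Rightarrow> ('j, 'k) space \<Rightarrow> (('i \<Rightarrow>\<^sub>0 'k) \<Rightarrow> ('j \<Rightarrow>\<^sub>0 'k)) \<Rightarrow> bool"
  where "surj_map X Y f \<longleftrightarrow> (\<forall>y\<in>elems Y. \<exists>x\<in>elems X. eqv Y (f x) y)"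

definition iso_map ::
  "('i, 'k::field) space \<Rightarrow> ('j, 'k) space \<Rightarrow> (('i \<Rightarrow>\<^sub>0 'k) \<Rightarrow> ('j \<Rightarrow>\<^sub>0 'k)) \<Rightarrow> bool"
  where "iso_map X Y f \<longleftrightarrow> is_map X Y f \<and> inj_map X Y f \<and> surj_map X Y f"

definition tens_space ::
  "('i, 'k::field) space \<Rightarrow> ('j, 'k) space \<Rightarrow> ('i \<times> 'j, 'k) space"
  where "tens_space X Y =
    \<lparr> gens = gens X \<times> gens Y,
      rels = pm.span ({x \<otimes> y |x y. x \<in> rels X \<and> y \<in> elems Y} \<union>
                      {x \<otimes> y |x y. x \<in> elems X \<and> y \<in> rels Y}) \<rparr>"

definition dsum_space :: "'a set \<Rightarrow> ('a \<Rightarrow> ('i, 'k::field) space) \<Rightarrow> ('a \<times> 'i, 'k) space"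
  where "dsum_space I X =
    \<lparr> gens = (SIGMA a:I. gens (X a)), rels = pm.span (\<Union>a\<in>I. dinj a ` rels (X a)) \<rparr>"


section \<open>Tensor powers and the Hecke algebra action\<close>

text \<open>A word \<open>[a\<^sub>1, \<dots>, a\<^sub>d]\<close> stands for the tensor of \<open>e\<^bsub>a\<^sub>1\<^esub>, \<dots>, e\<^bsub>a\<^sub>d\<^esub>\<close>.\<close>

definition words :: "nat \<Rightarrow> nat \<Rightarrow> nat list set"
  where "words n d = {w. length w = d \<and> set w \<subseteq> {1..n}}"

abbreviation tpow :: "nat \<Rightarrow> nat \<Rightarrow> (nat list \<Rightarrow>\<^sub>0 'k::field) set"
  where "tpow n d \<equiv> free (words n d)"

text \<open>The generator \<open>T\<^sub>i\<close> (\<open>1 \<le> i < d\<close>) acts on the letters \<open>i\<close> and \<open>i + 1\<close>, which are at the list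
  positions \<open>i - 1\<close> and \<open>i\<close>.\<close>

definition T :: "'k::field \<Rightarrow> nat \<Rightarrow> (nat list \<Rightarrow>\<^sub>0 'k) \<Rightarrow> (nat list \<Rightarrow>\<^sub>0 'k)"
  where "T q i = lext (\<lambda>w.
    let a = w ! (i - 1); b = w ! i; w' = w[i - 1 := b, i := a] in
    if a < b then bas w'
    else if a = b then q *\<^sub>v bas w
    else bas w' + (q - inverse q) *\<^sub>v bas w)"

text \<open>Right action of the product \<open>T\<^bsub>i\<^sub>1\<^esub> T\<^bsub>i\<^sub>2\<^esub> \<dots>\<close>: the first generator acts first.\<close>

definition act :: "'k::field \<Rightarrow> nat list \<Rightarrow> (nat list \<Rightarrow>\<^sub>0 'k) \<Rightarrow> (nat list \<Rightarrow>\<^sub>0 'k)"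
  where "act q is x = fold (T q) is x"

text \<open>Morphisms of \<open>\<Gamma>\<^sup>d\<^sub>q\<V>\<close> from \<open>V\<^sub>n\<^sup>\<otimes>\<^sup>d\<close> to \<open>V\<^sub>m\<^sup>\<otimes>\<^sup>d\<close>; they are extended by zero to the other words,
  so that equality of morphisms is equality of functions.\<close>

definition hom ::
  "'k::field \<Rightarrow> nat \<Rightarrow> nat \<Rightarrow> nat \<Rightarrow> ((nat list \<Rightarrow>\<^sub>0 'k) \<Rightarrow> (nat list \<Rightarrow>\<^sub>0 'k)) set"
  where "hom q d n m = {\<phi>. lin \<phi> \<and> \<phi> ` tpow n d \<subseteq> tpow m d \<and>
    (\<forall>w. w \<notin> words n d \<longrightarrow> \<phi> (bas w) = 0) \<and>
    (\<forall>i\<in>{1..<d}. \<forall>x\<in>tpow n d. \<phi> (T q i x) = T q i (\<phi> x))}"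

definition hom_id :: "nat \<Rightarrow> nat \<Rightarrow> (nat list \<Rightarrow>\<^sub>0 'k::field) \<Rightarrow> (nat list \<Rightarrow>\<^sub>0 'k)"
  where "hom_id d n = lext (\<lambda>w. if w \<in> words n d then bas w else 0)"

definition cat :: "(nat list \<times> nat list \<Rightarrow>\<^sub>0 'k::field) \<Rightarrow> (nat list \<Rightarrow>\<^sub>0 'k)"
  where "cat = lext (\<lambda>(u, v). bas (u @ v))"

definition split :: "nat \<Rightarrow> (nat list \<Rightarrow>\<^sub>0 'k::field) \<Rightarrow> (nat list \<times> nat list \<Rightarrow>\<^sub>0 'k)"
  where "split d = lext (\<lambda>w. bas (take d w, drop d w))"

text \<open>The map \<open>\<phi> \<otimes> \<psi>\<close> on \<open>V\<^sub>n\<^sup>\<otimes>\<^sup>d\<^sup>+\<^sup>e\<close>, for \<open>\<phi>\<close> on \<open>V\<^sub>n\<^sup>\<otimes>\<^sup>d\<close> and \<open>\<psi>\<close> on \<open>V\<^sub>n\<^sup>\<otimes>\<^sup>e\<close>.\<close>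

definition hom_tens ::
  "nat \<Rightarrow> ((nat list \<Rightarrow>\<^sub>0 'k::field) \<Rightarrow> (nat list \<Rightarrow>\<^sub>0 'k)) \<Rightarrow>
   ((nat list \<Rightarrow>\<^sub>0 'k) \<Rightarrow> (nat list \<Rightarrow>\<^sub>0 'k)) \<Rightarrow> (nat list \<Rightarrow>\<^sub>0 'k) \<Rightarrow> (nat list \<Rightarrow>\<^sub>0 'k)"
  where "hom_tens d \<phi> \<psi> x = cat (tens_map \<phi> \<psi> (split d x))"

definition decomposes ::
  "'k::field \<Rightarrow> nat \<Rightarrow> nat \<Rightarrow> nat \<Rightarrow> nat \<Rightarrow> ((nat list \<Rightarrow>\<^sub>0 'k) \<Rightarrow> (nat list \<Rightarrow>\<^sub>0 'k)) \<Rightarrow>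
   (((nat list \<Rightarrow>\<^sub>0 'k) \<Rightarrow> (nat list \<Rightarrow>\<^sub>0 'k)) \<times> ((nat list \<Rightarrow>\<^sub>0 'k) \<Rightarrow> (nat list \<Rightarrow>\<^sub>0 'k))) list \<Rightarrow> bool"
  where "decomposes q d e n m \<phi> ps \<longleftrightarrow>
    set ps \<subseteq> hom q d n m \<times> hom q e n m \<and>
    (\<forall>x. \<phi> x = (\<Sum>(\<psi>, \<chi>)\<leftarrow>ps. hom_tens d \<psi> \<chi> x))"


section \<open>Quantum polynomial functors\<close>

record (overloaded) ('i, 'k) pfunctor =
  deg :: nat
  obj :: "nat \<Rightarrow> ('i, 'k) space"
  mor :: "nat \<Rightarrow> nat \<Rightarrow> ((nat list \<Rightarrow>\<^sub>0 'k) \<Rightarrow> (nat list \<Rightarrow>\<^sub>0 'k)) \<Rightarrow> ('i \<Rightarrow>\<^sub>0 'k) \<Rightarrow> ('i \<Rightarrow>\<^sub>0 'k)"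

definition poly_functor :: "'k::field \<Rightarrow> ('i, 'k) pfunctor \<Rightarrow> bool"
  where "poly_functor q F \<longleftrightarrow>
    (\<forall>n. is_space (obj F n)) \<and>
    (\<forall>n m. \<forall>\<phi>\<in>hom q (deg F) n m. is_map (obj F n) (obj F m) (mor F n m \<phi>)) \<and>
    (\<forall>n. \<forall>x\<in>elems (obj F n). eqv (obj F n) (mor F n n (hom_id (deg F) n) x) x) \<and>
    (\<forall>n m l. \<forall>\<phi>\<in>hom q (deg F) n m. \<forall>\<psi>\<in>hom q (deg F) m l. \<forall>x\<in>elems (obj F n).
       eqv (obj F l) (mor F n l (\<psi> \<circ> \<phi>) x) (mor F m l \<psi> (mor F n m \<phi> x))) \<and>
    (\<forall>n m. \<forall>\<phi>\<in>hom q (deg F) n m. \<forall>\<psi>\<in>hom q (deg F) n m. \<forall>x\<in>elems (obj F n).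
       eqv (obj F m) (mor F n m (\<lambda>y. \<phi> y + \<psi> y) x) (mor F n m \<phi> x + mor F n m \<psi> x)) \<and>
    (\<forall>n m c. \<forall>\<phi>\<in>hom q (deg F) n m. \<forall>x\<in>elems (obj F n).
       eqv (obj F m) (mor F n m (\<lambda>y. c *\<^sub>v \<phi> y) x) (c *\<^sub>v mor F n m \<phi> x))"

definition nat_trans ::
  "'k::field \<Rightarrow> ('i, 'k) pfunctor \<Rightarrow> ('j, 'k) pfunctor \<Rightarrow>
   (nat \<Rightarrow> ('i \<Rightarrow>\<^sub>0 'k) \<Rightarrow> ('j \<Rightarrow>\<^sub>0 'k)) \<Rightarrow> bool"
  where "nat_trans q F G \<tau> \<longleftrightarrow> deg F = deg G \<and>
    (\<forall>n. is_map (obj F n) (obj G n) (\<tau> n)) \<and>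
    (\<forall>n m. \<forall>\<phi>\<in>hom q (deg F) n m. \<forall>x\<in>elems (obj F n).
       eqv (obj G m) (\<tau> m (mor F n m \<phi> x)) (mor G n m \<phi> (\<tau> n x)))"

text \<open>The unit for the tensor product: the functor \<open>V\<^sub>n\<^sup>\<otimes>\<^sup>0 \<mapsto> V\<^sub>n\<^sup>\<otimes>\<^sup>0\<close> of degree 0, with the constant
  value \<open>\<K>\<close>.\<close>

definition unit_functor :: "(nat list, 'k::field) pfunctor"
  where "unit_functor =
    \<lparr> deg = 0, obj = (\<lambda>n. \<lparr> gens = words n 0, rels = {0} \<rparr>), mor = (\<lambda>n m \<phi>. \<phi>) \<rparr>"

text \<open>A morphism of degree \<open>d + e\<close> acts on \<open>F \<otimes> G\<close> through any way of writing it as an element of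
  the tensor product of the spaces of morphisms of degrees \<open>d\<close> and \<open>e\<close>; up to \<open>eqv\<close> the result
  does not depend on the choice.\<close>

definition tens_functor ::
  "'k::field \<Rightarrow> ('i, 'k) pfunctor \<Rightarrow> ('j, 'k) pfunctor \<Rightarrow> ('i \<times> 'j, 'k) pfunctor"
  where "tens_functor q F G =
    \<lparr> deg = deg F + deg G,
      obj = (\<lambda>n. tens_space (obj F n) (obj G n)),
      mor = (\<lambda>n m \<phi> x. \<Sum>(\<psi>, \<chi>)\<leftarrow>(SOME ps. decomposes q (deg F) (deg G) n m \<phi> ps).
               tens_map (mor F n m \<psi>) (mor G n m \<chi>) x) \<rparr>"

definition dsum_functor ::
  "nat \<Rightarrow> 'a set \<Rightarrow> ('a \<Rightarrow> ('i, 'k::field) pfunctor) \<Rightarrow> ('a \<times> 'i, 'k) pfunctor"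
  where "dsum_functor d I F =
    \<lparr> deg = d,
      obj = (\<lambda>n. dsum_space I (\<lambda>a. obj (F a) n)),
      mor = (\<lambda>n m \<phi>. lext (\<lambda>(a, i). dinj a (mor (F a) n m \<phi> (bas i)))) \<rparr>"


section \<open>Algebras and exponential functors\<close>

type_synonym ('i, 'k) product =
  "nat \<Rightarrow> nat \<Rightarrow> nat \<Rightarrow> ('i \<times> 'i \<Rightarrow>\<^sub>0 'k) \<Rightarrow> ('i \<Rightarrow>\<^sub>0 'k)"

text \<open>In a family \<open>\<mu>\<close> of products, \<open>\<mu> d\<^sub>1 d\<^sub>2 n\<close> is the component at \<open>n\<close> of the map
  \<open>F\<^bsub>d\<^sub>1\<^esub> \<otimes> F\<^bsub>d\<^sub>2\<^esub> \<rightarrow> F\<^bsub>d\<^sub>1\<^esub>\<^sub>+\<^bsub>d\<^sub>2\<^esub>\<close>.\<close>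

definition pq_algebra ::
  "'k::field \<Rightarrow> (nat \<Rightarrow> ('i, 'k) pfunctor) \<Rightarrow> ('i, 'k) product \<Rightarrow>
   (nat \<Rightarrow> (nat list \<Rightarrow>\<^sub>0 'k) \<Rightarrow> ('i \<Rightarrow>\<^sub>0 'k)) \<Rightarrow> bool"
  where "pq_algebra q F \<mu> \<eta> \<longleftrightarrow>
    (\<forall>d. poly_functor q (F d) \<and> deg (F d) = d) \<and>
    (\<forall>d1 d2. nat_trans q (tens_functor q (F d1) (F d2)) (F (d1 + d2)) (\<mu> d1 d2)) \<and>
    nat_trans q unit_functor (F 0) \<eta> \<and>
    (\<forall>d1 d2 d3 n. \<forall>x\<in>elems (obj (F d1) n). \<forall>y\<in>elems (obj (F d2) n). \<forall>z\<in>elems (obj (F d3) n).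
       eqv (obj (F (d1 + d2 + d3)) n)
         (\<mu> (d1 + d2) d3 n (\<mu> d1 d2 n (x \<otimes> y) \<otimes> z))
         (\<mu> d1 (d2 + d3) n (x \<otimes> \<mu> d2 d3 n (y \<otimes> z)))) \<and>
    (\<forall>d n. \<forall>x\<in>elems (obj (F d) n).
       eqv (obj (F d) n) (\<mu> 0 d n (\<eta> n (bas []) \<otimes> x)) x \<and>
       eqv (obj (F d) n) (\<mu> d 0 n (x \<otimes> \<eta> n (bas []))) x)"

text \<open>The maps \<open>\<iota>\<close> and \<open>\<iota>'\<close> are \<open>incl 0 n d\<close> and \<open>incl n m d\<close>.\<close>

definition incl :: "nat \<Rightarrow> nat \<Rightarrow> nat \<Rightarrow> (nat list \<Rightarrow>\<^sub>0 'k::field) \<Rightarrow> (nat list \<Rightarrow>\<^sub>0 'k)"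
  where "incl s n d = lext (\<lambda>w. if w \<in> words n d then bas (map (\<lambda>a. s + a) w) else 0)"

definition exp_map ::
  "(nat \<Rightarrow> ('i, 'k::field) pfunctor) \<Rightarrow> ('i, 'k) product \<Rightarrow> nat \<Rightarrow> nat \<Rightarrow>
   ((nat \<times> nat) \<times> ('i \<times> 'i) \<Rightarrow>\<^sub>0 'k) \<Rightarrow> ('i \<Rightarrow>\<^sub>0 'k)"
  where "exp_map F \<mu> n m = lext (\<lambda>((d1, d2), (i, j)).
    \<mu> d1 d2 (n + m) (mor (F d1) n (n + m) (incl 0 n d1) (bas i) \<otimes>
                     mor (F d2) m (n + m) (incl n m d2) (bas j)))"

definition exponential_functor ::
  "'k::field \<Rightarrow> (nat \<Rightarrow> ('i, 'k) pfunctor) \<Rightarrow> ('i, 'k) product \<Rightarrow>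
   (nat \<Rightarrow> (nat list \<Rightarrow>\<^sub>0 'k) \<Rightarrow> ('i \<Rightarrow>\<^sub>0 'k)) \<Rightarrow> bool"
  where "exponential_functor q F \<mu> \<eta> \<longleftrightarrow> pq_algebra q F \<mu> \<eta> \<and>
    (\<forall>n m d. iso_map
       (dsum_space {(d1, d2). d1 + d2 = d} (\<lambda>(d1, d2). tens_space (obj (F d1) n) (obj (F d2) m)))
       (obj (F d) (n + m)) (exp_map F \<mu> n m))"

text \<open>A grading of \<open>F\<close>: \<open>G i n\<close> is the degree \<open>i\<close> part of \<open>F(n)\<close>, as a subspace of the free space
  containing the relations.\<close>

definition grading ::
  "'k::field \<Rightarrow> ('i, 'k) pfunctor \<Rightarrow> (nat \<Rightarrow> nat \<Rightarrow> ('i \<Rightarrow>\<^sub>0 'k) set) \<Rightarrow> bool"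
  where "grading q F G \<longleftrightarrow>
    (\<forall>i n. pm.subspace (G i n) \<and> rels (obj F n) \<subseteq> G i n \<and> G i n \<subseteq> elems (obj F n)) \<and>
    (\<forall>i n m. \<forall>\<phi>\<in>hom q (deg F) n m. mor F n m \<phi> ` G i n \<subseteq> G i m) \<and>
    (\<forall>n. \<forall>x\<in>elems (obj F n). \<exists>I c. finite I \<and> (\<forall>i\<in>I. c i \<in> G i n) \<and>
       eqv (obj F n) x (\<Sum>i\<in>I. c i)) \<and>
    (\<forall>n I c. finite I \<longrightarrow> (\<forall>i\<in>I. c i \<in> G i n) \<longrightarrow> (\<Sum>i\<in>I. c i) \<in> rels (obj F n) \<longrightarrow>
       (\<forall>i\<in>I. c i \<in> rels (obj F n)))"

definition graded_algebra ::
  "'k::field \<Rightarrow> (nat \<Rightarrow> ('i, 'k) pfunctor) \<Rightarrow> ('i, 'k) product \<Rightarrow>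
   (nat \<Rightarrow> (nat list \<Rightarrow>\<^sub>0 'k) \<Rightarrow> ('i \<Rightarrow>\<^sub>0 'k)) \<Rightarrow>
   (nat \<Rightarrow> nat \<Rightarrow> nat \<Rightarrow> ('i \<Rightarrow>\<^sub>0 'k) set) \<Rightarrow> bool"
  where "graded_algebra q F \<mu> \<eta> G \<longleftrightarrow> pq_algebra q F \<mu> \<eta> \<and>
    (\<forall>d. grading q (F d) (G d)) \<and>
    (\<forall>d1 d2 i j n. \<forall>x\<in>G d1 i n. \<forall>y\<in>G d2 j n. \<mu> d1 d2 n (x \<otimes> y) \<in> G (d1 + d2) (i + j) n) \<and>
    (\<forall>n. \<eta> n (bas []) \<in> G 0 0 n)"

definition graded_differential_algebra ::
  "'k::field \<Rightarrow> (nat \<Rightarrow> ('i, 'k) pfunctor) \<Rightarrow> ('i, 'k) product \<Rightarrow>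
   (nat \<Rightarrow> (nat list \<Rightarrow>\<^sub>0 'k) \<Rightarrow> ('i \<Rightarrow>\<^sub>0 'k)) \<Rightarrow>
   (nat \<Rightarrow> nat \<Rightarrow> nat \<Rightarrow> ('i \<Rightarrow>\<^sub>0 'k) set) \<Rightarrow>
   (nat \<Rightarrow> nat \<Rightarrow> ('i \<Rightarrow>\<^sub>0 'k) \<Rightarrow> ('i \<Rightarrow>\<^sub>0 'k)) \<Rightarrow> bool"
  where "graded_differential_algebra q F \<mu> \<eta> G \<delta> \<longleftrightarrow> graded_algebra q F \<mu> \<eta> G \<and>
    (\<forall>d. nat_trans q (F d) (F d) (\<delta> d)) \<and>
    (\<forall>d i n. \<delta> d n ` G d i n \<subseteq> G d (i + 1) n) \<and>
    (\<forall>d1 d2 i j n. \<forall>x\<in>G d1 i n. \<forall>y\<in>G d2 j n.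
       eqv (obj (F (d1 + d2)) n)
         (\<mu> d1 d2 n (\<delta> d1 n x \<otimes> y + q ^ (2 * i) *\<^sub>v (x \<otimes> \<delta> d2 n y)))
         (\<delta> (d1 + d2) n (\<mu> d1 d2 n (x \<otimes> y))))"

definition graded_exponential_functor ::
  "'k::field \<Rightarrow> (nat \<Rightarrow> ('i, 'k) pfunctor) \<Rightarrow> ('i, 'k) product \<Rightarrow>
   (nat \<Rightarrow> (nat list \<Rightarrow>\<^sub>0 'k) \<Rightarrow> ('i \<Rightarrow>\<^sub>0 'k)) \<Rightarrow>
   (nat \<Rightarrow> nat \<Rightarrow> nat \<Rightarrow> ('i \<Rightarrow>\<^sub>0 'k) set) \<Rightarrow> bool"
  where "graded_exponential_functor q F \<mu> \<eta> G \<longleftrightarrow>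
    graded_algebra q F \<mu> \<eta> G \<and> exponential_functor q F \<mu> \<eta>"


section \<open>Quantum symmetric powers\<close>

definition Sq :: "'k::field \<Rightarrow> nat \<Rightarrow> (nat list, 'k) pfunctor"
  where "Sq q d =
    \<lparr> deg = d,
      obj = (\<lambda>n. \<lparr> gens = words n d,
                    rels = pm.span {T q i x - q *\<^sub>v x |i x. i \<in> {1..<d} \<and> x \<in> tpow n d} \<rparr>),
      mor = (\<lambda>n m \<phi>. \<phi>) \<rparr>"

text \<open>The product of symmetric powers is concatenation of words. The next two maps are the
  values on words of length \<open>d\<close> of the coproduct \<open>\<Delta>\<^sup>(\<^sup>d\<^sup>-\<^sup>1\<^sup>,\<^sup>1\<^sup>)\<close> and on pairs of words of lengths
  \<open>d\<close> and \<open>e\<close> of the switch \<open>R\<^sup>(\<^sup>d\<^sup>,\<^sup>e\<^sup>)\<close>.\<close>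

definition Delta :: "'k::field \<Rightarrow> nat list \<Rightarrow> (nat list \<times> nat list \<Rightarrow>\<^sub>0 'k)"
  where "Delta q w = (let d = length w in
    split (d - 1) (\<Sum>i=1..d. q ^ (d - i) *\<^sub>v act q [i..<d] (bas w)))"

definition switch_word :: "nat \<Rightarrow> nat \<Rightarrow> nat list"
  where "switch_word d e = concat (map (\<lambda>j. rev [j..<d + j]) [1..<e + 1])"

definition switch :: "'k::field \<Rightarrow> nat list \<Rightarrow> nat list \<Rightarrow> (nat list \<times> nat list \<Rightarrow>\<^sub>0 'k)"
  where "switch q u v =
    split (length v) (act q (switch_word (length u) (length v)) (bas (u @ v)))"


section \<open>The functors \<open>B\<^sub>d\<close>\<close>

type_synonym Bidx = "(nat \<times> nat \<times> nat) \<times> (nat list \<times> nat list \<times> nat list)"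

definition B :: "'k::field \<Rightarrow> nat \<Rightarrow> (Bidx, 'k) pfunctor"
  where "B q d = dsum_functor d {(\<alpha>1, \<alpha>2, \<alpha>3). \<alpha>1 + \<alpha>2 + \<alpha>3 = d}
    (\<lambda>(\<alpha>1, \<alpha>2, \<alpha>3). tens_functor q (Sq q \<alpha>1) (tens_functor q (Sq q \<alpha>2) (Sq q \<alpha>3)))"

definition B_deg :: "nat \<times> nat \<times> nat \<Rightarrow> nat"
  where "B_deg = (\<lambda>(\<alpha>1, \<alpha>2, \<alpha>3). \<alpha>2 + 2 * \<alpha>3)"

definition B_grading :: "'k::field \<Rightarrow> nat \<Rightarrow> nat \<Rightarrow> nat \<Rightarrow> (Bidx \<Rightarrow>\<^sub>0 'k) set"
  where "B_grading q d i n =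
    {x + r |x r. x \<in> free {(\<alpha>, t) \<in> gens (obj (B q d) n). B_deg \<alpha> = i} \<and> r \<in> rels (obj (B q d) n)}"

definition B_delta1 :: "'k::field \<Rightarrow> Bidx \<Rightarrow> (Bidx \<Rightarrow>\<^sub>0 'k)"
  where "B_delta1 q = (\<lambda>((\<alpha>1, \<alpha>2, \<alpha>3), (u, v, w)).
    if \<alpha>1 = 0 then 0
    else lext (\<lambda>(u', x). bas ((\<alpha>1 - 1, \<alpha>2 + 1, \<alpha>3), (u', x @ v, w))) (Delta q u))"

definition B_delta2 :: "'k::field \<Rightarrow> Bidx \<Rightarrow> (Bidx \<Rightarrow>\<^sub>0 'k)"
  where "B_delta2 q = (\<lambda>((\<alpha>1, \<alpha>2, \<alpha>3), (u, v, w)).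
    if \<alpha>2 = 0 then 0
    else lext (\<lambda>(v', x). bas ((\<alpha>1, \<alpha>2 - 1, \<alpha>3 + 1), (u, v', x @ w))) (Delta q v))"

definition B_delta :: "'k::field \<Rightarrow> (Bidx \<Rightarrow>\<^sub>0 'k) \<Rightarrow> (Bidx \<Rightarrow>\<^sub>0 'k)"
  where "B_delta q = lext (\<lambda>((\<alpha>1, \<alpha>2, \<alpha>3), t).
    B_delta1 q ((\<alpha>1, \<alpha>2, \<alpha>3), t) + (q\<^sup>2) ^ \<alpha>2 *\<^sub>v B_delta2 q ((\<alpha>1, \<alpha>2, \<alpha>3), t))"

text \<open>In \<open>B_mu\<close>, the three nested extensions are the switches \<open>r\<^sub>1\<close>, \<open>r\<^sub>2\<close>, \<open>r\<^sub>3\<close>, and the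
  primes on a variable count the switches applied to it.\<close>

definition B_mu :: "'k::field \<Rightarrow> (Bidx \<times> Bidx \<Rightarrow>\<^sub>0 'k) \<Rightarrow> (Bidx \<Rightarrow>\<^sub>0 'k)"
  where "B_mu q = lext (\<lambda>(((\<alpha>1, \<alpha>2, \<alpha>3), (a1, a2, a3)), ((\<beta>1, \<beta>2, \<beta>3), (b1, b2, b3))).
    q ^ ((\<alpha>2 + \<alpha>3) * \<beta>1) *\<^sub>v
      lext (\<lambda>(b1', a3').
        lext (\<lambda>(b1'', a2').
          lext (\<lambda>(b2', a3'').
            bas ((\<alpha>1 + \<beta>1, \<alpha>2 + \<beta>2, \<alpha>3 + \<beta>3), (a1 @ b1'', a2' @ b2', a3'' @ b3)))
          (switch q a3' b2))
        (switch q a2 b1'))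
      (switch q a3 b1))"

definition B_unit :: "(nat list \<Rightarrow>\<^sub>0 'k::field) \<Rightarrow> (Bidx \<Rightarrow>\<^sub>0 'k)"
  where "B_unit = lext (\<lambda>w. bas ((0, 0, 0), (w, [], [])))"

definition B_tens_delta :: "'k::field \<Rightarrow> (Bidx \<times> Bidx \<Rightarrow>\<^sub>0 'k) \<Rightarrow> (Bidx \<times> Bidx \<Rightarrow>\<^sub>0 'k)"
  where "B_tens_delta q = lext (\<lambda>((\<alpha>, s), (\<beta>, t)).
    B_delta q (bas (\<alpha>, s)) \<otimes> bas (\<beta>, t) +
    q ^ (2 * B_deg \<alpha>) *\<^sub>v (bas (\<alpha>, s) \<otimes> B_delta q (bas (\<beta>, t))))"

end

theory Submission
  imports Defs
begin

text \<open>Every space in sight is a quotient of a tensor power by the relations \<open>x T_i = q x\<close> for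
  \<open>i\<close> in some set of indices. The summand \<open>(a, b, c)\<close> of \<open>B_d\<close> is obtained in this way from the
  indices inside three consecutive blocks of lengths \<open>a\<close>, \<open>b\<close>, \<open>c\<close> (\<open>blocks\<close>, \<open>rels_B\<close>), and a
  morphism acts on it as on the tensor power, because a sum of tensors of morphisms that equals
  \<open>\<phi>\<close> reassembles to \<open>\<phi>\<close>, whichever sum is chosen (\<open>mor_B_pack\<close>; that there is one is
  \<open>decomposes_exists\<close>). The product and the differential are right actions of Hecke algebra
  elements followed by a change of the labels (\<open>B_mu_pack\<close>, \<open>B_delta_pack\<close>). So they commute with
  morphisms, and what remains are identities between Hecke operators.

  The product acts by a positive braid that interleaves two triples of blocks. It carries each
  block rigidly to its place, so it respects the relations (\<open>shuf_blocks\<close>), and it is associative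
  because the two ways to interleave three triples use the same block crossings up to
  commutations and one Yang-Baxter move (\<open>shuf_assoc\<close>). It is surjective because each \<open>T_i\<close> is
  invertible (\<open>act_surj\<close>) and every triple of block lengths splits into two of given sums.

  For the Leibniz rule, the coproduct of a product of two blocks has two parts, according to the
  factor from which the last letter is taken (\<open>coproduct_add\<close>). A letter of the left factor gives
  the same braid on both sides. A letter of the right factor crosses a block on one side only and
  is then multiplied into that block, where each generator acts as \<open>q\<close>; the resulting scalar and
  the powers of \<open>q\<close> in the definitions of the product and the differential agree up to a power of
  \<open>q^3 = 1\<close> (\<open>leibniz_1_right\<close>, \<open>leibniz_2_right\<close>).

  The exponential property holds because \<open>T\<close> merely exchanges two letters in increasing order.
  If all letters of \<open>a\<close> are smaller than all letters of \<open>b\<close>, then the product of \<open>a\<close> and \<open>b\<close> is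
  the concatenation in each of the three blocks, up to a power of \<open>q\<close>. Conversely, the relations
  say that letters \<open>k < l\<close> satisfy \<open>e_l e_k = q e_k e_l\<close>, so the small letters of a word can be
  moved to its front at the price of one factor \<open>q\<close> per inversion; this gives the inverse
  (\<open>separate\<close>).\<close>


section \<open>Linear maps between free vector spaces\<close>

lemma lin_iff:
  fixes f :: "('i \<Rightarrow>\<^sub>0 'k::field) \<Rightarrow> ('j \<Rightarrow>\<^sub>0 'k)"
  shows "lin f \<longleftrightarrow> (\<forall>x y. f (x + y) = f x + f y) \<and> (\<forall>c x. f (c *\<^sub>v x) = c *\<^sub>v f x)"
  by (simp add: Vector_Spaces.linear_def module_hom_def module_hom_axioms_def
      pm.vector_space_axioms pm.module_axioms)

lemma linI: "(\<And>x y. f (x + y) = f x + f y) \<Longrightarrow> (\<And>c x. f (c *\<^sub>v x) = c *\<^sub>v f x) \<Longrightarrow> lin f"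
  by (simp add: lin_iff)

lemma lin_add: "lin f \<Longrightarrow> f (x + y) = f x + f y"
  and lin_scale: "lin f \<Longrightarrow> f (c *\<^sub>v x) = c *\<^sub>v f x"
  by (simp_all add: lin_iff)

lemma lin_zero: "lin f \<Longrightarrow> f 0 = 0"
  using lin_scale[of f 0 0] by simp

lemma lin_diff: "lin f \<Longrightarrow> f (x - y) = f x - f y"
  using lin_add[of f "x - y" y] by simp

lemma lin_sum: "lin f \<Longrightarrow> f (\<Sum>i\<in>I. g i) = (\<Sum>i\<in>I. f (g i))"
  by (induction I rule: infinite_finite_induct) (simp_all add: lin_zero lin_add)

lemma lin_sum_list: "lin f \<Longrightarrow> f (\<Sum>i\<leftarrow>xs. g i) = (\<Sum>i\<leftarrow>xs. f (g i))"
  by (induction xs) (simp_all add: lin_zero lin_add)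

lemmas lin_simps = lin_add lin_scale lin_zero lin_diff lin_sum lin_sum_list

named_theorems lin_intros

lemma lin_ident [lin_intros]: "lin (\<lambda>x. x)"
  and lin_null [lin_intros]: "lin (\<lambda>x. 0)"
  and lin_plus [lin_intros]: "lin f \<Longrightarrow> lin g \<Longrightarrow> lin (\<lambda>x. f x + g x)"
  and lin_minus [lin_intros]: "lin f \<Longrightarrow> lin g \<Longrightarrow> lin (\<lambda>x. f x - g x)"
  and lin_scaled [lin_intros]: "lin f \<Longrightarrow> lin (\<lambda>x. c *\<^sub>v f x)"
  by (simp_all add: lin_iff algebra_simps pm.scale_right_distrib pm.scale_right_diff_distrib)

lemma lin_sum_fun [lin_intros]: "(\<And>i. i \<in> I \<Longrightarrow> lin (f i)) \<Longrightarrow> lin (\<lambda>x. \<Sum>i\<in>I. f i x)"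
  by (induction I rule: infinite_finite_induct) (auto intro: lin_intros)

lemma lin_sum_list_fun [lin_intros]:
  "(\<And>i. i \<in> set xs \<Longrightarrow> lin (f i)) \<Longrightarrow> lin (\<lambda>x. \<Sum>i\<leftarrow>xs. f i x)"
  by (induction xs) (auto intro: lin_intros)

lemma lin_compose: "lin g \<Longrightarrow> lin f \<Longrightarrow> lin (\<lambda>x. g (f x))"
  by (simp add: lin_iff)

lemma lext_superset:
  assumes "finite S" "Poly_Mapping.keys x \<subseteq> S"
  shows "lext f x = (\<Sum>i\<in>S. Poly_Mapping.lookup x i *\<^sub>v f i)"
  unfolding lext_def using assms
  by (intro sum.mono_neutral_left) (auto simp: in_keys_iff)

lemma lin_lext:
  fixes f :: "'i \<Rightarrow> ('j \<Rightarrow>\<^sub>0 'k::field)"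
  shows "lin (lext f)"
proof (rule linI)
  fix x y :: "'i \<Rightarrow>\<^sub>0 'k" and c
  let ?S = "Poly_Mapping.keys x \<union> Poly_Mapping.keys y"
  have "Poly_Mapping.keys (x + y) \<subseteq> ?S"
    by (rule Poly_Mapping.keys_add)
  then show "lext f (x + y) = lext f x + lext f y"
    by (simp add: lext_superset[of ?S] lookup_add pm.scale_left_distrib sum.distrib)
  have "Poly_Mapping.keys (c *\<^sub>v x) \<subseteq> Poly_Mapping.keys x"
    by (auto simp: in_keys_iff lookup_scale)
  then show "lext f (c *\<^sub>v x) = c *\<^sub>v lext f x"
    by (simp add: lext_superset[of "Poly_Mapping.keys x"] lookup_scale pm.scale_sum_right)
qed

lemma lin_lext' [lin_intros]: "lin g \<Longrightarrow> lin (\<lambda>x. lext f (g x))"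
  by (rule lin_compose[OF lin_lext])

lemma lookup_bas: "Poly_Mapping.lookup (bas i :: _ \<Rightarrow>\<^sub>0 'k::field) j = (if i = j then 1 else 0)"
  by (simp add: bas_def lookup_single when_def)

lemma keys_bas [simp]: "Poly_Mapping.keys (bas i :: _ \<Rightarrow>\<^sub>0 'k::field) = {i}"
  by (simp add: bas_def)

lemma lext_bas [simp]: "lext f (bas i) = f i"
  by (simp add: lext_def lookup_bas)

lemma lext_bas_id: "lext bas x = x"
  by (rule poly_mapping_eqI)
    (simp add: lext_def lookup_sum lookup_scale lookup_bas in_keys_iff if_distrib cong: if_cong)

lemma lin_eq_lext:
  assumes "lin f"
  shows "f x = lext (\<lambda>i. f (bas i)) x"
proof -
  have "f (lext bas x) = lext (\<lambda>i. f (bas i)) x"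
    unfolding lext_def using assms by (simp add: lin_simps)
  then show ?thesis
    by (simp add: lext_bas_id)
qed

lemma bas_in_free [simp]: "(bas i :: _ \<Rightarrow>\<^sub>0 'k::field) \<in> free A \<longleftrightarrow> i \<in> A"
  by (simp add: free_def)

lemma subspace_free: "pm.subspace (free A :: ('i \<Rightarrow>\<^sub>0 'k::field) set)"
proof (rule pm.subspaceI)
  fix x y :: "'i \<Rightarrow>\<^sub>0 'k" and c
  assume "x \<in> free A"
  then show "c *\<^sub>v x \<in> free A"
    by (auto simp: free_def in_keys_iff lookup_scale)
  assume "y \<in> free A"
  then show "x + y \<in> free A"
    using \<open>x \<in> free A\<close> Poly_Mapping.keys_add[of x y] by (auto simp: free_def)
qed (simp add: free_def)

lemma free_mono: "A \<subseteq> A' \<Longrightarrow> free A \<subseteq> free A'"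
  by (auto simp: free_def)

lemma subspace_zero_only: "pm.subspace {0}"
  by (simp add: pm.subspace_single_0)

lemma lin_free_in_subspace:
  assumes "lin f" "pm.subspace R" "\<And>a. a \<in> A \<Longrightarrow> f (bas a) \<in> R" "x \<in> free A"
  shows "f x \<in> R"
proof -
  have "f x = (\<Sum>i\<in>Poly_Mapping.keys x. Poly_Mapping.lookup x i *\<^sub>v f (bas i))"
    by (subst lin_eq_lext[OF assms(1)]) (simp add: lext_def)
  also have "\<dots> \<in> R"
    using assms by (intro pm.subspace_sum pm.subspace_scale) (auto simp: free_def)
  finally show ?thesis .
qed

lemma lin_eq_on_free:
  assumes "lin f" "lin g" "\<And>a. a \<in> A \<Longrightarrow> f (bas a) = g (bas a)" "x \<in> free A"
  shows "f x = g x"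
proof -
  have "f x - g x \<in> {0}"
    by (rule lin_free_in_subspace[where f = "\<lambda>x. f x - g x" and A = A])
      (use assms in \<open>auto intro: lin_minus subspace_zero_only\<close>)
  then show ?thesis
    by simp
qed

lemma lin_ext:
  assumes "lin f" "lin g" "\<And>a. f (bas a) = g (bas a)"
  shows "f x = g x"
  by (rule lin_eq_on_free[where A = UNIV]) (use assms in \<open>auto simp: free_def\<close>)

lemma lin_span_in_subspace:
  assumes "lin f" "pm.subspace R" "\<And>a. a \<in> S \<Longrightarrow> f a \<in> R" "x \<in> pm.span S"
  shows "f x \<in> R"
  using assms(4)
proof (induction rule: pm.span_induct_alt)
  case base
  then show ?case
    using assms by (simp add: lin_zero pm.subspace_0)
next
  case (step c x y)
  then show ?case
    using assms by (simp add: lin_simps pm.subspace_add pm.subspace_scale)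
qed

text \<open>Two linear arguments at once: the form in which maps out of a tensor product are
  determined by their values on bases of the factors.\<close>

lemma bilin_free_in_subspace:
  assumes "\<And>y. lin (\<lambda>x. f x y)" "\<And>x. lin (f x)" "pm.subspace R"
    and "\<And>a b. a \<in> A \<Longrightarrow> b \<in> A' \<Longrightarrow> f (bas a) (bas b) \<in> R" "x \<in> free A" "y \<in> free A'"
  shows "f x y \<in> R"
proof (rule lin_free_in_subspace[where f = "\<lambda>x. f x y", OF assms(1,3) _ assms(5)])
  fix a assume "a \<in> A"
  then show "f (bas a) y \<in> R"
    by (intro lin_free_in_subspace[where f = "f (bas a)", OF assms(2,3) _ assms(6)] assms(4))
qed

lemma bilin_eq_on_free:
  assumes "\<And>y. lin (\<lambda>x. f x y)" "\<And>x. lin (f x)" "\<And>y. lin (\<lambda>x. g x y)" "\<And>x. lin (g x)"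
    and "\<And>a b. a \<in> A \<Longrightarrow> b \<in> A' \<Longrightarrow> f (bas a) (bas b) = g (bas a) (bas b)"
    and "x \<in> free A" "y \<in> free A'"
  shows "f x y = g x y"
proof (rule lin_eq_on_free[where f = "\<lambda>x. f x y" and g = "\<lambda>x. g x y", OF assms(1,3) _ assms(6)])
  fix a assume "a \<in> A"
  then show "f (bas a) y = g (bas a) y"
    by (intro lin_eq_on_free[where f = "f (bas a)" and g = "g (bas a)", OF assms(2,4) _ assms(7)]
        assms(5))
qed

lemma bilin_ext:
  assumes "\<And>y. lin (\<lambda>x. f x y)" "\<And>x. lin (f x)" "\<And>y. lin (\<lambda>x. g x y)" "\<And>x. lin (g x)"
    and "\<And>a b. f (bas a) (bas b) = g (bas a) (bas b)"
  shows "f x y = g x y"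
  by (rule bilin_eq_on_free[where f = f and g = g and A = UNIV and A' = UNIV, OF assms(1-4)])
    (auto simp: assms(5) free_def)

lemma lin_tens_left [lin_intros]: "lin f \<Longrightarrow> lin (\<lambda>x. f x \<otimes> y)"
  unfolding tens_def by (intro lin_intros)

lemma lin_lext_param:
  "(\<And>i. lin (\<lambda>x. F x i)) \<Longrightarrow> lin (\<lambda>x. lext (F x) z)"
  unfolding lext_def by (intro lin_intros)

lemma lin_tens_right [lin_intros]: "lin f \<Longrightarrow> lin (\<lambda>y. x \<otimes> f y)"
  unfolding tens_def by (rule lin_lext_param) (rule lin_lext')

lemma tens_bas [simp]: "bas i \<otimes> bas j = bas (i, j)"
  by (simp add: tens_def)

lemma tens_zero [simp]: "0 \<otimes> y = 0" "x \<otimes> 0 = 0"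
  using lin_zero[OF lin_tens_left[OF lin_ident]] lin_zero[OF lin_tens_right[OF lin_ident]]
  by auto

lemma tens_in_free: "x \<in> free A \<Longrightarrow> y \<in> free A' \<Longrightarrow> x \<otimes> y \<in> free (A \<times> A')"
  by (rule bilin_free_in_subspace[where f = "(\<otimes>)" and A = A and A' = A'])
    (auto intro!: lin_intros subspace_free)

lemma lin_tens_map [lin_intros]: "lin h \<Longrightarrow> lin (\<lambda>x. tens_map f g (h x))"
  unfolding tens_map_def by (intro lin_intros)

lemma tens_map_tens:
  assumes "lin f" "lin g"
  shows "tens_map f g (x \<otimes> y) = f x \<otimes> g y"
  by (rule bilin_ext[where f = "\<lambda>x y. tens_map f g (x \<otimes> y)"])
    (simp_all add: tens_map_def lin_intros lin_lext' assms)

lemma tens_map_bas: "tens_map f g (bas (i, j)) = f (bas i) \<otimes> g (bas j)"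
  by (simp add: tens_map_def)

lemma lin_dinj [lin_intros]: "lin f \<Longrightarrow> lin (\<lambda>x. dinj a (f x))"
  unfolding dinj_def by (intro lin_intros)

lemma dinj_bas [simp]: "dinj a (bas i) = bas (a, i)"
  by (simp add: dinj_def)


section \<open>Positive braid words\<close>

text \<open>Index lists are compared before they are interpreted as operators. As both sides of a relation
  have the same set of indices, the range of the indices has to be checked only once, when a word
  is made to act.\<close>

inductive braid_eq :: "nat list \<Rightarrow> nat list \<Rightarrow> bool" where
  reflexive: "braid_eq is is"
| symmetric: "braid_eq is js \<Longrightarrow> braid_eq js is"
| transitive: "braid_eq is js \<Longrightarrow> braid_eq js ks \<Longrightarrow> braid_eq is ks"
| far_commute: "i + 2 \<le> j \<Longrightarrow> braid_eq (us @ [i, j] @ vs) (us @ [j, i] @ vs)"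
| braid_move: "braid_eq (us @ [i, Suc i, i] @ vs) (us @ [Suc i, i, Suc i] @ vs)"

lemma braid_eq_set: "braid_eq is js \<Longrightarrow> set is = set js"
  by (induction rule: braid_eq.induct) auto

lemma braid_eq_context: "braid_eq is js \<Longrightarrow> braid_eq (us @ is @ vs) (us @ js @ vs)"
proof (induction rule: braid_eq.induct)
  case (far_commute i j us' vs')
  then show ?case
    using braid_eq.far_commute[of i j "us @ us'" "vs' @ vs"] by simp
next
  case (braid_move us' i vs')
  then show ?case
    using braid_eq.braid_move[of "us @ us'" i "vs' @ vs"] by simp
qed (blast intro: braid_eq.intros)+

lemma braid_eq_append: "braid_eq is is' \<Longrightarrow> braid_eq js js' \<Longrightarrow> braid_eq (is @ js) (is' @ js')"
  using braid_eq_context[of "is" is' "[]" js] braid_eq_context[of js js' is' "[]"]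
  by (auto intro: braid_eq.transitive)

text \<open>Passing to the monoid of braid words modulo \<open>braid_eq\<close> turns congruence reasoning into
  equational reasoning.\<close>

quotient_type braid = "nat list" / braid_eq
  by (rule equivpI)
    (auto intro!: reflpI sympI transpI intro: braid_eq.reflexive braid_eq.symmetric braid_eq.transitive)

instantiation braid :: monoid_mult
begin

lift_definition times_braid :: "braid \<Rightarrow> braid \<Rightarrow> braid" is append
  by (rule braid_eq_append)

lift_definition one_braid :: braid is "[]" .

instance
  by standard (transfer, simp add: braid_eq.reflexive)+

end

lift_definition braid_of :: "nat list \<Rightarrow> braid" is "\<lambda>is. is" .

lemma braid_of_append: "braid_of (is @ js) = braid_of is * braid_of js"
  by transfer (simp add: braid_eq.reflexive)

lemma braid_of_Nil: "braid_of [] = 1"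
  by transfer (simp add: braid_eq.reflexive)

lemma braid_of_Cons: "braid_of (i # is) = braid_of [i] * braid_of is"
  using braid_of_append[of "[i]" "is"] by simp

lemma braid_of_eq_iff: "braid_of is = braid_of js \<longleftrightarrow> braid_eq is js"
  by transfer simp

lemma braid_of_far: "i + 2 \<le> j \<or> j + 2 \<le> i \<Longrightarrow> braid_of [i] * braid_of [j] = braid_of [j] * braid_of [i]"
  unfolding braid_of_append[symmetric] braid_of_eq_iff
  using braid_eq.far_commute[of i j "[]" "[]"] braid_eq.far_commute[of j i "[]" "[]"] braid_eq.symmetric by auto

lemma braid_of_braid:
  "braid_of [i] * (braid_of [Suc i] * braid_of [i]) = braid_of [Suc i] * (braid_of [i] * braid_of [Suc i])"
  unfolding braid_of_append[symmetric] braid_of_eq_iff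
  using braid_eq.braid_move[of "[]" i "[]"] by simp

lemma braid_of_intertwine:
  assumes "\<And>i. i \<in> set is \<Longrightarrow> braid_of [i] * b = b * braid_of [f i]"
  shows "braid_of is * b = b * braid_of (map f is)"
  using assms
proof (induction "is")
  case (Cons i "is")
  have IH: "braid_of is * b = b * braid_of (map f is)" and i: "braid_of [i] * b = b * braid_of [f i]"
    using Cons by auto
  have "braid_of (i # is) * b = braid_of [i] * b * braid_of (map f is)"
    by (simp only: braid_of_Cons[of i "is"] mult.assoc IH)
  also have "\<dots> = b * braid_of (map f (i # is))"
    by (simp only: i list.map braid_of_Cons[of "f i" "map f is"] mult.assoc)
  finally show ?case .
qed (simp add: braid_of_Nil)

lemma braid_of_far_words:
  assumes "\<And>i j. i \<in> set is \<Longrightarrow> j \<in> set js \<Longrightarrow> i + 2 \<le> j \<or> j + 2 \<le> i"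
  shows "braid_of is * braid_of js = braid_of js * braid_of is"
proof -
  have *: "braid_of [i] * braid_of js = braid_of js * braid_of [i]" if "i \<in> set is" for i
    using braid_of_intertwine[of js "braid_of [i]" "\<lambda>j. j"] assms[OF that]
    by (simp add: braid_of_far)
  show ?thesis
    using braid_of_intertwine[of "is" "braid_of js" "\<lambda>i. i"] * by simp
qed


section \<open>Crossings of two blocks of strands\<close>

text \<open>The positive braid in which the \<open>d\<close> strands after the first \<open>p\<close> pass the next \<open>e\<close> strands, as a
  word in the generators; for \<open>p = 0\<close> it is the word of the switch.\<close>

primrec cross :: "nat \<Rightarrow> nat \<Rightarrow> nat \<Rightarrow> nat list" where
  "cross p d 0 = []"
| "cross p d (Suc e) = cross p d e @ rev [p + e + 1..<p + e + d + 1]"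

lemma cross_switch_word: "cross p d e = map ((+) p) (switch_word d e)"
proof (induction e)
  case (Suc e)
  have "map ((+) p) [Suc e..<d + Suc e] = [p + e + 1..<p + e + d + 1]"
    by (rule nth_equalityI) (simp_all del: upt_Suc)
  moreover have "switch_word d (Suc e) = switch_word d e @ rev [Suc e..<d + Suc e]"
    using upt_Suc_append[of 1 "e + 1"] by (simp add: switch_word_def del: upt_Suc)
  ultimately show ?case
    using Suc by (simp only: map_append rev_map[symmetric] cross.simps)
qed (simp add: switch_word_def)

lemma switch_word_cross: "switch_word d e = cross 0 d e"
  by (simp add: cross_switch_word map_idI)

lemma set_cross: "i \<in> set (cross p d e) \<Longrightarrow> p < i \<and> i < p + d + e"
  by (induction e) auto

lemma cross_0_left [simp]: "cross p 0 e = []"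
  by (induction e) auto

lemma cross_Suc_0_left: "cross p (Suc 0) e = [p + 1..<p + e + 1]"
  by (induction e) auto

lemma cross_add_right: "cross p d (e + f) = cross p d e @ cross (p + e) d f"
  by (induction f) (auto simp: add_ac)

lemma rev_upt_append: "a \<le> b \<Longrightarrow> b \<le> c \<Longrightarrow> rev [a..<c] = rev [b..<c] @ rev [a..<b]"
  by (metis le_Suc_ex rev_append upt_add_eq_append)

text \<open>With \<open>cross_add_right\<close> this is the pair of hexagon identities. The definition of \<open>cross\<close> moves the
  \<open>e\<close> strands one after another, so one of the two is immediate; here the inner and outer parts of
  successive moves have to be commuted past each other.\<close>

lemma cross_add_left:
  "braid_of (cross p (d + d') e) = braid_of (cross (p + d) d' e) * braid_of (cross p d e)"
proof (induction e)
  case (Suc e)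
  let ?l = "cross (p + d) d' e" and ?r = "cross p d e"
  let ?l1 = "rev [p + e + d + 1..<p + e + d + d' + 1]" and ?r1 = "rev [p + e + 1..<p + e + d + 1]"
  have "braid_of (cross p (d + d') (Suc e)) = braid_of ?l * (braid_of ?r * braid_of ?l1) * braid_of ?r1"
    using Suc rev_upt_append[of "p + e + 1" "p + e + d + 1" "p + e + d + d' + 1"]
    by (simp add: braid_of_append mult.assoc add_ac)
  also have "braid_of ?r * braid_of ?l1 = braid_of ?l1 * braid_of ?r"
    by (rule braid_of_far_words) (auto dest: set_cross)
  finally show ?case
    by (simp add: braid_of_append mult.assoc add_ac)
qed (simp add: braid_of_Nil)

text \<open>Everything in the run except the generators \<open>i + 1\<close> and \<open>i\<close> commutes with one side or the other,
  and on these two the braid relation applies.\<close>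

lemma descending_run_shift:
  assumes "a \<le> i" "i + 1 < b"
  shows "braid_of [i] * braid_of (rev [a..<b]) = braid_of (rev [a..<b]) * braid_of [Suc i]"
proof -
  let ?u = "braid_of (rev [i + 2..<b])" and ?v = "braid_of (rev [a..<i])"
  have "rev [a..<b] = rev [i + 2..<b] @ rev [i..<i + 2] @ rev [a..<i]"
    using assms rev_upt_append[of a i b] rev_upt_append[of i "i + 2" b] by simp
  moreover have "rev [i..<i + 2] = [Suc i] @ [i]"
    by (simp add: upt_rec)
  ultimately have run: "braid_of (rev [a..<b]) = ?u * (braid_of [Suc i] * (braid_of [i] * ?v))"
    by (simp only: braid_of_append mult.assoc)
  have u: "braid_of [i] * ?u = ?u * braid_of [i]"
    by (rule braid_of_far_words) auto
  have v: "braid_of [Suc i] * ?v = ?v * braid_of [Suc i]"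
    by (rule braid_of_far_words) auto
  have "braid_of [i] * braid_of (rev [a..<b])
      = ?u * ((braid_of [i] * (braid_of [Suc i] * braid_of [i])) * ?v)"
    using u unfolding run by (metis mult.assoc)
  also have "\<dots> = ?u * (braid_of [Suc i] * (braid_of [i] * (braid_of [Suc i] * ?v)))"
    unfolding braid_of_braid by (simp only: mult.assoc)
  also have "\<dots> = braid_of (rev [a..<b]) * braid_of [Suc i]"
    unfolding run v by (simp only: mult.assoc)
  finally show ?thesis .
qed

lemma ascending_run_shift:
  assumes "a \<le> i" "i + 1 < b"
  shows "braid_of [Suc i] * braid_of [a..<b] = braid_of [a..<b] * braid_of [i]"
proof -
  let ?u = "braid_of [a..<i]" and ?v = "braid_of [i + 2..<b]"
  have "[a..<b] = [a..<i] @ [i] @ [Suc i] @ [i + 2..<b]"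
    using assms by (metis Suc_eq_plus1 add_2_eq_Suc' append_Cons append_Nil le_Suc_ex lessI
        less_imp_le_nat order.strict_trans upt_add_eq_append upt_conv_Cons)
  then have run: "braid_of [a..<b] = ?u * (braid_of [i] * (braid_of [Suc i] * ?v))"
    by (simp only: braid_of_append)
  have u: "braid_of [Suc i] * ?u = ?u * braid_of [Suc i]"
    by (rule braid_of_far_words) auto
  have v: "braid_of [i] * ?v = ?v * braid_of [i]"
    by (rule braid_of_far_words) auto
  have "braid_of [Suc i] * braid_of [a..<b]
      = ?u * ((braid_of [Suc i] * (braid_of [i] * braid_of [Suc i])) * ?v)"
    using u unfolding run by (metis mult.assoc)
  also have "\<dots> = ?u * (braid_of [i] * (braid_of [Suc i] * (braid_of [i] * ?v)))"
    unfolding braid_of_braid[symmetric] by (simp only: mult.assoc)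
  also have "\<dots> = braid_of [a..<b] * braid_of [i]"
    unfolding run v by (simp only: mult.assoc)
  finally show ?thesis .
qed

lemma cross_left_block:
  assumes "\<And>i. i \<in> set is \<Longrightarrow> p < i \<and> i < p + d"
  shows "braid_of is * braid_of (cross p d e) = braid_of (cross p d e) * braid_of (map (\<lambda>i. i + e) is)"
proof (rule braid_of_intertwine)
  fix i assume "i \<in> set is"
  then have i: "p < i" "i < p + d"
    using assms by auto
  show "braid_of [i] * braid_of (cross p d e) = braid_of (cross p d e) * braid_of [i + e]"
  proof (induction e)
    case (Suc e)
    have "braid_of [i + e] * braid_of (rev [p + e + 1..<p + e + d + 1])
      = braid_of (rev [p + e + 1..<p + e + d + 1]) * braid_of [Suc (i + e)]"
      by (rule descending_run_shift) (use i in auto)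
    with Suc show ?case
      by (simp only: cross.simps braid_of_append add_Suc_right) (metis mult.assoc)
  qed (simp add: braid_of_Nil)
qed

lemma cross_right_block:
  assumes "\<And>i. i \<in> set is \<Longrightarrow> p + d < i \<and> i < p + d + e"
  shows "braid_of is * braid_of (cross p d e) = braid_of (cross p d e) * braid_of (map (\<lambda>i. i - d) is)"
proof (rule braid_of_intertwine)
  fix i assume "i \<in> set is"
  then have "p + d < i" "i < p + d + e"
    using assms by auto
  then show "braid_of [i] * braid_of (cross p d e) = braid_of (cross p d e) * braid_of [i - d]"
  proof (induction d arbitrary: i)
    case (Suc d)
    let ?l = "cross (p + d) (Suc 0) e"
    have split: "braid_of (cross p (Suc d) e) = braid_of ?l * braid_of (cross p d e)"
      using cross_add_left[of p d "Suc 0" e] by simp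
    have "braid_of [Suc (i - 1)] * braid_of ?l = braid_of ?l * braid_of [i - 1]"
      unfolding cross_Suc_0_left by (rule ascending_run_shift) (use Suc.prems in auto)
    moreover have "braid_of [i - 1] * braid_of (cross p d e) = braid_of (cross p d e) * braid_of [i - 1 - d]"
      using Suc by auto
    ultimately show ?case
      using Suc.prems unfolding split by simp (metis mult.assoc)
  qed (simp add: braid_of_Nil)
qed

text \<open>The crossings of \<open>a\<close> with \<open>b\<close> and with \<open>c\<close> form a single crossing with a block of \<open>b + c\<close>
  strands, and the crossing of \<open>b\<close> with \<open>c\<close> takes place inside this block, which is carried along.\<close>

lemma cross_Yang_Baxter:
  "braid_of (cross p a b) * (braid_of (cross (p + b) a c) * braid_of (cross p b c))
   = braid_of (cross (p + a) b c) * (braid_of (cross p a c) * braid_of (cross (p + c) a b))"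
proof -
  have *: "map (\<lambda>i. i - a) (cross (p + a) b c) = cross p b c"
    unfolding cross_switch_word by (simp add: o_def)
  have "braid_of (cross p a b) * (braid_of (cross (p + b) a c) * braid_of (cross p b c))
      = braid_of (cross p a (b + c)) * braid_of (cross p b c)"
    by (simp only: cross_add_right braid_of_append mult.assoc)
  also have "\<dots> = braid_of (cross (p + a) b c) * braid_of (cross p a (b + c))"
    using cross_right_block[of "cross (p + a) b c" p a "b + c"] set_cross[of _ "p + a" b c]
    by (simp add: * add.assoc)
  also have "\<dots> = braid_of (cross (p + a) b c) * (braid_of (cross p a c) * braid_of (cross (p + c) a b))"
    by (simp only: add.commute[of b c] cross_add_right braid_of_append mult.assoc)
  finally show ?thesis .
qed


section \<open>Shuffling two triples of blocks\<close>

text \<open>The braid of the product, taking blocks in the order \<open>a, b, c, e, f, g\<close> to the order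
  \<open>a, e, b, f, c, g\<close>. The block \<open>g\<close> stays where it is, so that its length is not a parameter.\<close>

definition shuf :: "nat \<Rightarrow> nat \<Rightarrow> nat \<Rightarrow> nat \<Rightarrow> nat \<Rightarrow> nat list"
  where "shuf a b c e f = cross (a + b) c e @ cross a b e @ cross (a + e + b) c f"

lemma set_shuf: "i \<in> set (shuf a b c e f) \<Longrightarrow> a < i \<and> i < a + b + c + e + f"
  by (auto simp: shuf_def dest!: set_cross)

lemma braid_of_shuf: "braid_of (shuf a b c e f)
  = braid_of (cross (a + b) c e) * (braid_of (cross a b e) * braid_of (cross (a + e + b) c f))"
  by (simp add: shuf_def braid_of_append)

lemma far_cross:
  assumes "i < p \<or> p + d + e < i"
  shows "braid_of [i] * braid_of (cross p d e) = braid_of (cross p d e) * braid_of [i]"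
  by (rule braid_of_far_words) (use assms in \<open>auto dest!: set_cross\<close>)

lemma cross_left_strand:
  "p < i \<Longrightarrow> i < p + d \<Longrightarrow> braid_of [i] * braid_of (cross p d e) = braid_of (cross p d e) * braid_of [i + e]"
  using cross_left_block[of "[i]" p d e] by simp

lemma cross_right_strand:
  "p + d < i \<Longrightarrow> i < p + d + e \<Longrightarrow> braid_of [i] * braid_of (cross p d e) = braid_of (cross p d e) * braid_of [i - d]"
  using cross_right_block[of "[i]" p d e] by simp

lemma push_through:
  fixes x u y v z :: "'m::monoid_mult"
  assumes "x * u = u * y" "y * v = v * z"
  shows "x * (u * v) = (u * v) * z"
  using assms by (metis mult.assoc)

lemma shuf_left_1:
  assumes "i < a"
  shows "braid_of [i] * braid_of (shuf a b c e f) = braid_of (shuf a b c e f) * braid_of [i]"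
  unfolding braid_of_shuf
  by (rule push_through[OF far_cross push_through[OF far_cross far_cross]]) (use assms in auto)

lemma shuf_left_2:
  assumes "a < i" "i < a + b"
  shows "braid_of [i] * braid_of (shuf a b c e f) = braid_of (shuf a b c e f) * braid_of [i + e]"
  unfolding braid_of_shuf
  by (rule push_through[OF far_cross push_through[OF cross_left_strand far_cross]]) (use assms in auto)

lemma shuf_left_3:
  assumes "a + b < i" "i < a + b + c"
  shows "braid_of [i] * braid_of (shuf a b c e f) = braid_of (shuf a b c e f) * braid_of [i + e + f]"
  unfolding braid_of_shuf
  by (rule push_through[OF cross_left_strand push_through[OF far_cross cross_left_strand]])
    (use assms in auto)

lemma shuf_right_1:
  assumes "a + b + c < i" "i < a + b + c + e"
  shows "braid_of [i] * braid_of (shuf a b c e f) = braid_of (shuf a b c e f) * braid_of [i - c - b]"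
  unfolding braid_of_shuf
  by (rule push_through[OF cross_right_strand push_through[OF cross_right_strand far_cross]])
    (use assms in auto)

lemma shuf_right_2:
  assumes "a + b + c + e < i" "i < a + b + c + e + f"
  shows "braid_of [i] * braid_of (shuf a b c e f) = braid_of (shuf a b c e f) * braid_of [i - c]"
  unfolding braid_of_shuf
  by (rule push_through[OF far_cross push_through[OF far_cross cross_right_strand]])
    (use assms in auto)

lemma shuf_right_3:
  assumes "a + b + c + e + f < i"
  shows "braid_of [i] * braid_of (shuf a b c e f) = braid_of (shuf a b c e f) * braid_of [i]"
  unfolding braid_of_shuf
  by (rule push_through[OF far_cross push_through[OF far_cross far_cross]]) (use assms in auto)

text \<open>The generators that act inside one of three consecutive blocks.\<close>

definition blocks :: "nat \<Rightarrow> nat \<Rightarrow> nat \<Rightarrow> nat set"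
  where "blocks a b c = {1..<a} \<union> {a + 1..<a + b} \<union> {a + b + 1..<a + b + c}"

text \<open>Neighbouring strands of a block are still neighbours afterwards. This is why the product is well
  defined on the quotients.\<close>

lemma shuf_blocks:
  assumes "i \<in> blocks a b c \<union> (+) (a + b + c) ` blocks e f g"
  shows "\<exists>j\<in>blocks (a + e) (b + f) (c + g).
    braid_of [i] * braid_of (shuf a b c e f) = braid_of (shuf a b c e f) * braid_of [j]"
proof -
  let ?B = "blocks (a + e) (b + f) (c + g)"
  consider "1 \<le> i" "i < a" | "a < i" "i < a + b" | "a + b < i" "i < a + b + c"
    | "a + b + c < i" "i < a + b + c + e" | "a + b + c + e < i" "i < a + b + c + e + f"
    | "a + b + c + e + f < i" "i < a + b + c + e + f + g"
    using assms by (auto simp: blocks_def)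
  then show ?thesis
  proof cases
    case 1
    then have "i \<in> ?B" by (auto simp: blocks_def)
    with 1 show ?thesis using shuf_left_1 by blast
  next
    case 2
    then have "i + e \<in> ?B" by (auto simp: blocks_def)
    with 2 show ?thesis using shuf_left_2 by blast
  next
    case 3
    then have "i + e + f \<in> ?B" by (auto simp: blocks_def)
    with 3 show ?thesis using shuf_left_3 by blast
  next
    case 4
    then have "i - c - b \<in> ?B" by (auto simp: blocks_def)
    with 4 show ?thesis using shuf_right_1 by blast
  next
    case 5
    then have "i - c \<in> ?B" by (auto simp: blocks_def)
    with 5 show ?thesis using shuf_right_2 by blast
  next
    case 6
    then have "i \<in> ?B" by (auto simp: blocks_def)
    with 6 show ?thesis using shuf_right_3 by blast
  qed
qed

text \<open>Interleaving three triples of blocks uses nine block crossings, performed in two orders. Three of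
  them are the crossings among the same three blocks, and their order is reversed by a Yang-Baxter
  move. All other changes of order concern crossings of disjoint pairs of blocks.\<close>

lemma rearrange_shuffles:
  fixes X1 :: "'m::monoid_mult"
  assumes YB: "X3 * (Y1 * Y2) = Z2 * (W1 * W3)"
    and Z1: "X1 * Z1 = Z1 * X1" "X2 * Z1 = Z1 * X2" "X3 * Z1 = Z1 * X3"
    and Z2: "X1 * Z2 = Z2 * X1" "X2 * Z2 = Z2 * X2"
    and Z3: "X1 * Z3 = Z3 * X1" "X2 * Z3 = Z3 * X2" "W1 * Z3 = Z3 * W1" "W3 * Z3 = Z3 * W3"
      "Y2' * Z3 = Z3 * Y2'"
    and W: "X2 * W1 = W1 * X2" "W3 * Y2' = Y2' * W3"
  shows "(X1 * (X2 * X3)) * ((Z1 * Y1) * ((Y2 * Y2') * (Z3 * Y3')))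
       = (Z1 * (Z2 * Z3)) * ((X1 * W1) * ((X2 * Y2') * (W3 * Y3')))"
proof -
  have swap: "x * (y * z) = y * (x * z)" if "x * y = y * x" for x y z :: 'm
    using that by (metis mult.assoc)
  have YB': "X3 * (Y1 * (Y2 * r)) = Z2 * (W1 * (W3 * r))" for r
    using YB by (metis mult.assoc)
  show ?thesis
    by (simp only: mult.assoc Z1 Z1[THEN swap] YB' Z2 Z2[THEN swap] Z3 Z3[THEN swap] W W[THEN swap])
qed

lemma far_crosses:
  "p + d + e \<le> p' \<Longrightarrow> braid_of (cross p d e) * braid_of (cross p' d' e') = braid_of (cross p' d' e') * braid_of (cross p d e)"
  "p + d + e \<le> p' \<Longrightarrow> braid_of (cross p' d' e') * braid_of (cross p d e) = braid_of (cross p d e) * braid_of (cross p' d' e')"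
  by (rule braid_of_far_words, fastforce dest!: set_cross)+

lemma map_shift_cross: "map ((+) s) (cross p d e) = cross (s + p) d e"
  unfolding cross_switch_word by (simp add: add.assoc)

lemma shuf_assoc:
  "braid_of (shuf a b c e f) * braid_of (shuf (a + e) (b + f) (c + g) h k)
   = braid_of (map ((+) (a + b + c)) (shuf e f g h k)) * braid_of (shuf a b c (e + h) (f + k))"
proof -
  define X1 X2 X3 where X: "X1 = braid_of (cross (a + b) c e)" "X2 = braid_of (cross a b e)"
    "X3 = braid_of (cross (a + e + b) c f)"
  define Z1 Z2 Z3 where Z: "Z1 = braid_of (cross (a + b + c + e + f) g h)"
    "Z2 = braid_of (cross (a + b + c + e) f h)" "Z3 = braid_of (cross (a + b + c + e + h + f) g k)"
  define Y1 Y2 where Y: "Y1 = braid_of (cross (a + e + b + f) c h)"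
    "Y2 = braid_of (cross (a + e + b) f h)"
  define Y2' Y3' where Y': "Y2' = braid_of (cross (a + e) b h)"
    "Y3' = braid_of (cross (a + e + h + b + f) c k)"
  define W1 W3 where W: "W1 = braid_of (cross (a + b + e) c h)"
    "W3 = braid_of (cross (a + e + h + b) c f)"
  note defs = X Z Y Y' W
  have "(X1 * (X2 * X3)) * ((Z1 * Y1) * ((Y2 * Y2') * (Z3 * Y3')))
      = (Z1 * (Z2 * Z3)) * ((X1 * W1) * ((X2 * Y2') * (W3 * Y3')))"
  proof (rule rearrange_shuffles)
    show "X3 * (Y1 * Y2) = Z2 * (W1 * W3)"
      unfolding defs using cross_Yang_Baxter[of "a + e + b" c f h] by (simp add: add_ac)
  qed (unfold defs, (rule far_crosses, simp)+)
  moreover have "braid_of (shuf a b c e f) = X1 * (X2 * X3)"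
    unfolding defs by (simp add: braid_of_shuf)
  moreover have "braid_of (shuf (a + e) (b + f) (c + g) h k) = (Z1 * Y1) * ((Y2 * Y2') * (Z3 * Y3'))"
    unfolding defs by (simp add: braid_of_shuf cross_add_left add_ac)
  moreover have "braid_of (map ((+) (a + b + c)) (shuf e f g h k)) = Z1 * (Z2 * Z3)"
    unfolding defs by (simp add: shuf_def map_shift_cross braid_of_append add_ac)
  moreover have "braid_of (shuf a b c (e + h) (f + k)) = (X1 * W1) * ((X2 * Y2') * (W3 * Y3'))"
    unfolding defs by (simp add: braid_of_shuf cross_add_right braid_of_append add_ac)
  ultimately show ?thesis
    by simp
qed

text \<open>The differential moves one strand from a block to the next. This and the three lemmas below compare
  the shuffles before and after such a move, for either factor and for either pair of blocks.\<close>

lemma shuf_shift_12_left: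
  "braid_of (shuf a (Suc b) c e f) = braid_of (shuf (Suc a) b c e f) * braid_of [Suc a..<Suc a + e]"
proof -
  have "braid_of (cross a (Suc b) e) = braid_of (cross (Suc a) b e) * braid_of [Suc a..<Suc a + e]"
    using cross_add_left[of a "Suc 0" b e] by (simp add: cross_Suc_0_left)
  moreover have "braid_of [Suc a..<Suc a + e] * braid_of (cross (Suc (a + e + b)) c f)
      = braid_of (cross (Suc (a + e + b)) c f) * braid_of [Suc a..<Suc a + e]"
    by (rule braid_of_far_words) (auto dest!: set_cross)
  ultimately show ?thesis
    by (simp add: braid_of_shuf mult.assoc del: upt_Suc)
qed

lemma shuf_shift_12_right:
  "braid_of (shuf a b c (Suc e) f) = braid_of (shuf a b c e (Suc f)) * braid_of (cross (a + e) b 1)"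
proof -
  define X Y u v w where defs: "X = braid_of (cross (a + b) c e)" "Y = braid_of (cross a b e)"
    "u = braid_of (cross (a + b + e) c 1)" "v = braid_of (cross (a + e) b 1)"
    "w = braid_of (cross (a + e + b + 1) c f)"
  have "braid_of (shuf a b c (Suc e) f) = (X * u) * ((Y * v) * w)"
    using cross_add_right[of "a + b" c e 1] cross_add_right[of a b e 1]
    unfolding defs braid_of_shuf by (simp add: braid_of_append add_ac del: cross.simps)
  moreover have "braid_of (shuf a b c e (Suc f)) = X * (Y * (u * w))"
    using cross_add_right[of "a + e + b" c 1 f]
    unfolding defs braid_of_shuf by (simp add: braid_of_append add_ac del: cross.simps)
  moreover have "u * Y = Y * u" "v * w = w * v"
    unfolding defs by (rule far_crosses; simp)+
  ultimately show ?thesis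
    unfolding defs(4)[symmetric] by (metis mult.assoc)
qed

lemma shuf_shift_23_left:
  "braid_of (shuf a b (Suc c) e f)
   = braid_of (shuf a (Suc b) c e f) * braid_of [Suc (a + e + b)..<Suc (a + e + b) + f]"
proof -
  have "braid_of (cross (a + b) (Suc c) e) = braid_of (cross (Suc (a + b)) c e) * braid_of (cross (a + b) (Suc 0) e)"
    using cross_add_left[of "a + b" "Suc 0" c e] by simp
  moreover have "braid_of (cross (a + b) (Suc 0) e) * braid_of (cross a b e) = braid_of (cross a (Suc b) e)"
    using cross_add_left[of a b "Suc 0" e] by simp
  moreover have "braid_of (cross (a + e + b) (Suc c) f)
      = braid_of (cross (Suc (a + e + b)) c f) * braid_of [Suc (a + e + b)..<Suc (a + e + b) + f]"
    using cross_add_left[of "a + e + b" "Suc 0" c f] by (simp add: cross_Suc_0_left)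
  ultimately show ?thesis
    by (simp add: braid_of_shuf del: upt_Suc) (metis mult.assoc)
qed

lemma shuf_shift_23_right:
  "braid_of (shuf a b c e (Suc f)) = braid_of (shuf a b c e f) * braid_of (cross (a + e + b + f) c 1)"
  by (simp add: braid_of_shuf braid_of_append mult.assoc)


section \<open>The Hecke algebra action on words\<close>

type_synonym 'k tensor = "nat list \<Rightarrow>\<^sub>0 'k"

abbreviation tlen :: "nat \<Rightarrow> 'k::field tensor set"
  where "tlen d \<equiv> free {w. length w = d}"

lemma tpow_subset_tlen: "tpow n d \<subseteq> tlen d"
  by (rule free_mono) (auto simp: words_def)

lemma lin_T [lin_intros]: "lin f \<Longrightarrow> lin (\<lambda>x. T q i (f x))"
  unfolding T_def by (rule lin_lext')

lemma lin_T': "lin (T q i)"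
  by (rule lin_T[OF lin_ident])

lemmas T_simps = lin_simps[OF lin_T']

lemma T_bas:
  "T q (Suc (length u)) (bas (u @ a # b # v)) =
    (if a < b then bas (u @ b # a # v)
     else if a = b then q *\<^sub>v bas (u @ a # b # v)
     else bas (u @ b # a # v) + (q - inverse q) *\<^sub>v bas (u @ a # b # v))"
  by (simp add: T_def Let_def nth_append list_update_append)

lemma word_at:
  assumes "i \<in> {1..<d}" "length w = d"
  obtains u a b v where "w = u @ a # b # v" "i = Suc (length u)"
proof -
  obtain k where k: "i = Suc k" "Suc k < length w"
    using assms by (cases i) auto
  then have "w = take k w @ w ! k # w ! i # drop (Suc i) w" "i = Suc (length (take k w))"
    using id_take_nth_drop[of k w] by (simp_all add: Cons_nth_drop_Suc)
  then show thesis
    by (rule that)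
qed

lemma T_bas_in_free:
  assumes "i \<in> {1..<length w}" "\<And>u a b v. w = u @ a # b # v \<Longrightarrow> u @ b # a # v \<in> A" "w \<in> A"
  shows "T q i (bas w) \<in> free A"
proof -
  obtain u a b v where "w = u @ a # b # v" "i = Suc (length u)"
    using assms(1) by (rule word_at) simp
  then show ?thesis
    using assms(2,3) by (auto simp: T_bas intro!: pm.subspace_add pm.subspace_scale subspace_free)
qed

lemma T_in_tpow:
  assumes "i \<in> {1..<d}" "x \<in> tpow n d"
  shows "T q i x \<in> tpow n d"
  using lin_T' subspace_free _ assms(2)
proof (rule lin_free_in_subspace)
  fix w assume "w \<in> words n d"
  then show "T q i (bas w) \<in> tpow n d"
    using assms(1) by (intro T_bas_in_free) (auto simp: words_def)
qed

lemma T_in_tlen: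
  assumes "i \<in> {1..<d}" "x \<in> tlen d"
  shows "T q i x \<in> tlen d"
  using lin_T' subspace_free _ assms(2)
proof (rule lin_free_in_subspace)
  fix w :: "nat list" assume "w \<in> {w. length w = d}"
  then show "T q i (bas w) \<in> tlen d"
    using assms(1) by (intro T_bas_in_free) auto
qed

lemma T_quadratic:
  assumes "q \<noteq> 0" "i \<in> {1..<d}" "x \<in> tlen d"
  shows "T q i (T q i x) = (q - inverse q) *\<^sub>v T q i x + x"
proof (rule lin_eq_on_free[OF _ _ _ assms(3)])
  fix w :: "nat list" assume "w \<in> {w. length w = d}"
  then have w: "length w = d"
    by simp
  with assms obtain u a b v where "w = u @ a # b # v" "i = Suc (length u)"
    by (rule_tac word_at[of i d w]) auto
  then show "T q i (T q i (bas w)) = (q - inverse q) *\<^sub>v T q i (bas w) + bas w"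
    using assms(1)
    by (cases a b rule: linorder_cases)
      (auto intro!: poly_mapping_eqI simp: T_bas T_simps lookup_add lookup_scale algebra_simps)
qed (intro lin_intros)+

lemma T_far:
  assumes "i + 2 \<le> j" "i \<in> {1..<d}" "j \<in> {1..<d}" "x \<in> tlen d"
  shows "T q i (T q j x) = T q j (T q i x)"
proof (rule lin_eq_on_free[OF _ _ _ assms(4)])
  fix w :: "nat list" assume "w \<in> {w. length w = d}"
  then have w: "length w = d"
    by simp
  with assms obtain u a b v where 1: "w = u @ a # b # v" "i = Suc (length u)"
    by (rule_tac word_at[of i d w]) auto
  have "j - i - 1 \<in> {1..<length v}"
    using w assms 1 by auto
  then obtain u' a' b' v' where 2: "v = u' @ a' # b' # v'" "j - i - 1 = Suc (length u')"
    by (rule word_at[OF _ refl])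
  have j: "j = Suc (length (u @ s # t # u'))" for s t
    using 1 2 assms(1) by simp
  have Tj: "T q j (bas (u @ s # t # u' @ s' # t' # v')) =
    (if s' < t' then bas (u @ s # t # u' @ t' # s' # v')
     else if s' = t' then q *\<^sub>v bas (u @ s # t # u' @ s' # t' # v')
     else bas (u @ s # t # u' @ t' # s' # v') + (q - inverse q) *\<^sub>v bas (u @ s # t # u' @ s' # t' # v'))"
    for s t s' t'
    using T_bas[of q "u @ s # t # u'" s' t' v'] j[of s t] by simp
  show "T q i (T q j (bas w)) = T q j (T q i (bas w))"
    unfolding 1 2
    by (cases a b rule: linorder_cases; cases a' b' rule: linorder_cases)
      (auto intro!: poly_mapping_eqI simp: T_bas Tj T_simps lookup_add lookup_scale algebra_simps)
qed (intro lin_intros)+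

lemma T_braid:
  assumes "q \<noteq> 0" "1 \<le> i" "Suc i < d" "x \<in> tlen d"
  shows "T q i (T q (Suc i) (T q i x)) = T q (Suc i) (T q i (T q (Suc i) x))"
proof (rule lin_eq_on_free[OF _ _ _ assms(4)])
  fix w :: "nat list" assume "w \<in> {w. length w = d}"
  then have w: "length w = d"
    by simp
  with assms obtain u a b v where 1: "w = u @ a # b # v" "i = Suc (length u)"
    by (rule_tac word_at[of i d w]) auto
  with w assms obtain c v' where 2: "v = c # v'"
    by (cases v) auto
  have T2: "T q (Suc (Suc (length u))) (bas (u @ r # s # t # v')) =
    (if s < t then bas (u @ r # t # s # v')
     else if s = t then q *\<^sub>v bas (u @ r # s # t # v')
     else bas (u @ r # t # s # v') + (q - inverse q) *\<^sub>v bas (u @ r # s # t # v'))" for r s t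
    using T_bas[of q "u @ [r]" s t v'] by simp
  show "T q i (T q (Suc i) (T q i (bas w))) = T q (Suc i) (T q i (T q (Suc i) (bas w)))"
    unfolding 1 2 using assms(1)
    by (cases a b rule: linorder_cases; cases b c rule: linorder_cases; cases a c rule: linorder_cases)
      (auto intro!: poly_mapping_eqI simp: T_bas T2 T_simps lookup_add lookup_scale algebra_simps)
qed (intro lin_intros)+

lemma act_Nil [simp]: "act q [] x = x"
  and act_Cons: "act q (i # is) x = act q is (T q i x)"
  and act_append: "act q (is @ js) x = act q js (act q is x)"
  by (simp_all add: act_def)

lemma lin_act [lin_intros]: "lin f \<Longrightarrow> lin (\<lambda>x. act q is (f x))"
  by (induction "is" arbitrary: f) (auto simp: act_Cons intro: lin_T)

lemma lin_act': "lin (act q is)"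
  by (rule lin_act[OF lin_ident])

lemmas act_simps = lin_simps[OF lin_act']

lemma act_in_tpow: "set is \<subseteq> {1..<d} \<Longrightarrow> x \<in> tpow n d \<Longrightarrow> act q is x \<in> tpow n d"
  by (induction "is" arbitrary: x) (auto simp: act_Cons T_in_tpow)

lemma act_in_tlen: "set is \<subseteq> {1..<d} \<Longrightarrow> x \<in> tlen d \<Longrightarrow> act q is x \<in> tlen d"
  by (induction "is" arbitrary: x) (auto simp: act_Cons T_in_tlen)

text \<open>The braid relations hold for the operators, so the action of a braid word only depends on
  its class in the braid monoid.\<close>

lemma act_braid_eq:
  assumes "braid_of is = braid_of js" "q \<noteq> 0" "set is \<subseteq> {1..<d}" "x \<in> tlen d"
  shows "act q is x = act q js x"
  using assms(1,3,4) unfolding braid_of_eq_iff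
proof (induction arbitrary: x rule: braid_eq.induct)
  case (symmetric "is" js)
  then show ?case
    by (simp add: braid_eq_set)
next
  case (transitive "is" js ks)
  then show ?case
    by (simp add: braid_eq_set)
next
  case (far_commute i j us vs)
  then show ?case
    by (simp add: act_append act_Cons T_far[of i j d] act_in_tlen)
next
  case (braid_move us i vs)
  then show ?case
    by (simp add: act_append act_Cons T_braid[of q i d] act_in_tlen assms(2))
qed simp


section \<open>Concatenation of tensors\<close>

definition dot :: "'k::field tensor \<Rightarrow> 'k tensor \<Rightarrow> 'k tensor"
    (infixr "\<bullet>" 70)
  where "x \<bullet> y = cat (x \<otimes> y)"

lemma lin_cat [lin_intros]: "lin f \<Longrightarrow> lin (\<lambda>x. cat (f x))"
  unfolding cat_def by (rule lin_lext')

lemma lin_dot_left [lin_intros]: "lin f \<Longrightarrow> lin (\<lambda>x. f x \<bullet> y)"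
  and lin_dot_right [lin_intros]: "lin f \<Longrightarrow> lin (\<lambda>y. x \<bullet> f y)"
  unfolding dot_def by (intro lin_intros; assumption)+

lemmas dot_simps = lin_simps[OF lin_dot_left[OF lin_ident]] lin_simps[OF lin_dot_right[OF lin_ident]]

lemma cat_bas [simp]: "cat (bas (u, v)) = bas (u @ v)"
  by (simp add: cat_def)

lemma dot_bas [simp]: "bas u \<bullet> bas v = bas (u @ v)"
  by (simp add: dot_def)

lemma dot_in_free:
  assumes "x \<in> free A" "y \<in> free A'" "\<And>u v. u \<in> A \<Longrightarrow> v \<in> A' \<Longrightarrow> u @ v \<in> A''"
  shows "x \<bullet> y \<in> free A''"
  by (rule bilin_free_in_subspace[OF _ _ subspace_free _ assms(1,2)])
    (auto simp: assms(3) intro: lin_dot_left lin_dot_right lin_ident)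

lemma dot_in_tlen: "x \<in> tlen d \<Longrightarrow> y \<in> tlen e \<Longrightarrow> x \<bullet> y \<in> tlen (d + e)"
  by (erule (1) dot_in_free) auto

lemma dot_in_tpow: "x \<in> tpow n d \<Longrightarrow> y \<in> tpow n e \<Longrightarrow> x \<bullet> y \<in> tpow n (d + e)"
  by (erule (1) dot_in_free) (auto simp: words_def)

lemma dot_assoc: "(x \<bullet> y) \<bullet> z = x \<bullet> y \<bullet> z"
proof (rule lin_ext[where f = "\<lambda>z. (x \<bullet> y) \<bullet> z" and g = "\<lambda>z. x \<bullet> y \<bullet> z"])
  fix c
  show "(x \<bullet> y) \<bullet> bas c = x \<bullet> y \<bullet> bas c"
    by (rule bilin_ext[where f = "\<lambda>x y. (x \<bullet> y) \<bullet> bas c" and g = "\<lambda>x y. x \<bullet> y \<bullet> bas c"]) (simp_all add: lin_intros)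
qed (intro lin_intros)+

lemma T_dot_left:
  assumes "i \<in> {1..<d}" "x \<in> tlen d"
  shows "T q i (x \<bullet> y) = T q i x \<bullet> y"
proof (rule lin_eq_on_free[OF _ _ _ assms(2)])
  fix w :: "nat list" assume "w \<in> {w. length w = d}"
  then have w: "length w = d"
    by simp
  with assms obtain u a b v where w': "w = u @ a # b # v" "i = Suc (length u)"
    by (rule_tac word_at[of i d w]) auto
  show "T q i (bas w \<bullet> y) = T q i (bas w) \<bullet> y"
    by (rule lin_ext)
      (simp_all add: lin_intros w' T_bas dot_simps)
qed (intro lin_intros)+

lemma T_dot_right:
  assumes "i \<in> {1..<e}" "x \<in> tlen d" "y \<in> tlen e"
  shows "T q (d + i) (x \<bullet> y) = x \<bullet> T q i y"
proof (rule lin_eq_on_free[OF _ _ _ assms(3)])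
  fix w :: "nat list" assume "w \<in> {w. length w = e}"
  then have w: "length w = e"
    by simp
  with assms obtain u a b v where w': "w = u @ a # b # v" "i = Suc (length u)"
    by (rule_tac word_at[of i e w]) auto
  show "T q (d + i) (x \<bullet> bas w) = x \<bullet> T q i (bas w)"
  proof (rule lin_eq_on_free[OF _ _ _ assms(2)])
    fix z :: "nat list" assume "z \<in> {w. length w = d}"
    then show "T q (d + i) (bas z \<bullet> bas w) = bas z \<bullet> T q i (bas w)"
      using T_bas[of q "z @ u" a b v] by (simp add: w' T_bas dot_simps)
  qed (intro lin_intros)+
qed (intro lin_intros)+

lemma act_dot_left:
  "set is \<subseteq> {1..<d} \<Longrightarrow> x \<in> tlen d \<Longrightarrow> act q is (x \<bullet> y) = act q is x \<bullet> y"
  by (induction "is" arbitrary: x) (auto simp: act_Cons T_dot_left T_in_tlen)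

lemma act_dot_right:
  "set is \<subseteq> {1..<e} \<Longrightarrow> x \<in> tlen d \<Longrightarrow> y \<in> tlen e \<Longrightarrow>
    act q (map ((+) d) is) (x \<bullet> y) = x \<bullet> act q is y"
  by (induction "is" arbitrary: y) (auto simp: act_Cons T_dot_right T_in_tlen)

lemma act_dot_middle:
  assumes "set is \<subseteq> {1..<e}" "x \<in> tlen d" "y \<in> tlen e"
  shows "act q (map ((+) d) is) (x \<bullet> y \<bullet> z) = x \<bullet> act q is y \<bullet> z"
proof -
  have "act q (map ((+) d) is) ((x \<bullet> y) \<bullet> z) = act q (map ((+) d) is) (x \<bullet> y) \<bullet> z"
    by (rule act_dot_left[of _ "d + e"]) (use assms in \<open>auto intro: dot_in_tlen\<close>)
  also have "\<dots> = (x \<bullet> act q is y) \<bullet> z"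
    by (simp only: act_dot_right[OF assms])
  finally show ?thesis
    by (simp only: dot_assoc)
qed

lemma act_cross_middle:
  assumes "x \<in> tlen p" "y \<in> tlen d" "z \<in> tlen e"
  shows "act q (cross p d e) (x \<bullet> y \<bullet> z \<bullet> t) = x \<bullet> act q (cross 0 d e) (y \<bullet> z) \<bullet> t"
proof -
  have "cross p d e = map ((+) p) (cross 0 d e)"
    by (simp add: map_shift_cross)
  moreover have "set (cross 0 d e) \<subseteq> {1..<d + e}"
    by (auto dest!: set_cross)
  ultimately have "act q (cross p d e) (x \<bullet> (y \<bullet> z) \<bullet> t) = x \<bullet> act q (cross 0 d e) (y \<bullet> z) \<bullet> t"
    using act_dot_middle[of "cross 0 d e" "d + e" x p "y \<bullet> z"] assms dot_in_tlen by metis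
  then show ?thesis
    by (simp add: dot_assoc)
qed


section \<open>Morphisms act on tensor products\<close>

lemma hom_lin: "\<phi> \<in> hom q d n m \<Longrightarrow> lin \<phi>"
  and hom_outside: "\<phi> \<in> hom q d n m \<Longrightarrow> w \<notin> words n d \<Longrightarrow> \<phi> (bas w) = 0"
  and hom_T: "\<phi> \<in> hom q d n m \<Longrightarrow> i \<in> {1..<d} \<Longrightarrow> x \<in> tpow n d \<Longrightarrow> \<phi> (T q i x) = T q i (\<phi> x)"
  by (auto simp: hom_def)

lemma hom_in_tpow:
  assumes "\<phi> \<in> hom q d n m"
  shows "\<phi> x \<in> tpow m d"
  using hom_lin[OF assms] subspace_free
proof (rule lin_free_in_subspace)
  show "\<phi> (bas w) \<in> tpow m d" if "w \<in> UNIV" for w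
  proof (cases "w \<in> words n d")
    case True
    then show ?thesis
      using assms by (auto simp: hom_def)
  next
    case False
    then show ?thesis
      using hom_outside[OF assms False] pm.subspace_0[OF subspace_free] by simp
  qed
qed (simp add: free_def)

lemma hom_act:
  "\<phi> \<in> hom q d n m \<Longrightarrow> set is \<subseteq> {1..<d} \<Longrightarrow> x \<in> tpow n d \<Longrightarrow> \<phi> (act q is x) = act q is (\<phi> x)"
  by (induction "is" arbitrary: x) (auto simp: act_Cons hom_T T_in_tpow)

lemma append_in_words: "length u = d \<Longrightarrow> u @ v \<in> words n (d + e) \<longleftrightarrow> u \<in> words n d \<and> v \<in> words n e"
  by (auto simp: words_def)

lemma finite_words: "finite (words n d)"
  using finite_lists_length_eq[of "{1..n}" d] by (simp add: words_def conj_commute)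

text \<open>The coefficient of \<open>w\<close> in the last tensor factors.\<close>

definition coeff_right :: "nat \<Rightarrow> nat list \<Rightarrow> 'k::field tensor \<Rightarrow> 'k tensor"
  where "coeff_right d w = lext (\<lambda>v. if drop d v = w then bas (take d v) else 0)"

lemma lin_coeff_right [lin_intros]: "lin f \<Longrightarrow> lin (\<lambda>x. coeff_right d w (f x))"
  unfolding coeff_right_def by (rule lin_lext')

lemma lin_lookup_scale: "lin (\<lambda>y. Poly_Mapping.lookup y w *\<^sub>v x)"
  by (rule linI) (simp_all add: lookup_add lookup_scale pm.scale_left_distrib)

lemma coeff_right_dot:
  assumes "x \<in> tlen d"
  shows "coeff_right d w (x \<bullet> y) = Poly_Mapping.lookup y w *\<^sub>v x"
proof (rule lin_eq_on_free[OF _ _ _ assms])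
  fix u :: "nat list" assume u: "u \<in> {w. length w = d}"
  show "coeff_right d w (bas u \<bullet> y) = Poly_Mapping.lookup y w *\<^sub>v bas u"
    by (rule lin_ext)
      (use u in \<open>auto simp: lin_intros lin_lookup_scale coeff_right_def lin_lext' lookup_bas\<close>)
qed (intro lin_intros)+

lemma tpow_eqI_dot:
  assumes "lin f" "lin g" "x \<in> tpow n (d + e)"
    and "\<And>u v. u \<in> words n d \<Longrightarrow> v \<in> words n e \<Longrightarrow> f (bas u \<bullet> bas v) = g (bas u \<bullet> bas v)"
  shows "f x = g x"
  using assms(1,2) _ assms(3)
proof (rule lin_eq_on_free)
  fix w assume "w \<in> words n (d + e)"
  then have "take d w \<in> words n d" "drop d w \<in> words n e"
    using append_in_words[of "take d w" d "drop d w" n e] by (auto simp: words_def)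
  then show "f (bas w) = g (bas w)"
    using assms(4)[of "take d w" "drop d w"] by simp
qed

text \<open>The generators of the left block do not touch the letters at which the coefficient is read off.\<close>

lemma coeff_right_T:
  fixes x :: "'k::field tensor"
  assumes "i \<in> {1..<d}" "x \<in> tpow n (d + e)"
  shows "coeff_right d w (T q i x) = T q i (coeff_right d w x)"
proof (rule tpow_eqI_dot[OF _ _ assms(2)])
  fix u v assume "u \<in> words n d" "v \<in> words n e"
  then have u: "bas u \<in> (tlen d :: 'k tensor set)"
    by (auto simp: words_def)
  show "coeff_right d w (T q i (bas u \<bullet> bas v)) = T q i (coeff_right d w (bas u \<bullet> bas v))"
    using T_in_tlen[OF assms(1) u]
    by (simp only: T_dot_left[OF assms(1) u] coeff_right_dot u T_simps)
qed (intro lin_intros)+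

lemma coeff_right_sum:
  fixes x :: "'k::field tensor"
  assumes "x \<in> tpow n (d + e)"
  shows "x = (\<Sum>w\<in>words n e. coeff_right d w x \<bullet> bas w)"
proof (rule tpow_eqI_dot[OF _ _ assms])
  fix u v assume "u \<in> words n d" and v: "v \<in> words n e"
  then have u: "bas u \<in> (tlen d :: 'k tensor set)"
    by (auto simp: words_def)
  have "(\<Sum>w\<in>words n e. coeff_right d w (bas u \<bullet> bas v) \<bullet> bas w :: 'k tensor)
      = (\<Sum>w\<in>words n e. if v = w then bas u \<bullet> bas v else 0)"
    unfolding coeff_right_dot[OF u] by (rule sum.cong) (auto simp: lookup_bas dot_simps)
  also have "\<dots> = bas u \<bullet> bas v"
    using v finite_words by simp
  finally show "bas u \<bullet> bas v
      = (\<Sum>w\<in>words n e. coeff_right d w (bas u \<bullet> bas v) \<bullet> bas w :: 'k tensor)"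
    by (rule sym)
qed (intro lin_intros)+

text \<open>The conditions on a morphism other than Hecke linearity.\<close>

definition word_map :: "nat \<Rightarrow> nat \<Rightarrow> nat \<Rightarrow> ('k::field tensor \<Rightarrow> 'k tensor) \<Rightarrow> bool"
  where "word_map e n m \<chi> \<longleftrightarrow>
    lin \<chi> \<and> (\<forall>x. \<chi> x \<in> tpow m e) \<and> (\<forall>w. w \<notin> words n e \<longrightarrow> \<chi> (bas w) = 0)"

lemma word_map_hom:
  "word_map e n m \<chi> \<Longrightarrow> (\<And>i x. i \<in> {1..<e} \<Longrightarrow> x \<in> tpow n e \<Longrightarrow> \<chi> (T q i x) = T q i (\<chi> x)) \<Longrightarrow>
    \<chi> \<in> hom q e n m"
  by (auto simp: word_map_def hom_def)

text \<open>The exchange step of a dimension count: if some \<open>\<chi>\<^sub>j\<close> fails to be Hecke linear, then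
  comparing a coefficient of the defect makes \<open>\<psi>\<^sub>j\<close> a linear combination of the other \<open>\<psi>\<^sub>i\<close>, and
  the term \<open>j\<close> can be eliminated.\<close>

lemma decompose_from_left_linear:
  assumes q: "\<phi> \<in> hom q (d + e) n m" and "finite I"
    and "\<And>i. i \<in> I \<Longrightarrow> \<psi> i \<in> hom q d n m" "\<And>i. i \<in> I \<Longrightarrow> word_map e n m (\<chi> i)"
    and "\<And>x y. x \<in> tlen d \<Longrightarrow> \<phi> (x \<bullet> y) = (\<Sum>i\<in>I. \<psi> i x \<bullet> \<chi> i y)"
  shows "\<exists>J \<chi>'. finite J \<and> (\<forall>i\<in>J. \<psi> i \<in> hom q d n m \<and> \<chi>' i \<in> hom q e n m) \<and>
    (\<forall>x y. x \<in> tlen d \<longrightarrow> \<phi> (x \<bullet> y) = (\<Sum>i\<in>J. \<psi> i x \<bullet> \<chi>' i y))"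
  using assms(2-)
proof (induction I arbitrary: \<chi> rule: finite_psubset_induct)
  case (psubset I)
  note \<psi> = psubset.prems(1) and \<chi> = psubset.prems(2) and sum = psubset.prems(3)
  show ?case
  proof (cases "\<forall>i\<in>I. \<chi> i \<in> hom q e n m")
    case True
    then show ?thesis
      using psubset.hyps \<psi> sum by blast
  next
    case False
    then obtain j where j: "j \<in> I" "\<chi> j \<notin> hom q e n m"
      by blast
    then obtain k y where k: "k \<in> {1..<e}" and y: "y \<in> tpow n e"
      and kj: "\<chi> j (T q k y) \<noteq> T q k (\<chi> j y)"
      using word_map_hom[OF \<chi>] by blast
    define z where "z i = \<chi> i (T q k y) - T q k (\<chi> i y)" for i
    have "z j \<noteq> 0"
      using kj by (simp add: z_def)
    then obtain w where w: "Poly_Mapping.lookup (z j) w \<noteq> 0"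
      by (metis lookup_zero poly_mapping_eqI)
    define r where "r i = Poly_Mapping.lookup (z i) w / Poly_Mapping.lookup (z j) w" for i
    have dep: "(\<Sum>i\<in>I. r i *\<^sub>v \<psi> i (bas u)) = 0" for u
    proof (cases "u \<in> words n d")
      case True
      then have u: "bas u \<in> tpow n d" "bas u \<in> tlen d"
        by (auto simp: words_def)
      have y': "y \<in> tlen e"
        using y tpow_subset_tlen by blast
      have \<psi>u: "\<psi> i (bas u) \<in> tlen d" if "i \<in> I" for i
        using hom_in_tpow[OF \<psi>[OF that]] tpow_subset_tlen by blast
      have \<chi>y: "\<chi> i y \<in> tlen e" if "i \<in> I" for i
        using \<chi>[OF that] tpow_subset_tlen unfolding word_map_def by blast
      have "\<phi> (bas u \<bullet> T q k y) = T q (d + k) (\<phi> (bas u \<bullet> y))"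
        using k hom_T[OF q, of "d + k" "bas u \<bullet> y"] dot_in_tpow[OF u(1) y]
        by (simp add: T_dot_right[OF k u(2) y'])
      then have "(\<Sum>i\<in>I. \<psi> i (bas u) \<bullet> \<chi> i (T q k y)) = T q (d + k) (\<Sum>i\<in>I. \<psi> i (bas u) \<bullet> \<chi> i y)"
        by (simp only: sum[OF u(2)])
      also have "\<dots> = (\<Sum>i\<in>I. \<psi> i (bas u) \<bullet> T q k (\<chi> i y))"
        unfolding T_simps using T_dot_right[OF k \<psi>u \<chi>y] by (intro sum.cong) auto
      finally have "(\<Sum>i\<in>I. \<psi> i (bas u) \<bullet> z i) = 0"
        by (simp add: z_def dot_simps sum_subtractf)
      then have "coeff_right d w (\<Sum>i\<in>I. \<psi> i (bas u) \<bullet> z i) = 0"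
        by (simp add: lin_simps[OF lin_coeff_right[OF lin_ident]])
      then have *: "(\<Sum>i\<in>I. Poly_Mapping.lookup (z i) w *\<^sub>v \<psi> i (bas u)) = 0"
        using \<psi>u by (simp add: lin_simps[OF lin_coeff_right[OF lin_ident]] coeff_right_dot)
      have "(\<Sum>i\<in>I. r i *\<^sub>v \<psi> i (bas u))
          = (1 / Poly_Mapping.lookup (z j) w) *\<^sub>v (\<Sum>i\<in>I. Poly_Mapping.lookup (z i) w *\<^sub>v \<psi> i (bas u))"
        by (simp add: r_def pm.scale_sum_right)
      with * show ?thesis
        by simp
    next
      case False
      then show ?thesis
        using hom_outside[OF \<psi>] by simp
    qed
    have dep': "(\<Sum>i\<in>I. r i *\<^sub>v \<psi> i x) = 0" for x
    proof (rule lin_ext[where f = "\<lambda>x. \<Sum>i\<in>I. r i *\<^sub>v \<psi> i x" and g = "\<lambda>x. 0"])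
      show "lin (\<lambda>x. \<Sum>i\<in>I. r i *\<^sub>v \<psi> i x)"
        using hom_lin[OF \<psi>] by (intro lin_intros)
    qed (simp_all add: lin_intros dep)
    define \<chi>' where "\<chi>' i y = \<chi> i y - r i *\<^sub>v \<chi> j y" for i y
    have rj: "r j = 1"
      using w by (simp add: r_def)
    show ?thesis
    proof (rule psubset.IH)
      show "I - {j} \<subset> I"
        using j by blast
      show "\<psi> i \<in> hom q d n m" if "i \<in> I - {j}" for i
        using that \<psi> by blast
      show "word_map e n m (\<chi>' i)" if "i \<in> I - {j}" for i
        using that \<chi>[of i] \<chi>[OF j(1)] unfolding word_map_def \<chi>'_def
        by (auto intro!: lin_minus lin_scaled pm.subspace_diff pm.subspace_scale subspace_free)
      show "\<phi> (x \<bullet> y) = (\<Sum>i\<in>I - {j}. \<psi> i x \<bullet> \<chi>' i y)" if "x \<in> tlen d" for x y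
      proof -
        have "(\<Sum>i\<in>I - {j}. \<psi> i x \<bullet> \<chi>' i y) = (\<Sum>i\<in>I. \<psi> i x \<bullet> \<chi>' i y)"
          using psubset.hyps j(1) rj by (simp add: sum.remove[of I j] \<chi>'_def dot_simps)
        also have "\<dots> = (\<Sum>i\<in>I. \<psi> i x \<bullet> \<chi> i y) - (\<Sum>i\<in>I. r i *\<^sub>v \<psi> i x) \<bullet> \<chi> j y"
          by (simp add: \<chi>'_def dot_simps sum_subtractf)
        finally show ?thesis
          using sum[OF that] by (simp add: dep' dot_simps)
      qed
    qed
  qed
qed

lemma hom_tens_bas: "hom_tens d \<psi> \<chi> (bas w) = \<psi> (bas (take d w)) \<bullet> \<chi> (bas (drop d w))"
  by (simp add: hom_tens_def split_def tens_map_bas dot_def)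

lemma lin_hom_tens: "lin (hom_tens d \<psi> \<chi>)"
  unfolding hom_tens_def split_def by (intro lin_intros)

text \<open>Expanding \<open>\<phi>\<close> in the matrix units of the right factor gives a decomposition whose left factors are
  Hecke linear, because \<open>\<phi>\<close> commutes with the generators of the left block; then the right factors
  are corrected by \<open>decompose_from_left_linear\<close>.\<close>

lemma decomposes_exists:
  fixes q :: "'k::field"
  assumes "\<phi> \<in> hom q (d + e) n m"
  shows "\<exists>ps. decomposes q d e n m \<phi> ps"
proof -
  let ?I = "words n e \<times> words m e"
  define \<psi> where "\<psi> = (\<lambda>(v, w) x. coeff_right d w (\<phi> (x \<bullet> bas v)))"
  define \<chi> :: "nat list \<times> nat list \<Rightarrow> 'k tensor \<Rightarrow> 'k tensor"
    where "\<chi> = (\<lambda>(v, w). lext (\<lambda>v'. if v' = v then bas w else 0))"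
  have lin: "lin \<phi>"
    by (rule hom_lin[OF assms])
  have \<psi>: "\<psi> i \<in> hom q d n m" if iI: "i \<in> ?I" for i
  proof -
    obtain v w where i: "i = (v, w)" "v \<in> words n e" "w \<in> words m e"
      using iI by blast
    then have v: "bas v \<in> tpow n e"
      by simp
    have lin\<psi>: "lin (\<psi> i)"
      unfolding \<psi>_def i by (simp add: lin_intros lin_compose[OF lin])
    have "word_map d n m (\<psi> i)"
      unfolding word_map_def
    proof (intro conjI allI impI)
      show "\<psi> i x \<in> tpow m d" for x
        unfolding \<psi>_def i prod.case
      proof (rule lin_free_in_subspace[where f = "coeff_right d w", OF _ subspace_free])
        show "\<phi> (x \<bullet> bas v) \<in> tpow m (d + e)"
          by (rule hom_in_tpow[OF assms])
        show "coeff_right d w (bas v) \<in> tpow m d" if "v \<in> words m (d + e)" for v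
          using that by (auto simp: coeff_right_def words_def pm.subspace_0[OF subspace_free]
              dest: in_set_takeD)
      qed (unfold coeff_right_def, rule lin_lext)
      show "\<psi> i (bas u) = 0" if "u \<notin> words n d" for u
      proof -
        have "u @ v \<notin> words n (d + e)"
          using that i(2) by (auto simp: words_def)
        then show ?thesis
          using hom_outside[OF assms] by (simp add: \<psi>_def i coeff_right_def lin_zero[OF lin_lext])
      qed
    qed (rule lin\<psi>)
    then show ?thesis
    proof (rule word_map_hom)
      fix k and x :: "'k tensor" assume k: "k \<in> {1..<d}" and x: "x \<in> tpow n d"
      then have "\<phi> (T q k x \<bullet> bas v) = T q k (\<phi> (x \<bullet> bas v))"
        using T_dot_left[OF k, of x q "bas v"] tpow_subset_tlen[of n d]
          hom_T[OF assms, of k "x \<bullet> bas v"] dot_in_tpow[OF x v] by fastforce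
      then show "\<psi> i (T q k x) = T q k (\<psi> i x)"
        using coeff_right_T[OF k hom_in_tpow[OF assms]] by (simp add: \<psi>_def i)
    qed
  qed
  have \<chi>: "word_map e n m (\<chi> i)" if iI: "i \<in> ?I" for i
  proof -
    obtain v w where i: "i = (v, w)" "v \<in> words n e" "w \<in> words m e"
      using iI by blast
    have "\<chi> i x \<in> tpow m e" for x
      unfolding \<chi>_def i prod.case
      by (rule lin_free_in_subspace[where A = UNIV, OF lin_lext subspace_free])
        (use i in \<open>auto simp: free_def\<close>)
    then show ?thesis
      using i by (auto simp: word_map_def \<chi>_def lin_lext)
  qed
  have sum: "\<phi> (x \<bullet> y) = (\<Sum>i\<in>?I. \<psi> i x \<bullet> \<chi> i y)" if x: "x \<in> tlen d" for x y
  proof (rule lin_ext[where f = "\<lambda>y. \<phi> (x \<bullet> y)" and g = "\<lambda>y. \<Sum>i\<in>?I. \<psi> i x \<bullet> \<chi> i y"])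
    show "lin (\<lambda>y. \<phi> (x \<bullet> y))"
      by (rule lin_compose[OF lin]) (intro lin_intros)
    show "lin (\<lambda>y. \<Sum>i\<in>?I. \<psi> i x \<bullet> \<chi> i y)"
      by (auto intro!: lin_intros simp: \<chi>_def split_beta)
    fix v
    show "\<phi> (x \<bullet> bas v) = (\<Sum>i\<in>?I. \<psi> i x \<bullet> \<chi> i (bas v))"
    proof (cases "v \<in> words n e")
      case True
      have "(\<Sum>i\<in>?I. \<psi> i x \<bullet> \<chi> i (bas v))
          = (\<Sum>v'\<in>words n e. \<Sum>w\<in>words m e. if v = v' then coeff_right d w (\<phi> (x \<bullet> bas v)) \<bullet> bas w else 0)"
        unfolding sum.cartesian_product
        by (rule sum.cong) (auto simp: \<psi>_def \<chi>_def dot_simps)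
      also have "\<dots> = (\<Sum>w\<in>words m e. coeff_right d w (\<phi> (x \<bullet> bas v)) \<bullet> bas w)"
        using True finite_words by (subst sum.swap) simp
      also have "\<dots> = \<phi> (x \<bullet> bas v)"
        by (rule coeff_right_sum[symmetric, OF hom_in_tpow[OF assms]])
      finally show ?thesis ..
    next
      case False
      have "\<phi> (x \<bullet> bas v) = 0"
      proof (rule lin_eq_on_free[where f = "\<lambda>x. \<phi> (x \<bullet> bas v)" and g = "\<lambda>x. 0", OF _ _ _ x])
        show "\<phi> (bas u \<bullet> bas v) = 0" if "u \<in> {w. length w = d}" for u
          using False that hom_outside[OF assms] append_in_words[of u d v n e] by simp
      qed (rule lin_compose[OF lin lin_dot_left[OF lin_ident]] lin_null)+
      moreover have "\<chi> i (bas v) = 0" if "i \<in> ?I" for i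
        using False that by (auto simp: \<chi>_def)
      ultimately show ?thesis
        by (simp add: dot_simps)
    qed
  qed
  have "finite ?I"
    using finite_words by blast
  then obtain J \<chi>' where J: "finite J" "\<And>i. i \<in> J \<Longrightarrow> \<psi> i \<in> hom q d n m \<and> \<chi>' i \<in> hom q e n m"
    and eq: "\<And>x y. x \<in> tlen d \<Longrightarrow> \<phi> (x \<bullet> y) = (\<Sum>i\<in>J. \<psi> i x \<bullet> \<chi>' i y)"
    using decompose_from_left_linear[OF assms _ \<psi> \<chi> sum] by blast
  obtain js where js: "set js = J" "distinct js"
    using finite_distinct_list[OF J(1)] by blast
  have "decomposes q d e n m \<phi> (map (\<lambda>i. (\<psi> i, \<chi>' i)) js)"
    unfolding decomposes_def
  proof (intro conjI allI)
    show "set (map (\<lambda>i. (\<psi> i, \<chi>' i)) js) \<subseteq> hom q d n m \<times> hom q e n m"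
      using J js by auto
    fix x
    show "\<phi> x = (\<Sum>(\<psi>, \<chi>)\<leftarrow>map (\<lambda>i. (\<psi> i, \<chi>' i)) js. hom_tens d \<psi> \<chi> x)"
    proof (rule lin_ext[where f = \<phi>, OF lin])
      show "lin (\<lambda>x. \<Sum>(\<psi>, \<chi>)\<leftarrow>map (\<lambda>i. (\<psi> i, \<chi>' i)) js. hom_tens d \<psi> \<chi> x)"
        by (auto intro!: lin_intros simp: lin_hom_tens split_beta)
      fix w
      have "(\<Sum>i\<in>J. \<psi> i (bas (take d w)) \<bullet> \<chi>' i (bas (drop d w))) = \<phi> (bas w)"
      proof (cases "d \<le> length w")
        case True
        then show ?thesis
          using eq[of "bas (take d w)" "bas (drop d w)"] by simp
      next
        case False
        then have "\<psi> i (bas (take d w)) = 0" if "i \<in> J" for i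
          using hom_outside[of "\<psi> i" q d n m] J(2)[OF that] by (auto simp: words_def)
        moreover have "\<phi> (bas w) = 0"
          using False hom_outside[OF assms] by (auto simp: words_def)
        ultimately show ?thesis
          by (simp add: dot_simps)
      qed
      then show "\<phi> (bas w) = (\<Sum>(\<psi>, \<chi>)\<leftarrow>map (\<lambda>i. (\<psi> i, \<chi>' i)) js. hom_tens d \<psi> \<chi> (bas w))"
        using js by (simp add: hom_tens_bas o_def sum_list_distinct_conv_sum_set)
    qed
  qed
  then show ?thesis ..
qed

text \<open>What the arbitrary choice in the definition of the tensor product of functors comes to: a
  sum of elementary tensors of morphisms with the given sum.\<close>

lemma hom_decomposition:
  assumes "\<phi> \<in> hom q (d + e) n m"
  obtains ps where "(SOME ps. decomposes q d e n m \<phi> ps) = ps"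
    and "\<And>\<psi> \<chi>. (\<psi>, \<chi>) \<in> set ps \<Longrightarrow> \<psi> \<in> hom q d n m \<and> \<chi> \<in> hom q e n m"
    and "\<And>x y. x \<in> tlen d \<Longrightarrow> \<phi> (x \<bullet> y) = (\<Sum>(\<psi>, \<chi>)\<leftarrow>ps. \<psi> x \<bullet> \<chi> y)"
proof -
  obtain ps where ps: "(SOME ps. decomposes q d e n m \<phi> ps) = ps"
    by blast
  then have dec: "decomposes q d e n m \<phi> ps"
    using decomposes_exists[OF assms] someI_ex by metis
  have homs: "\<psi> \<in> hom q d n m \<and> \<chi> \<in> hom q e n m" if "(\<psi>, \<chi>) \<in> set ps" for \<psi> \<chi>
    using that dec by (auto simp: decomposes_def)
  have lin: "lin (fst i)" "lin (snd i)" if "i \<in> set ps" for i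
    using homs[of "fst i" "snd i"] that hom_lin by auto
  have "\<phi> (x \<bullet> y) = (\<Sum>i\<leftarrow>ps. fst i x \<bullet> snd i y)" if x: "x \<in> tlen d" for x y
  proof (rule bilin_eq_on_free[where f = "\<lambda>x y. \<phi> (x \<bullet> y)" and A = "{w. length w = d}" and A' = UNIV
        and g = "\<lambda>x y. \<Sum>i\<leftarrow>ps. fst i x \<bullet> snd i y"])
    show "lin (\<lambda>x. \<phi> (x \<bullet> y))" for y
      by (rule lin_compose[OF hom_lin[OF assms] lin_dot_left[OF lin_ident]])
    show "lin (\<lambda>y. \<phi> (x \<bullet> y))" for x
      by (rule lin_compose[OF hom_lin[OF assms] lin_dot_right[OF lin_ident]])
    show "lin (\<lambda>x. \<Sum>i\<leftarrow>ps. fst i x \<bullet> snd i y)" for y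
      by (rule lin_sum_list_fun, rule lin_dot_left) (rule lin)
    show "lin (\<lambda>y. \<Sum>i\<leftarrow>ps. fst i x \<bullet> snd i y)" for x
      by (rule lin_sum_list_fun, rule lin_dot_right) (rule lin)
    show "\<phi> (bas u \<bullet> bas v) = (\<Sum>i\<leftarrow>ps. fst i (bas u) \<bullet> snd i (bas v))"
      if "u \<in> {w. length w = d}" for u v
      using dec that by (simp add: decomposes_def hom_tens_bas case_prod_unfold)
  qed (use x in \<open>auto simp: free_def\<close>)
  then show thesis
    using that[OF ps homs] by (simp add: case_prod_unfold)
qed


section \<open>Relations\<close>

definition Rel :: "'k::field \<Rightarrow> nat \<Rightarrow> nat \<Rightarrow> nat set \<Rightarrow> 'k tensor set"
  where "Rel q n d J = pm.span {T q i x - q *\<^sub>v x |i x. i \<in> J \<and> x \<in> tpow n d}"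

lemma subspace_Rel: "pm.subspace (Rel q n d J)"
  unfolding Rel_def by (rule pm.subspace_span)

lemma Rel_mono: "J \<subseteq> K \<Longrightarrow> Rel q n d J \<subseteq> Rel q n d K"
  unfolding Rel_def by (rule pm.span_mono) blast

lemma T_diff_in_Rel: "i \<in> J \<Longrightarrow> x \<in> tpow n d \<Longrightarrow> T q i x - q *\<^sub>v x \<in> Rel q n d J"
  unfolding Rel_def by (rule pm.span_base) blast

lemma lin_Rel_in_subspace:
  assumes "lin f" "pm.subspace R"
    and "\<And>i x. i \<in> J \<Longrightarrow> x \<in> tpow n d \<Longrightarrow> f (T q i x - q *\<^sub>v x) \<in> R" "x \<in> Rel q n d J"
  shows "f x \<in> R"
  using assms(1,2) _ assms(4)[unfolded Rel_def]
  by (rule lin_span_in_subspace) (use assms(3) in auto)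

lemma Rel_subset_tpow: "J \<subseteq> {1..<d} \<Longrightarrow> Rel q n d J \<subseteq> tpow n d"
  by (rule subsetI, rule lin_Rel_in_subspace[OF lin_ident subspace_free])
    (auto intro!: pm.subspace_diff pm.subspace_scale subspace_free T_in_tpow)

lemma tpow_tlen: "x \<in> tpow n d \<Longrightarrow> x \<in> tlen d"
  using tpow_subset_tlen by blast

lemma dot_Rel_left:
  fixes q :: "'k::field"
  assumes "r \<in> Rel q n a J" "J \<subseteq> {1..<a}" "y \<in> tpow n e"
  shows "r \<bullet> y \<in> Rel q n (a + e) J"
proof (rule lin_Rel_in_subspace[OF _ subspace_Rel _ assms(1)])
  fix i and x :: "'k tensor" assume i: "i \<in> J" and x: "x \<in> tpow n a"
  then have "T q i x \<bullet> y = T q i (x \<bullet> y)"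
    using assms(2) T_dot_left[OF _ tpow_tlen[OF x], of i q y] by auto
  then show "(T q i x - q *\<^sub>v x) \<bullet> y \<in> Rel q n (a + e) J"
    using T_diff_in_Rel[OF i dot_in_tpow[OF x assms(3)]] by (simp add: dot_simps)
qed (intro lin_intros)

lemma dot_Rel_right:
  fixes q :: "'k::field"
  assumes "r \<in> Rel q n e K" "K \<subseteq> {1..<e}" "y \<in> tpow n a"
  shows "y \<bullet> r \<in> Rel q n (a + e) ((+) a ` K)"
proof (rule lin_Rel_in_subspace[OF _ subspace_Rel _ assms(1)])
  fix i and x :: "'k tensor" assume i: "i \<in> K" and x: "x \<in> tpow n e"
  then have "y \<bullet> T q i x = T q (a + i) (y \<bullet> x)"
    using assms(2) T_dot_right[OF _ tpow_tlen[OF assms(3)] tpow_tlen[OF x], of i q] by auto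
  then show "y \<bullet> (T q i x - q *\<^sub>v x) \<in> Rel q n (a + e) ((+) a ` K)"
    using T_diff_in_Rel[OF imageI[OF i] dot_in_tpow[OF assms(3) x]] by (simp add: dot_simps)
qed (intro lin_intros)

text \<open>In the quotient each generator is multiplication by \<open>q\<close>.\<close>

lemma act_mod_Rel:
  assumes "set is \<subseteq> J" "J \<subseteq> {1..<d}" "x \<in> tpow n d"
  shows "act q is x - q ^ length is *\<^sub>v x \<in> Rel q n d J"
  using assms(1,3)
proof (induction "is" arbitrary: x)
  case Nil
  then show ?case
    by (simp add: pm.subspace_0[OF subspace_Rel])
next
  case (Cons i "is")
  then have i: "i \<in> J" "T q i x \<in> tpow n d"
    using assms(2) T_in_tpow[of i d x n q] by auto
  have "act q (i # is) x - q ^ length (i # is) *\<^sub>v x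
      = (act q is (T q i x) - q ^ length is *\<^sub>v T q i x) + q ^ length is *\<^sub>v (T q i x - q *\<^sub>v x)"
    by (simp add: act_Cons pm.scale_right_diff_distrib mult.commute)
  also have "\<dots> \<in> Rel q n d J"
    using Cons i by (intro pm.subspace_add pm.subspace_scale subspace_Rel T_diff_in_Rel) auto
  finally show ?case .
qed

lemma lin_image_subspace:
  assumes "lin f" "pm.subspace S"
  shows "pm.subspace (f ` S)"
proof (rule pm.subspaceI)
  show "0 \<in> f ` S"
    using pm.subspace_0[OF assms(2)] lin_zero[OF assms(1)] by force
  show "x + y \<in> f ` S" if xy: "x \<in> f ` S" "y \<in> f ` S" for x y
    using xy pm.subspace_add[OF assms(2)] lin_add[OF assms(1), symmetric] by auto
  show "c *\<^sub>v x \<in> f ` S" if x: "x \<in> f ` S" for c x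
    using x pm.subspace_scale[OF assms(2)] lin_scale[OF assms(1), symmetric] by auto
qed

lemma free_image: "free (s ` A) = lext (\<lambda>i. bas (s i)) ` free A"
proof (intro equalityI subsetI)
  fix x assume x: "x \<in> free (s ` A)"
  show "x \<in> lext (\<lambda>i. bas (s i)) ` free A"
  proof (rule lin_free_in_subspace[OF lin_ident _ _ x])
    show "pm.subspace (lext (\<lambda>i. bas (s i)) ` free A)"
      by (rule lin_image_subspace[OF lin_lext subspace_free])
    show "bas a \<in> lext (\<lambda>i. bas (s i)) ` free A" if a: "a \<in> s ` A" for a
      using a by (auto intro!: image_eqI[where x = "bas _"])
  qed
next
  fix x assume "x \<in> lext (\<lambda>i. bas (s i)) ` free A"
  then obtain y where y: "y \<in> free A" "x = lext (\<lambda>i. bas (s i)) y"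
    by blast
  show "x \<in> free (s ` A)"
    unfolding y(2) by (rule lin_free_in_subspace[OF lin_lext subspace_free _ y(1)]) auto
qed

text \<open>A space whose basis is a rearrangement \<open>s\<close> of words and whose relations come from a
  parabolic subalgebra. Tensor products of symmetric powers are of this kind, which reduces all
  later computations to words and Hecke operators.\<close>

definition flat_space :: "'k::field \<Rightarrow> nat \<Rightarrow> nat \<Rightarrow> nat set \<Rightarrow> (nat list \<Rightarrow> 'i) \<Rightarrow> ('i, 'k) space \<Rightarrow> bool"
  where "flat_space q n d J s X \<longleftrightarrow>
    gens X = s ` words n d \<and> rels X = lext (\<lambda>w. bas (s w)) ` Rel q n d J"

lemma lext_cut_dot:
  assumes "x \<in> tlen a"
  shows "lext (\<lambda>w. bas (take a w, s (drop a w))) (x \<bullet> y) = x \<otimes> lext (\<lambda>w. bas (s w)) y"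
proof (rule bilin_eq_on_free[where f = "\<lambda>x y. lext (\<lambda>w. bas (take a w, s (drop a w))) (x \<bullet> y)"
      and g = "\<lambda>x y. x \<otimes> lext (\<lambda>w. bas (s w)) y" and A = "{w. length w = a}" and A' = UNIV])
  show "lin (\<lambda>x. lext (\<lambda>w. bas (take a w, s (drop a w))) (x \<bullet> y))"
    "lin (\<lambda>x. x \<otimes> lext (\<lambda>w. bas (s w)) y)" for y
    by (intro lin_intros)+
  show "lin (\<lambda>y. lext (\<lambda>w. bas (take a w, s (drop a w))) (x \<bullet> y))"
    "lin (\<lambda>y. x \<otimes> lext (\<lambda>w. bas (s w)) y)" for x
    by (intro lin_intros)+
qed (use assms in \<open>auto simp: free_def\<close>)

text \<open>Concatenating the two words turns relations of either factor into relations at the corresponding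
  indices of the longer word, and every relation at these indices arises in this way.\<close>

lemma flat_space_tens:
  fixes q :: "'k::field"
  assumes "J \<subseteq> {1..<a}" "K \<subseteq> {1..<e}" "gens X = words n a" "rels X = Rel q n a J"
    and Y: "flat_space q n e K s Y"
  shows "flat_space q n (a + e) (J \<union> (+) a ` K) (\<lambda>w. (take a w, s (drop a w))) (tens_space X Y)"
proof -
  let ?S = "lext (\<lambda>w. bas (s w))" and ?S' = "lext (\<lambda>w. bas (take a w, s (drop a w)))"
  let ?R = "Rel q n (a + e) (J \<union> (+) a ` K)"
  let ?A = "{x \<otimes> y |x y. x \<in> rels X \<and> y \<in> elems Y}" and ?B = "{x \<otimes> y |x y. x \<in> elems X \<and> y \<in> rels Y}"
  have elY: "elems Y = ?S ` tpow n e"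
    using Y free_image unfolding flat_space_def by metis
  have relY: "rels Y = ?S ` Rel q n e K"
    using Y by (simp add: flat_space_def)
  have RX: "Rel q n a J \<subseteq> tlen a"
    using Rel_subset_tpow[OF assms(1)] tpow_subset_tlen by blast
  have "pm.span (?A \<union> ?B) \<subseteq> ?S' ` ?R"
  proof (rule pm.span_minimal)
    show "pm.subspace (?S' ` ?R)"
      by (rule lin_image_subspace[OF lin_lext subspace_Rel])
    show "?A \<union> ?B \<subseteq> ?S' ` ?R"
    proof
      fix z assume "z \<in> ?A \<union> ?B"
      then consider x y where "z = x \<otimes> ?S y" "x \<in> Rel q n a J" "y \<in> tpow n e"
        | x y where "z = x \<otimes> ?S y" "x \<in> tpow n a" "y \<in> Rel q n e K"
        unfolding elY relY assms(3,4) by blast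
      then show "z \<in> ?S' ` ?R"
      proof cases
        case 1
        have "x \<bullet> y \<in> ?R"
          using dot_Rel_left[OF 1(2) assms(1) 1(3)] Rel_mono[of J "J \<union> (+) a ` K"] by blast
        moreover have "z = ?S' (x \<bullet> y)"
          using 1 RX by (subst lext_cut_dot) auto
        ultimately show ?thesis
          by blast
      next
        case 2
        have "x \<bullet> y \<in> ?R"
          using dot_Rel_right[OF 2(3) assms(2) 2(2)] Rel_mono[of "(+) a ` K" "J \<union> (+) a ` K"] by blast
        moreover have "z = ?S' (x \<bullet> y)"
          using 2 tpow_subset_tlen by (subst lext_cut_dot) auto
        ultimately show ?thesis
          by blast
      qed
    qed
  qed
  moreover have "?S' ` ?R \<subseteq> pm.span (?A \<union> ?B)"
  proof (rule image_subsetI)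
    fix r assume r: "r \<in> ?R"
    show "?S' r \<in> pm.span (?A \<union> ?B)"
    proof (rule lin_Rel_in_subspace[OF lin_lext pm.subspace_span _ r])
      fix i and x :: "'k tensor" assume i: "i \<in> J \<union> (+) a ` K" and x: "x \<in> tpow n (a + e)"
      show "?S' (T q i x - q *\<^sub>v x) \<in> pm.span (?A \<union> ?B)"
      proof (rule lin_free_in_subspace[OF _ pm.subspace_span _ x])
        show "lin (\<lambda>x. ?S' (T q i x - q *\<^sub>v x))"
          by (intro lin_intros)
        fix w assume w: "w \<in> words n (a + e)"
        define u v where "u = take a w" "v = drop a w"
        with w have uv: "w = u @ v" "u \<in> words n a" "v \<in> words n e"
          using append_in_words[of u a v n e] by (auto simp: words_def)
        then have u: "(bas u :: 'k tensor) \<in> tlen a" "(bas u :: 'k tensor) \<in> tpow n a"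
          and v: "(bas v :: 'k tensor) \<in> tlen e" "(bas v :: 'k tensor) \<in> tpow n e"
          by (auto simp: words_def)
        from i consider "i \<in> J" | k where "k \<in> K" "i = a + k"
          by blast
        then have "?S' (T q i (bas u \<bullet> bas v) - q *\<^sub>v (bas u \<bullet> bas v)) \<in> ?A \<union> ?B"
        proof cases
          case 1
          then have ia: "i \<in> {1..<a}"
            using assms(1) by blast
          have r: "T q i (bas u) - q *\<^sub>v bas u \<in> rels X"
            unfolding assms(4) by (rule T_diff_in_Rel[OF 1 u(2)])
          have "?S' (T q i (bas u \<bullet> bas v) - q *\<^sub>v (bas u \<bullet> bas v))
              = ?S' ((T q i (bas u) - q *\<^sub>v bas u) \<bullet> bas v)"
            by (simp only: T_dot_left[OF ia u(1)] dot_simps)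
          also have "\<dots> = (T q i (bas u) - q *\<^sub>v bas u) \<otimes> ?S (bas v)"
            using r RX by (intro lext_cut_dot) (auto simp: assms(4))
          finally show ?thesis
            using r imageI[OF v(2), of ?S] unfolding elY by blast
        next
          case 2
          then have ka: "k \<in> {1..<e}"
            using assms(2) by blast
          have r: "?S (T q k (bas v) - q *\<^sub>v bas v) \<in> rels Y"
            unfolding relY by (rule imageI[OF T_diff_in_Rel[OF 2(1) v(2)]])
          have "?S' (T q i (bas u \<bullet> bas v) - q *\<^sub>v (bas u \<bullet> bas v))
              = ?S' (bas u \<bullet> (T q k (bas v) - q *\<^sub>v bas v))"
            by (simp only: 2(2) T_dot_right[OF ka u(1) v(1)] dot_simps)
          also have "\<dots> = bas u \<otimes> ?S (T q k (bas v) - q *\<^sub>v bas v)"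
            by (rule lext_cut_dot[OF u(1)])
          finally show ?thesis
            using r u(2) unfolding assms(3) by blast
        qed
        then show "?S' (T q i (bas w) - q *\<^sub>v bas w) \<in> pm.span (?A \<union> ?B)"
          unfolding uv(1) dot_bas by (rule pm.span_base)
      qed
    qed
  qed
  moreover have "words n a \<times> s ` words n e = (\<lambda>w. (take a w, s (drop a w))) ` words n (a + e)"
  proof (intro equalityI subsetI)
    fix z assume "z \<in> words n a \<times> s ` words n e"
    then obtain u v where "z = (u, s v)" "u \<in> words n a" "v \<in> words n e"
      by auto
    then show "z \<in> (\<lambda>w. (take a w, s (drop a w))) ` words n (a + e)"
      by (intro image_eqI[where x = "u @ v"]) (auto simp: words_def)
  next
    fix z assume "z \<in> (\<lambda>w. (take a w, s (drop a w))) ` words n (a + e)"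
    then show "z \<in> words n a \<times> s ` words n e"
      by (auto simp: words_def intro!: imageI dest: in_set_takeD in_set_dropD)
  qed
  ultimately show ?thesis
    using Y assms(3) by (auto simp: flat_space_def tens_space_def)
qed


section \<open>The functors as sums of word spaces\<close>

definition cut :: "nat \<Rightarrow> nat \<Rightarrow> nat list \<Rightarrow> nat list \<times> nat list \<times> nat list"
  where "cut a b w = (take a w, take b (drop a w), drop b (drop a w))"

text \<open>The tensor power as the summand \<open>(a, b, c)\<close>: a word is cut into its three blocks.\<close>

definition pack :: "nat \<Rightarrow> nat \<Rightarrow> nat \<Rightarrow> 'k::field tensor \<Rightarrow> (Bidx \<Rightarrow>\<^sub>0 'k)"
  where "pack a b c = lext (\<lambda>w. bas ((a, b, c), cut a b w))"

abbreviation triple :: "'k::field \<Rightarrow> nat \<Rightarrow> nat \<Rightarrow> nat \<Rightarrow> (nat list \<times> nat list \<times> nat list, 'k) pfunctor"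
  where "triple q a b c \<equiv> tens_functor q (Sq q a) (tens_functor q (Sq q b) (Sq q c))"

lemma lin_pack [lin_intros]: "lin f \<Longrightarrow> lin (\<lambda>x. pack a b c (f x))"
  unfolding pack_def by (rule lin_lext')

lemma lin_pack': "lin (pack a b c)"
  by (rule lin_pack[OF lin_ident])

lemmas pack_simps = lin_simps[OF lin_pack']

lemma pack_bas: "length u = a \<Longrightarrow> length v = b \<Longrightarrow> pack a b c (bas (u @ v @ w)) = bas ((a, b, c), (u, v, w))"
  by (simp add: pack_def cut_def)

lemma obj_Sq: "obj (Sq q d) n = \<lparr>gens = words n d, rels = Rel q n d {1..<d}\<rparr>"
  by (simp add: Sq_def Rel_def)

lemma flat_space_triple: "flat_space q n (a + (b + c)) (blocks a b c) (cut a b) (obj (triple q a b c) n)"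
proof -
  have "flat_space q n (b + c) ({1..<b} \<union> (+) b ` {1..<c}) (\<lambda>w. (take b w, drop b w))
      (tens_space (obj (Sq q b) n) (obj (Sq q c) n))"
    by (rule flat_space_tens[where s = "\<lambda>w. w"])
      (simp_all add: obj_Sq flat_space_def lext_bas_id)
  then have "flat_space q n (a + (b + c)) ({1..<a} \<union> (+) a ` ({1..<b} \<union> (+) b ` {1..<c}))
      (\<lambda>w. (take a w, take b (drop a w), drop b (drop a w)))
      (tens_space (obj (Sq q a) n) (tens_space (obj (Sq q b) n) (obj (Sq q c) n)))"
    by (rule flat_space_tens[rotated -1]) (auto simp: obj_Sq)
  moreover have "{1..<a} \<union> (+) a ` ({1..<b} \<union> (+) b ` {1..<c}) = blocks a b c"
    by (simp add: blocks_def image_Un add_ac Un_assoc)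
  ultimately show ?thesis
    unfolding cut_def by (simp add: tens_functor_def del: drop_drop)
qed

lemma obj_B: "obj (B q d) n = dsum_space {(a, b, c). a + b + c = d} (\<lambda>(a, b, c). obj (triple q a b c) n)"
  by (simp add: B_def dsum_functor_def case_prod_unfold)

lemma gens_B: "gens (obj (B q d) n) =
  {((a, b, c), (u, v, w)) |a b c u v w. a + b + c = d \<and> u \<in> words n a \<and> v \<in> words n b \<and> w \<in> words n c}"
  by (auto simp: obj_B dsum_space_def tens_functor_def tens_space_def obj_Sq)

lemma dinj_cut: "dinj (a, b, c) (lext (\<lambda>w. bas (cut a b w)) x) = pack a b c x"
  by (rule lin_ext)
    (simp_all add: lin_intros lin_lext lin_pack' pack_def)

lemma rels_B: "rels (obj (B q d) n)
  = pm.span (\<Union>(a, b, c)\<in>{(a, b, c). a + b + c = d}. pack a b c ` Rel q n d (blocks a b c))"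
proof -
  have *: "dinj (a, b, c) ` rels (obj (triple q a b c) n) = pack a b c ` Rel q n d (blocks a b c)"
    if "a + b + c = d" for a b c
    using flat_space_triple[of q n a b c] that
    by (simp add: flat_space_def image_image dinj_cut add.assoc)
  show ?thesis
    unfolding obj_B dsum_space_def space.select_convs
    by (intro arg_cong[where f = pm.span] SUP_cong refl) (clarify, simp only: prod.case *)
qed

abbreviation elemsB :: "'k::field \<Rightarrow> nat \<Rightarrow> nat \<Rightarrow> (Bidx \<Rightarrow>\<^sub>0 'k) set"
  where "elemsB q d n \<equiv> elems (obj (B q d) n)"

abbreviation relsB :: "'k::field \<Rightarrow> nat \<Rightarrow> nat \<Rightarrow> (Bidx \<Rightarrow>\<^sub>0 'k) set"
  where "relsB q d n \<equiv> rels (obj (B q d) n)"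

lemma subspace_rels_B: "pm.subspace (relsB q d n)"
  unfolding rels_B by (rule pm.subspace_span)

lemma pack_in_elems: "x \<in> tpow n d \<Longrightarrow> a + b + c = d \<Longrightarrow> pack a b c x \<in> elemsB q d n"
  by (rule lin_free_in_subspace[OF lin_pack' subspace_free])
    (auto simp: pack_def cut_def gens_B words_def dest: in_set_takeD in_set_dropD)

lemma pack_in_rels: "x \<in> Rel q n d (blocks a b c) \<Longrightarrow> a + b + c = d \<Longrightarrow> pack a b c x \<in> relsB q d n"
  unfolding rels_B by (rule pm.span_base) blast

lemma gens_B_cases:
  assumes "i \<in> gens (obj (B q d) n)"
  obtains a b c w where "a + b + c = d" "w \<in> words n d" "(bas i :: Bidx \<Rightarrow>\<^sub>0 'k::field) = pack a b c (bas w)"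
proof -
  from assms obtain a b c u v w where i: "i = ((a, b, c), (u, v, w))" "a + b + c = d"
    "u \<in> words n a" "v \<in> words n b" "w \<in> words n c"
    unfolding gens_B by blast
  then have "u @ v @ w \<in> words n d"
    by (auto simp: words_def)
  moreover have "(bas i :: Bidx \<Rightarrow>\<^sub>0 'k) = pack a b c (bas (u @ v @ w))"
    using i by (simp add: pack_bas words_def)
  ultimately show thesis
    using that i by blast
qed

lemma elems_B_in_subspace:
  fixes q :: "'k::field"
  assumes "lin f" "pm.subspace R"
    and "\<And>a b c w. a + b + c = d \<Longrightarrow> w \<in> words n d \<Longrightarrow> f (pack a b c (bas w)) \<in> R"
    and "x \<in> elemsB q d n"
  shows "f x \<in> R"
  using assms(1,2) _ assms(4)
proof (rule lin_free_in_subspace)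
  fix i assume "i \<in> gens (obj (B q d) n)"
  then obtain a b c w where "a + b + c = d" "w \<in> words n d" "(bas i :: Bidx \<Rightarrow>\<^sub>0 'k) = pack a b c (bas w)"
    by (rule gens_B_cases)
  then show "f (bas i) \<in> R"
    using assms(3) by metis
qed

lemma elems_B_eqI:
  fixes q :: "'k::field"
  assumes "lin f" "lin g"
    and "\<And>a b c w. a + b + c = d \<Longrightarrow> w \<in> words n d \<Longrightarrow> f (pack a b c (bas w)) = g (pack a b c (bas w))"
    and "x \<in> elemsB q d n"
  shows "f x = g x"
  using assms(1,2) _ assms(4)
proof (rule lin_eq_on_free)
  fix i assume "i \<in> gens (obj (B q d) n)"
  then obtain a b c w where "a + b + c = d" "w \<in> words n d" "(bas i :: Bidx \<Rightarrow>\<^sub>0 'k) = pack a b c (bas w)"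
    by (rule gens_B_cases)
  then show "f (bas i) = g (bas i)"
    using assms(3) by metis
qed

lemma rels_B_in_subspace:
  assumes "lin f" "pm.subspace R"
    and "\<And>a b c x. a + b + c = d \<Longrightarrow> x \<in> Rel q n d (blocks a b c) \<Longrightarrow> f (pack a b c x) \<in> R"
    and "x \<in> relsB q d n"
  shows "f x \<in> R"
  using assms(1,2) _ assms(4)[unfolded rels_B]
  by (rule lin_span_in_subspace) (use assms(3) in auto)

lemma blocks_subset: "a + b + c = d \<Longrightarrow> blocks a b c \<subseteq> {1..<d}"
  by (auto simp: blocks_def)

lemma is_space_B: "is_space (obj (B q d) n)"
proof -
  have "finite {(a, b, c). a + b + c = d}"
    by (rule finite_subset[of _ "{..d} \<times> {..d} \<times> {..d}"]) auto
  moreover have "finite (gens (obj (triple q a b c) n))" for a b c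
    by (simp add: tens_functor_def tens_space_def obj_Sq finite_words)
  ultimately have "finite (gens (obj (B q d) n))"
    unfolding obj_B dsum_space_def space.select_convs
    by (intro finite_SigmaI) (auto simp only: split: prod.splits)
  moreover have "relsB q d n \<subseteq> elemsB q d n"
  proof
    fix x :: "Bidx \<Rightarrow>\<^sub>0 'a" assume x: "x \<in> relsB q d n"
    show "x \<in> elemsB q d n"
    proof (rule rels_B_in_subspace[OF lin_ident subspace_free _ x])
      show "pack a b c y \<in> elemsB q d n"
        if "a + b + c = d" "y \<in> Rel q n d (blocks a b c)" for a b c y
        using subsetD[OF Rel_subset_tpow[OF blocks_subset[OF that(1)]] that(2)] that(1)
        by (rule pack_in_elems)
    qed
  qed
  ultimately show ?thesis
    by (simp add: is_space_def subspace_rels_B)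
qed


subsection \<open>Morphisms\<close>

text \<open>Each term of the chosen decomposition acts on the two parts of a cut word; before cutting, the terms
  add up to \<open>\<phi>\<close>.\<close>

lemma mor_tens_cut:
  assumes \<phi>: "\<phi> \<in> hom q (a + deg G) n m" and w: "length w = a + deg G"
    and G: "\<And>\<chi> v. \<chi> \<in> hom q (deg G) n m \<Longrightarrow> length v = deg G \<Longrightarrow>
      mor G n m \<chi> (bas (s v)) = lext (\<lambda>v. bas (s v)) (\<chi> (bas v))"
  shows "mor (tens_functor q (Sq q a) G) n m \<phi> (bas (take a w, s (drop a w)))
    = lext (\<lambda>w. bas (take a w, s (drop a w))) (\<phi> (bas w))"
proof -
  obtain ps where some: "(SOME ps. decomposes q a (deg G) n m \<phi> ps) = ps"
    and ps: "\<And>\<psi> \<chi>. (\<psi>, \<chi>) \<in> set ps \<Longrightarrow> \<psi> \<in> hom q a n m \<and> \<chi> \<in> hom q (deg G) n m"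
    and sum: "\<And>x y. x \<in> tlen a \<Longrightarrow> \<phi> (x \<bullet> y) = (\<Sum>(\<psi>, \<chi>)\<leftarrow>ps. \<psi> x \<bullet> \<chi> y)"
    using hom_decomposition[OF \<phi>] by blast
  let ?u = "take a w" and ?v = "drop a w" and ?S = "lext (\<lambda>w. bas (take a w, s (drop a w)))"
  have elementary: "\<psi> (bas ?u) \<otimes> mor G n m \<chi> (bas (s ?v)) = ?S (\<psi> (bas ?u) \<bullet> \<chi> (bas ?v))"
    if "(\<psi>, \<chi>) \<in> set ps" for \<psi> \<chi>
  proof -
    have h: "\<psi> \<in> hom q a n m" "\<chi> \<in> hom q (deg G) n m"
      using ps[OF that] by blast+
    have "mor G n m \<chi> (bas (s ?v)) = lext (\<lambda>v. bas (s v)) (\<chi> (bas ?v))"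
      by (rule G[OF h(2)]) (simp add: w)
    then show ?thesis
      by (simp only: lext_cut_dot[OF tpow_tlen[OF hom_in_tpow[OF h(1)]]])
  qed
  have "mor (tens_functor q (Sq q a) G) n m \<phi> (bas (?u, s ?v))
      = (\<Sum>(\<psi>, \<chi>)\<leftarrow>ps. \<psi> (bas ?u) \<otimes> mor G n m \<chi> (bas (s ?v)))"
    by (simp add: tens_functor_def Sq_def some tens_map_bas)
  also have "\<dots> = (\<Sum>(\<psi>, \<chi>)\<leftarrow>ps. ?S (\<psi> (bas ?u) \<bullet> \<chi> (bas ?v)))"
    by (intro arg_cong[where f = sum_list] map_cong) (auto simp: elementary)
  also have "\<dots> = ?S (\<Sum>(\<psi>, \<chi>)\<leftarrow>ps. \<psi> (bas ?u) \<bullet> \<chi> (bas ?v))"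
    by (simp add: lin_sum_list[OF lin_lext] case_prod_unfold)
  also have "\<dots> = ?S (\<phi> (bas w))"
    using sum[of "bas ?u" "bas ?v"] w by simp
  finally show ?thesis .
qed

lemma mor_triple:
  assumes "\<phi> \<in> hom q (a + (b + c)) n m" and "length w = a + (b + c)"
  shows "mor (triple q a b c) n m \<phi> (bas (cut a b w)) = lext (\<lambda>w. bas (cut a b w)) (\<phi> (bas w))"
proof -
  let ?G = "tens_functor q (Sq q b) (Sq q c)"
  have deg: "deg ?G = b + c"
    by (simp add: tens_functor_def Sq_def)
  have G: "mor ?G n m \<chi> (bas (take b v, drop b v)) = lext (\<lambda>v. bas (take b v, drop b v)) (\<chi> (bas v))"
    if "\<chi> \<in> hom q (b + c) n m" "length v = b + c" for \<chi> v
    using mor_tens_cut[of \<chi> q b "Sq q c" n m v "\<lambda>v. v"] that by (simp add: Sq_def lext_bas_id)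
  show ?thesis
    using mor_tens_cut[of \<phi> q a ?G n m w "\<lambda>v. (take b v, drop b v)"] assms G
    unfolding cut_def deg by simp
qed

lemma lin_mor_B: "lin (mor (B q d) n m \<phi>)"
  by (simp add: B_def dsum_functor_def lin_lext)

lemma mor_B_pack:
  assumes "\<phi> \<in> hom q d n m" "a + b + c = d" "x \<in> tlen d"
  shows "mor (B q d) n m \<phi> (pack a b c x) = pack a b c (\<phi> x)"
proof (rule lin_eq_on_free[OF _ _ _ assms(3)])
  show "lin (\<lambda>x. mor (B q d) n m \<phi> (pack a b c x))"
    by (rule lin_compose[OF lin_mor_B lin_pack'])
  show "lin (\<lambda>x. pack a b c (\<phi> x))"
    by (rule lin_compose[OF lin_pack' hom_lin[OF assms(1)]])
  fix w :: "nat list" assume "w \<in> {w. length w = d}"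
  then have "mor (triple q a b c) n m \<phi> (bas (cut a b w)) = lext (\<lambda>w. bas (cut a b w)) (\<phi> (bas w))"
    using assms(1,2) by (intro mor_triple) (auto simp: add.assoc)
  then show "mor (B q d) n m \<phi> (pack a b c (bas w)) = pack a b c (\<phi> (bas w))"
    by (simp add: pack_def[of a b c] B_def dsum_functor_def flip: dinj_cut) (simp add: dinj_cut pack_def)
qed

lemma deg_B: "deg (B q d) = d"
  by (simp add: B_def dsum_functor_def)

lemma eqv_refl: "pm.subspace (rels X) \<Longrightarrow> x = y \<Longrightarrow> eqv X x y"
  by (simp add: eqv_def pm.subspace_0)

lemma is_map_mor_B:
  fixes q :: "'k::field"
  assumes "\<phi> \<in> hom q d n m"
  shows "is_map (obj (B q d) n) (obj (B q d) m) (mor (B q d) n m \<phi>)"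
  unfolding is_map_def
proof (intro conjI image_subsetI lin_mor_B)
  fix x assume x: "x \<in> elemsB q d n"
  show "mor (B q d) n m \<phi> x \<in> elemsB q d m"
  proof (rule elems_B_in_subspace[OF lin_mor_B subspace_free _ x])
    fix a b c w assume abc: "a + b + c = d" and w: "w \<in> words n d"
    then have "mor (B q d) n m \<phi> (pack a b c (bas w)) = pack a b c (\<phi> (bas w))"
      using mor_B_pack[OF assms abc, of "bas w"] tpow_tlen[of "bas w" n d] by auto
    then show "mor (B q d) n m \<phi> (pack a b c (bas w)) \<in> elemsB q d m"
      using pack_in_elems[OF hom_in_tpow[OF assms] abc] by simp
  qed
next
  fix x assume x: "x \<in> relsB q d n"
  show "mor (B q d) n m \<phi> x \<in> relsB q d m"
  proof (rule rels_B_in_subspace[OF lin_mor_B subspace_rels_B _ x])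
    fix a b c r assume abc: "a + b + c = d" and r: "r \<in> Rel q n d (blocks a b c)"
    have "r \<in> tlen d"
      using tpow_tlen[OF subsetD[OF Rel_subset_tpow[OF blocks_subset[OF abc]] r]] .
    then have "mor (B q d) n m \<phi> (pack a b c r) = pack a b c (\<phi> r)"
      by (rule mor_B_pack[OF assms abc])
    moreover have "\<phi> r \<in> Rel q m d (blocks a b c)"
    proof (rule lin_Rel_in_subspace[OF hom_lin[OF assms] subspace_Rel _ r])
      fix i and x :: "'k tensor" assume i: "i \<in> blocks a b c" and x: "x \<in> tpow n d"
      then have "\<phi> (T q i x) = T q i (\<phi> x)"
        using blocks_subset[OF abc] hom_T[OF assms] by blast
      then show "\<phi> (T q i x - q *\<^sub>v x) \<in> Rel q m d (blocks a b c)"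
        using T_diff_in_Rel[OF i hom_in_tpow[OF assms, of x], of q]
        by (simp add: lin_simps[OF hom_lin[OF assms]])
    qed
    ultimately show "mor (B q d) n m \<phi> (pack a b c r) \<in> relsB q d m"
      using pack_in_rels abc by metis
  qed
qed

lemma hom_comp: "\<phi> \<in> hom q d n m \<Longrightarrow> \<psi> \<in> hom q d m l \<Longrightarrow> \<psi> \<circ> \<phi> \<in> hom q d n l"
  using hom_in_tpow[of \<phi> q d n m]
  by (auto simp: hom_def o_def lin_zero intro: lin_compose)

lemma hom_add: "\<phi> \<in> hom q d n m \<Longrightarrow> \<psi> \<in> hom q d n m \<Longrightarrow> (\<lambda>y. \<phi> y + \<psi> y) \<in> hom q d n m"
  by (auto simp: hom_def T_simps intro: lin_plus pm.subspace_add[OF subspace_free])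

lemma hom_scale: "\<phi> \<in> hom q d n m \<Longrightarrow> (\<lambda>y. c *\<^sub>v \<phi> y) \<in> hom q d n m"
  by (auto simp: hom_def T_simps intro: lin_scaled pm.subspace_scale[OF subspace_free])

lemma hom_id_apply: "x \<in> tpow n d \<Longrightarrow> hom_id d n x = x"
  by (rule lin_eq_on_free[where g = "\<lambda>x. x" and A = "words n d"])
    (auto simp: hom_id_def lin_lext lin_ident)

lemma hom_id_in_hom: "hom_id d n \<in> hom q d n n"
  by (auto simp: hom_def hom_id_apply T_in_tpow) (simp_all add: hom_id_def lin_lext)

lemma poly_functor_B: "poly_functor q (B q d)"
proof -
  have eqvI: "eqv (obj (B q d) l) (f x) (g x)"
    if "lin f" "lin g" "x \<in> elemsB q d n"
      and "\<And>a b c w. a + b + c = d \<Longrightarrow> w \<in> words n d \<Longrightarrow> bas w \<in> tpow n d \<Longrightarrow> (bas w :: _ \<Rightarrow>\<^sub>0 'a) \<in> tlen d \<Longrightarrow>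
        f (pack a b c (bas w)) = g (pack a b c (bas w))" for f g x n l
  proof (rule eqv_refl[OF subspace_rels_B], rule elems_B_eqI[OF that(1,2) _ that(3)])
    fix a b c w assume "a + b + c = d" "w \<in> words n d"
    then show "f (pack a b c (bas w)) = g (pack a b c (bas w))"
      by (intro that(4)) (auto simp: words_def)
  qed
  note lins = lin_mor_B lin_compose[OF lin_mor_B lin_mor_B] lin_plus[OF lin_mor_B lin_mor_B]
    lin_scaled[OF lin_mor_B] lin_ident
  have identity: "eqv (obj (B q d) n) (mor (B q d) n n (hom_id d n) x) x"
    if "x \<in> elemsB q d n" for n x
    by (rule eqvI[OF _ _ that]) (simp_all add: lins mor_B_pack[OF hom_id_in_hom] hom_id_apply)
  have composition: "eqv (obj (B q d) l) (mor (B q d) n l (\<psi> \<circ> \<phi>) x) (mor (B q d) m l \<psi> (mor (B q d) n m \<phi> x))"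
    if h: "\<phi> \<in> hom q d n m" "\<psi> \<in> hom q d m l" and x: "x \<in> elemsB q d n" for n m l \<phi> \<psi> x
    by (rule eqvI[OF _ _ x])
      (simp_all add: lins o_def mor_B_pack[OF hom_comp[OF h, unfolded o_def]] mor_B_pack[OF h(1)]
        mor_B_pack[OF h(2) _ tpow_tlen[OF hom_in_tpow[OF h(1)]]])
  have additive: "eqv (obj (B q d) m) (mor (B q d) n m (\<lambda>y. \<phi> y + \<psi> y) x) (mor (B q d) n m \<phi> x + mor (B q d) n m \<psi> x)"
    if h: "\<phi> \<in> hom q d n m" "\<psi> \<in> hom q d n m" and x: "x \<in> elemsB q d n" for n m \<phi> \<psi> x
    by (rule eqvI[OF _ _ x])
      (simp_all add: lins mor_B_pack[OF hom_add[OF h]] mor_B_pack[OF h(1)] mor_B_pack[OF h(2)] pack_simps)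
  have homogeneous: "eqv (obj (B q d) m) (mor (B q d) n m (\<lambda>y. c *\<^sub>v \<phi> y) x) (c *\<^sub>v mor (B q d) n m \<phi> x)"
    if h: "\<phi> \<in> hom q d n m" and x: "x \<in> elemsB q d n" for n m \<phi> c x
    by (rule eqvI[OF _ _ x])
      (simp_all add: lins mor_B_pack[OF hom_scale[OF h]] mor_B_pack[OF h] pack_simps)
  show ?thesis
    unfolding poly_functor_def deg_B
    by (intro conjI allI ballI; (rule is_space_B is_map_mor_B identity composition additive homogeneous; assumption))
qed


section \<open>The product\<close>

lemma lext_split: "lext (\<lambda>(x, y). F x y) (split d z) = lext (\<lambda>w. F (take d w) (drop d w)) z"
  by (rule lin_ext)
    (simp_all add: split_def lin_lext lin_lext')

text \<open>A switch inside a longer word is the same braid with shifted indices, acting on the whole word. The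
  linear map \<open>H\<close> stands for what happens afterwards, so that nested switches can be unfolded one by
  one.\<close>

lemma lext_switch:
  assumes H: "lin H"
    and F: "\<And>v' u'. length v' = length v \<Longrightarrow> length u' = length u \<Longrightarrow> F v' u' = H (bas (x @ v' @ u' @ t))"
  shows "lext (\<lambda>(v', u'). F v' u') (switch q u v)
    = H (act q (cross (length x) (length u) (length v)) (bas (x @ u @ v @ t)))"
proof -
  let ?d = "length u" and ?e = "length v"
  define z where "z = act q (cross 0 ?d ?e) (bas u \<bullet> bas v)"
  have "z \<in> tlen (?d + ?e)"
    unfolding z_def by (intro act_in_tlen) (auto dest!: set_cross simp: dot_bas)
  then have "lext (\<lambda>w. F (take ?e w) (drop ?e w)) z = H (bas x \<bullet> z \<bullet> bas t)"
  proof (rule lin_eq_on_free[where g = "\<lambda>z. H (bas x \<bullet> z \<bullet> bas t)", rotated -1])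
    show "lin (\<lambda>z. H (bas x \<bullet> z \<bullet> bas t))"
      by (rule lin_compose[OF H]) (intro lin_intros)
    fix w :: "nat list" assume "w \<in> {w. length w = ?d + ?e}"
    then show "lext (\<lambda>w. F (take ?e w) (drop ?e w)) (bas w) = H (bas x \<bullet> bas w \<bullet> bas t)"
      by (simp add: F) (simp flip: append_assoc)
  qed (rule lin_lext)
  moreover have "act q (cross (length x) ?d ?e) (bas x \<bullet> bas u \<bullet> bas v \<bullet> bas t) = bas x \<bullet> z \<bullet> bas t"
    unfolding z_def by (rule act_cross_middle) auto
  ultimately show ?thesis
    by (simp add: switch_def lext_split switch_word_cross z_def)
qed

lemma lin_B_mu [lin_intros]: "lin f \<Longrightarrow> lin (\<lambda>x. B_mu q (f x))"
  unfolding B_mu_def by (rule lin_lext')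

lemma lin_B_mu': "lin (B_mu q)"
  by (rule lin_B_mu[OF lin_ident])

lemma B_mu_bas:
  fixes q :: "'k::field"
  assumes "length a1 = a" "length a2 = b" "length a3 = c" "length b1 = e" "length b2 = f"
  shows "B_mu q (bas (((a, b, c), (a1, a2, a3)), ((e, f, g), (b1, b2, b3))))
    = q ^ ((b + c) * e) *\<^sub>v pack (a + e) (b + f) (c + g)
        (act q (shuf a b c e f) (bas (a1 @ a2 @ a3 @ b1 @ b2 @ b3)))"
proof -
  let ?P = "pack (a + e) (b + f) (c + g)"
  let ?C1 = "cross (a + b) c e" and ?C2 = "cross a b e" and ?C3 = "cross (a + e + b) c f"
  \<comment> \<open>The three switches are unfolded from the inside out.\<close>
  define F1 where "F1 b1'' a2' b2' a3'' =
    (bas ((a + e, b + f, c + g), (a1 @ b1'', a2' @ b2', a3'' @ b3)) :: Bidx \<Rightarrow>\<^sub>0 'k)" for b1'' a2' b2' a3''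
  have 3: "lext (\<lambda>(b2', a3''). F1 b1'' a2' b2' a3'') (switch q a3' b2)
      = ?P (act q ?C3 (bas (a1 @ b1'' @ a2' @ a3' @ b2 @ b3)))"
    if "length b1'' = e" "length a2' = b" "length a3' = c" for b1'' a2' a3'
  proof -
    have "lext (\<lambda>(b2', a3''). F1 b1'' a2' b2' a3'') (switch q a3' b2)
        = ?P (act q (cross (length (a1 @ b1'' @ a2')) (length a3') (length b2)) (bas ((a1 @ b1'' @ a2') @ a3' @ b2 @ b3)))"
    proof (rule lext_switch)
      show "F1 b1'' a2' v' u' = ?P (bas ((a1 @ b1'' @ a2') @ v' @ u' @ b3))"
        if "length v' = length b2" "length u' = length a3'" for v' u'
      proof -
        have "?P (bas ((a1 @ b1'') @ (a2' @ v') @ (u' @ b3)))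
            = (bas ((a + e, b + f, c + g), (a1 @ b1'', a2' @ v', u' @ b3)) :: Bidx \<Rightarrow>\<^sub>0 'k)"
          by (rule pack_bas) (use that \<open>length b1'' = e\<close> \<open>length a2' = b\<close> assms in auto)
        then show ?thesis
          by (simp add: F1_def)
      qed
    qed (rule lin_pack')
    then show ?thesis
      using that assms by (simp add: add.assoc)
  qed
  have 2: "lext (\<lambda>(b1'', a2'). lext (\<lambda>(b2', a3''). F1 b1'' a2' b2' a3'') (switch q a3' b2)) (switch q a2 b1')
      = ?P (act q ?C3 (act q ?C2 (bas (a1 @ a2 @ b1' @ a3' @ b2 @ b3))))"
    if "length b1' = e" "length a3' = c" for b1' a3'
  proof -
    have "lext (\<lambda>(b1'', a2'). lext (\<lambda>(b2', a3''). F1 b1'' a2' b2' a3'') (switch q a3' b2)) (switch q a2 b1')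
      = ?P (act q ?C3 (act q (cross (length a1) (length a2) (length b1')) (bas (a1 @ a2 @ b1' @ (a3' @ b2 @ b3)))))"
      by (rule lext_switch[where H = "\<lambda>z. ?P (act q ?C3 z)"])
        (use 3 that assms in \<open>auto intro!: lin_intros\<close>)
    then show ?thesis
      using that assms by simp
  qed
  have "lext (\<lambda>(b1', a3'). lext (\<lambda>(b1'', a2'). lext (\<lambda>(b2', a3''). F1 b1'' a2' b2' a3'')
        (switch q a3' b2)) (switch q a2 b1')) (switch q a3 b1)
      = ?P (act q ?C3 (act q ?C2 (act q (cross (length (a1 @ a2)) (length a3) (length b1))
          (bas ((a1 @ a2) @ a3 @ b1 @ (b2 @ b3))))))"
    by (rule lext_switch[where H = "\<lambda>z. ?P (act q ?C3 (act q ?C2 z))"])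
      (use 2 assms in \<open>auto intro!: lin_intros\<close>)
  then show ?thesis
    using assms by (simp add: B_mu_def F1_def shuf_def act_append)
qed

lemma word_3_blocks:
  "length w = a + b + c \<Longrightarrow> \<exists>u v t. w = u @ v @ t \<and> length u = a \<and> length v = b \<and> length t = c"
  by (intro exI[of _ "take a w"] exI[of _ "take b (drop a w)"] exI[of _ "drop b (drop a w)"])
    (simp del: drop_drop)

lemma B_mu_pack:
  fixes q :: "'k::field"
  assumes "x \<in> tlen (a + b + c)" "y \<in> tlen (e + f + g)"
  shows "B_mu q (pack a b c x \<otimes> pack e f g y)
    = q ^ ((b + c) * e) *\<^sub>v pack (a + e) (b + f) (c + g) (act q (shuf a b c e f) (x \<bullet> y))"
proof (rule bilin_eq_on_free[OF _ _ _ _ _ assms])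
  fix u v :: "nat list" assume "u \<in> {w. length w = a + b + c}" "v \<in> {w. length w = e + f + g}"
  then have u: "length u = a + b + c" and v: "length v = e + f + g"
    by auto
  obtain a1 a2 a3 where "u = a1 @ a2 @ a3" "length a1 = a" "length a2 = b" "length a3 = c"
    using word_3_blocks[OF u] by blast
  moreover obtain b1 b2 b3 where "v = b1 @ b2 @ b3" "length b1 = e" "length b2 = f" "length b3 = g"
    using word_3_blocks[OF v] by blast
  ultimately show "B_mu q (pack a b c (bas u) \<otimes> pack e f g (bas v))
    = q ^ ((b + c) * e) *\<^sub>v pack (a + e) (b + f) (c + g) (act q (shuf a b c e f) (bas u \<bullet> bas v))"
    by (simp add: pack_bas B_mu_bas)
qed (intro lin_intros)+

lemma set_shuf_subset:
  "a + b + c = d \<Longrightarrow> e + f + g = d' \<Longrightarrow> set (shuf a b c e f) \<subseteq> {1..<d + d'}"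
  by (auto dest!: set_shuf)

lemma B_mu_in_elems:
  assumes "x \<in> elemsB q d n" "y \<in> elemsB q d' n"
  shows "B_mu q (x \<otimes> y) \<in> elemsB q (d + d') n"
proof (rule elems_B_in_subspace[OF _ subspace_free _ assms(1)])
  fix a b c u assume abc: "a + b + c = d" and u: "u \<in> words n d"
  show "B_mu q (pack a b c (bas u) \<otimes> y) \<in> elemsB q (d + d') n"
  proof (rule elems_B_in_subspace[OF _ subspace_free _ assms(2)])
    fix e f g v assume efg: "e + f + g = d'" and v: "v \<in> words n d'"
    have "act q (shuf a b c e f) (bas u \<bullet> bas v) \<in> tpow n (d + d')"
      using u v set_shuf_subset[OF abc efg] by (intro act_in_tpow dot_in_tpow) auto
    moreover have "B_mu q (pack a b c (bas u) \<otimes> pack e f g (bas v))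
        = q ^ ((b + c) * e) *\<^sub>v pack (a + e) (b + f) (c + g) (act q (shuf a b c e f) (bas u \<bullet> bas v))"
      using u v abc efg by (intro B_mu_pack) (auto simp: words_def)
    moreover have "(a + e) + (b + f) + (c + g) = d + d'"
      using abc efg by simp
    ultimately show "B_mu q (pack a b c (bas u) \<otimes> pack e f g (bas v)) \<in> elemsB q (d + d') n"
      using pack_in_elems pm.subspace_scale[OF subspace_free] by metis
  qed (intro lin_intros)
qed (intro lin_intros)

lemma act_intertwine:
  assumes "braid_of [i] * braid_of js = braid_of js * braid_of [k]"
    and "q \<noteq> 0" "i \<in> {1..<d}" "set js \<subseteq> {1..<d}" "x \<in> tlen d"
  shows "act q js (T q i x) = T q k (act q js x)"
proof -
  have "act q ([i] @ js) x = act q (js @ [k]) x"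
    by (rule act_braid_eq[where d = d]) (use assms in \<open>auto simp: braid_of_append simp del: append_Cons\<close>)
  then show ?thesis
    by (simp add: act_append act_Cons)
qed

text \<open>A generator inside a block is carried to a generator inside a block of the product, so \<open>T_i - q\<close>
  before the shuffle becomes \<open>T_j - q\<close> after it.\<close>

lemma shuf_Rel:
  fixes q :: "'k::field"
  assumes q: "q \<noteq> 0" and abc: "a + b + c = d" and efg: "e + f + g = d'"
    and r: "r \<in> Rel q n (d + d') (blocks a b c \<union> (+) d ` blocks e f g)"
  shows "pack (a + e) (b + f) (c + g) (act q (shuf a b c e f) r) \<in> relsB q (d + d') n"
proof (rule lin_Rel_in_subspace[OF lin_compose[OF lin_pack' lin_act'] subspace_rels_B _ r])
  fix i and x :: "'k tensor"
  assume i: "i \<in> blocks a b c \<union> (+) d ` blocks e f g" and x: "x \<in> tpow n (d + d')"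
  note range = set_shuf_subset[OF abc efg]
  obtain j where j: "j \<in> blocks (a + e) (b + f) (c + g)"
    "braid_of [i] * braid_of (shuf a b c e f) = braid_of (shuf a b c e f) * braid_of [j]"
    using shuf_blocks[of i a b c e f g] i abc by auto
  have "act q (shuf a b c e f) (T q i x) = T q j (act q (shuf a b c e f) x)"
    by (rule act_intertwine[OF j(2) q _ range tpow_tlen[OF x]])
      (use i abc efg in \<open>auto simp: blocks_def\<close>)
  then have "act q (shuf a b c e f) (T q i x - q *\<^sub>v x) \<in> Rel q n (d + d') (blocks (a + e) (b + f) (c + g))"
    using T_diff_in_Rel[OF j(1) act_in_tpow[OF range x], of q] by (simp add: act_simps)
  then show "pack (a + e) (b + f) (c + g) (act q (shuf a b c e f) (T q i x - q *\<^sub>v x))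
      \<in> relsB q (d + d') n"
    by (rule pack_in_rels) (use abc efg in simp)
qed

lemma B_mu_pack_in_rels:
  assumes q: "q \<noteq> 0" and abc: "a + b + c = d" and efg: "e + f + g = d'"
    and x: "x \<in> tlen d" and y: "y \<in> tlen d'"
    and xy: "x \<bullet> y \<in> Rel q n (d + d') J" "J \<subseteq> blocks a b c \<union> (+) d ` blocks e f g"
  shows "B_mu q (pack a b c x \<otimes> pack e f g y) \<in> relsB q (d + d') n"
  using x y shuf_Rel[OF q abc efg subsetD[OF Rel_mono[OF xy(2)] xy(1)]]
  by (simp add: B_mu_pack pm.subspace_scale[OF subspace_rels_B] flip: abc efg)

lemma B_mu_rels_left:
  assumes q: "q \<noteq> 0" and x: "x \<in> relsB q d n" and y: "y \<in> elemsB q d' n"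
  shows "B_mu q (x \<otimes> y) \<in> relsB q (d + d') n"
proof (rule rels_B_in_subspace[OF _ subspace_rels_B _ x])
  fix a b c r assume abc: "a + b + c = d" and r: "r \<in> Rel q n d (blocks a b c)"
  show "B_mu q (pack a b c r \<otimes> y) \<in> relsB q (d + d') n"
  proof (rule elems_B_in_subspace[OF _ subspace_rels_B _ y])
    fix e f g v assume efg: "e + f + g = d'" and v: "v \<in> words n d'"
    show "B_mu q (pack a b c r \<otimes> pack e f g (bas v)) \<in> relsB q (d + d') n"
    proof (rule B_mu_pack_in_rels[OF q abc efg])
      show "r \<bullet> bas v \<in> Rel q n (d + d') (blocks a b c)"
        by (rule dot_Rel_left[OF r blocks_subset[OF abc]]) (simp add: v)
    qed (use v tpow_tlen[OF subsetD[OF Rel_subset_tpow[OF blocks_subset[OF abc]] r]] in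
        \<open>auto simp: words_def\<close>)
  qed (intro lin_intros)
qed (intro lin_intros)

lemma B_mu_rels_right:
  assumes q: "q \<noteq> 0" and x: "x \<in> elemsB q d n" and y: "y \<in> relsB q d' n"
  shows "B_mu q (x \<otimes> y) \<in> relsB q (d + d') n"
proof (rule elems_B_in_subspace[OF _ subspace_rels_B _ x])
  fix a b c u assume abc: "a + b + c = d" and u: "u \<in> words n d"
  show "B_mu q (pack a b c (bas u) \<otimes> y) \<in> relsB q (d + d') n"
  proof (rule rels_B_in_subspace[OF _ subspace_rels_B _ y])
    fix e f g r assume efg: "e + f + g = d'" and r: "r \<in> Rel q n d' (blocks e f g)"
    show "B_mu q (pack a b c (bas u) \<otimes> pack e f g r) \<in> relsB q (d + d') n"
    proof (rule B_mu_pack_in_rels[OF q abc efg])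
      show "bas u \<bullet> r \<in> Rel q n (d + d') ((+) d ` blocks e f g)"
        by (rule dot_Rel_right[OF r blocks_subset[OF efg]]) (simp add: u)
    qed (use u tpow_tlen[OF subsetD[OF Rel_subset_tpow[OF blocks_subset[OF efg]] r]] in
        \<open>auto simp: words_def\<close>)
  qed (intro lin_intros)
qed (intro lin_intros)

lemma tens_elems_in_subspace:
  assumes "lin f" "pm.subspace R" "\<And>x y. x \<in> elems X \<Longrightarrow> y \<in> elems Y \<Longrightarrow> f (x \<otimes> y) \<in> R"
    and "z \<in> elems (tens_space X Y)"
  shows "f z \<in> R"
proof (rule lin_free_in_subspace[OF assms(1,2) _ assms(4)])
  fix k assume "k \<in> gens (tens_space X Y)"
  then obtain i j where "k = (i, j)" "i \<in> gens X" "j \<in> gens Y"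
    by (auto simp: tens_space_def)
  then show "f (bas k) \<in> R"
    using assms(3)[of "bas i" "bas j"] by simp
qed

lemma is_map_tens:
  assumes "lin f" "is_space Z"
    and "\<And>x y. x \<in> elems X \<Longrightarrow> y \<in> elems Y \<Longrightarrow> f (x \<otimes> y) \<in> elems Z"
    and "\<And>x y. x \<in> rels X \<Longrightarrow> y \<in> elems Y \<Longrightarrow> f (x \<otimes> y) \<in> rels Z"
    and "\<And>x y. x \<in> elems X \<Longrightarrow> y \<in> rels Y \<Longrightarrow> f (x \<otimes> y) \<in> rels Z"
  shows "is_map (tens_space X Y) Z f"
  unfolding is_map_def
proof (intro conjI image_subsetI)
  show "f z \<in> elems Z" if "z \<in> elems (tens_space X Y)" for z
    by (rule tens_elems_in_subspace[OF assms(1) subspace_free assms(3) that])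
  show "f z \<in> rels Z" if z: "z \<in> rels (tens_space X Y)" for z
  proof -
    have "pm.subspace (rels Z)"
      using assms(2) by (simp add: is_space_def)
    from assms(1) this _ z[unfolded tens_space_def space.select_convs] show ?thesis
      by (rule lin_span_in_subspace) (use assms(4,5) in auto)
  qed
qed (rule assms(1))

lemma is_map_B_mu:
  "q \<noteq> 0 \<Longrightarrow> is_map (tens_space (obj (B q d) n) (obj (B q d') n)) (obj (B q (d + d')) n) (B_mu q)"
  by (rule is_map_tens[OF lin_B_mu' is_space_B B_mu_in_elems B_mu_rels_left B_mu_rels_right])

text \<open>A morphism commutes with the Hecke operator of the product, and on a tensor product it acts through
  a decomposition, whose terms add up to the morphism on concatenated words.\<close>

lemma B_mu_natural:
  fixes q :: "'k::field"
  assumes "q \<noteq> 0" "\<phi> \<in> hom q (d + d') n m" "z \<in> elems (tens_space (obj (B q d) n) (obj (B q d') n))"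
  shows "B_mu q (mor (tens_functor q (B q d) (B q d')) n m \<phi> z) = mor (B q (d + d')) n m \<phi> (B_mu q z)"
proof -
  obtain ps where some: "(SOME ps. decomposes q d d' n m \<phi> ps) = ps"
    and ps: "\<And>\<psi> \<chi>. (\<psi>, \<chi>) \<in> set ps \<Longrightarrow> \<psi> \<in> hom q d n m \<and> \<chi> \<in> hom q d' n m"
    and sum: "\<And>x y. x \<in> tlen d \<Longrightarrow> \<phi> (x \<bullet> y) = (\<Sum>(\<psi>, \<chi>)\<leftarrow>ps. \<psi> x \<bullet> \<chi> y)"
    using hom_decomposition[OF assms(2)] by blast
  have mor: "mor (tens_functor q (B q d) (B q d')) n m \<phi> z
      = (\<Sum>p\<leftarrow>ps. tens_map (mor (B q d) n m (fst p)) (mor (B q d') n m (snd p)) z)" for z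
    by (simp add: tens_functor_def deg_B some case_prod_unfold)
  show ?thesis
  proof (rule lin_eq_on_free[OF _ _ _ assms(3)])
    show "lin (\<lambda>z. B_mu q (mor (tens_functor q (B q d) (B q d')) n m \<phi> z))"
      unfolding mor by (intro lin_intros)
    show "lin (\<lambda>z. mor (B q (d + d')) n m \<phi> (B_mu q z))"
      by (rule lin_compose[OF lin_mor_B lin_B_mu'])
    fix k assume "k \<in> gens (tens_space (obj (B q d) n) (obj (B q d') n))"
    then obtain i j where k: "k = (i, j)" and ij: "i \<in> gens (obj (B q d) n)" "j \<in> gens (obj (B q d') n)"
      by (auto simp: tens_space_def)
    obtain a b c u where u: "a + b + c = d" "u \<in> words n d" "(bas i :: Bidx \<Rightarrow>\<^sub>0 'k) = pack a b c (bas u)"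
      by (rule gens_B_cases[OF ij(1)])
    obtain e f g v where v: "e + f + g = d'" "v \<in> words n d'" "(bas j :: Bidx \<Rightarrow>\<^sub>0 'k) = pack e f g (bas v)"
      by (rule gens_B_cases[OF ij(2)])
    have k': "(bas k :: Bidx \<times> Bidx \<Rightarrow>\<^sub>0 'k) = pack a b c (bas u) \<otimes> pack e f g (bas v)"
      using k u v by (metis tens_bas)
    have ul: "(bas u :: 'k tensor) \<in> tlen d" and vl: "(bas v :: 'k tensor) \<in> tlen d'"
      using u v by (auto simp: words_def)
    let ?h = "shuf a b c e f" and ?P = "pack (a + e) (b + f) (c + g)" and ?c = "q ^ ((b + c) * e)"
    have elementary: "B_mu q (tens_map (mor (B q d) n m (fst p)) (mor (B q d') n m (snd p)) (bas k))
        = ?c *\<^sub>v ?P (act q ?h (fst p (bas u) \<bullet> snd p (bas v)))" if "p \<in> set ps" for p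
    proof -
      have p: "fst p \<in> hom q d n m" "snd p \<in> hom q d' n m"
        using ps[of "fst p" "snd p"] that by auto
      have "tens_map (mor (B q d) n m (fst p)) (mor (B q d') n m (snd p)) (bas k)
          = pack a b c (fst p (bas u)) \<otimes> pack e f g (snd p (bas v))"
        unfolding k' tens_map_tens[OF lin_mor_B lin_mor_B]
        by (simp only: mor_B_pack[OF p(1) u(1) ul] mor_B_pack[OF p(2) v(1) vl])
      then show ?thesis
        using tpow_tlen[OF hom_in_tpow[OF p(1)]] tpow_tlen[OF hom_in_tpow[OF p(2)]] u(1) v(1)
        by (simp add: B_mu_pack)
    qed
    have "B_mu q (mor (tens_functor q (B q d) (B q d')) n m \<phi> (bas k))
        = (\<Sum>p\<leftarrow>ps. ?c *\<^sub>v ?P (act q ?h (fst p (bas u) \<bullet> snd p (bas v))))"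
      unfolding mor lin_sum_list[OF lin_B_mu']
      by (intro arg_cong[where f = sum_list] map_cong) (auto simp: elementary)
    also have "\<dots> = ?c *\<^sub>v ?P (act q ?h (\<Sum>p\<leftarrow>ps. fst p (bas u) \<bullet> snd p (bas v)))"
      by (rule lin_sum_list[symmetric]) (intro lin_intros)
    also have "\<dots> = ?c *\<^sub>v ?P (act q ?h (\<phi> (bas u \<bullet> bas v)))"
      by (simp only: sum[OF ul] case_prod_unfold)
    also have "\<dots> = ?c *\<^sub>v ?P (\<phi> (act q ?h (bas u \<bullet> bas v)))"
      using hom_act[OF assms(2) set_shuf_subset[OF u(1) v(1)]] u v by (simp add: dot_in_tpow words_def)
    also have "\<dots> = mor (B q (d + d')) n m \<phi> (?c *\<^sub>v ?P (act q ?h (bas u \<bullet> bas v)))"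
    proof -
      have "act q ?h (bas u \<bullet> bas v) \<in> (tlen (d + d') :: 'k tensor set)"
        by (intro act_in_tlen set_shuf_subset[OF u(1) v(1)] dot_in_tlen ul vl)
      then show ?thesis
        using u(1) v(1) by (subst lin_scale[OF lin_mor_B], subst mor_B_pack[OF assms(2)]) auto
    qed
    also have "?c *\<^sub>v ?P (act q ?h (bas u \<bullet> bas v)) = B_mu q (bas k)"
      unfolding k' using ul vl u(1) v(1) by (subst B_mu_pack) auto
    finally show "B_mu q (mor (tens_functor q (B q d) (B q d')) n m \<phi> (bas k))
        = mor (B q (d + d')) n m \<phi> (B_mu q (bas k))" .
  qed
qed

lemma B_mu_assoc:
  fixes q :: "'k::field"
  assumes "q \<noteq> 0" "x \<in> elemsB q d1 n" "y \<in> elemsB q d2 n" "z \<in> elems (obj (B q d3) n)"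
  shows "B_mu q (B_mu q (x \<otimes> y) \<otimes> z) = B_mu q (x \<otimes> B_mu q (y \<otimes> z))"
proof (rule elems_B_eqI[OF _ _ _ assms(2)])
  fix a b c u assume abc: "a + b + c = d1" and u: "u \<in> words n d1"
  let ?x = "pack a b c (bas u) :: Bidx \<Rightarrow>\<^sub>0 'k"
  show "B_mu q (B_mu q (?x \<otimes> y) \<otimes> z) = B_mu q (?x \<otimes> B_mu q (y \<otimes> z))"
  proof (rule elems_B_eqI[OF _ _ _ assms(3)])
    fix e f g v assume efg: "e + f + g = d2" and v: "v \<in> words n d2"
    let ?y = "pack e f g (bas v) :: Bidx \<Rightarrow>\<^sub>0 'k"
    show "B_mu q (B_mu q (?x \<otimes> ?y) \<otimes> z) = B_mu q (?x \<otimes> B_mu q (?y \<otimes> z))"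
    proof (rule elems_B_eqI[OF _ _ _ assms(4)])
      fix h k l w assume hkl: "h + k + l = d3" and w: "w \<in> words n d3"
      let ?z = "pack h k l (bas w) :: Bidx \<Rightarrow>\<^sub>0 'k"
      define X Y Z :: "'k tensor" where "X = bas u" "Y = bas v" "Z = bas w"
      then have X: "X \<in> tlen d1" and Y: "Y \<in> tlen d2" and Z: "Z \<in> tlen d3"
        using u v w by (auto simp: words_def)
      let ?s1 = "shuf a b c e f" and ?s2 = "shuf (a + e) (b + f) (c + g) h k"
      let ?s3 = "shuf e f g h k" and ?s4 = "shuf a b c (e + h) (f + k)"
      have XY: "act q ?s1 (X \<bullet> Y) \<in> tlen (d1 + d2)"
        by (intro act_in_tlen dot_in_tlen X Y set_shuf_subset[OF abc efg])
      have YZ: "act q ?s3 (Y \<bullet> Z) \<in> tlen (d2 + d3)"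
        by (intro act_in_tlen dot_in_tlen Y Z set_shuf_subset[OF efg hkl])
      have "B_mu q (pack a b c X \<otimes> pack e f g Y)
          = q ^ ((b + c) * e) *\<^sub>v pack (a + e) (b + f) (c + g) (act q ?s1 (X \<bullet> Y))"
        by (rule B_mu_pack) (use X Y abc efg in auto)
      moreover have "B_mu q (pack (a + e) (b + f) (c + g) (act q ?s1 (X \<bullet> Y)) \<otimes> pack h k l Z)
          = q ^ ((b + f + (c + g)) * h) *\<^sub>v pack (a + e + h) (b + f + k) (c + g + l)
              (act q ?s2 (act q ?s1 (X \<bullet> Y) \<bullet> Z))"
        by (rule B_mu_pack) (use XY Z abc efg hkl in \<open>auto simp: algebra_simps\<close>)
      ultimately have left: "B_mu q (B_mu q (pack a b c X \<otimes> pack e f g Y) \<otimes> pack h k l Z)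
          = q ^ ((b + c) * e + (b + f + (c + g)) * h) *\<^sub>v pack (a + e + h) (b + f + k) (c + g + l)
              (act q ?s2 (act q ?s1 (X \<bullet> Y) \<bullet> Z))"
        by (simp add: lin_simps[OF lin_B_mu'] lin_simps[OF lin_tens_left[OF lin_ident]] power_add)
      have "B_mu q (pack e f g Y \<otimes> pack h k l Z)
          = q ^ ((f + g) * h) *\<^sub>v pack (e + h) (f + k) (g + l) (act q ?s3 (Y \<bullet> Z))"
        by (rule B_mu_pack) (use Y Z efg hkl in auto)
      moreover have "B_mu q (pack a b c X \<otimes> pack (e + h) (f + k) (g + l) (act q ?s3 (Y \<bullet> Z)))
          = q ^ ((b + c) * (e + h)) *\<^sub>v pack (a + (e + h)) (b + (f + k)) (c + (g + l))
              (act q ?s4 (X \<bullet> act q ?s3 (Y \<bullet> Z)))"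
        by (rule B_mu_pack) (use X YZ abc efg hkl in \<open>auto simp: algebra_simps\<close>)
      ultimately have right: "B_mu q (pack a b c X \<otimes> B_mu q (pack e f g Y \<otimes> pack h k l Z))
          = q ^ ((f + g) * h + (b + c) * (e + h)) *\<^sub>v pack (a + (e + h)) (b + (f + k)) (c + (g + l))
              (act q ?s4 (X \<bullet> act q ?s3 (Y \<bullet> Z)))"
        by (simp add: lin_simps[OF lin_B_mu'] lin_simps[OF lin_tens_right[OF lin_ident]] power_add)
      have "act q ?s2 (act q ?s1 (X \<bullet> Y) \<bullet> Z) = act q (?s1 @ ?s2) (X \<bullet> Y \<bullet> Z)"
        using act_dot_left[OF set_shuf_subset[OF abc efg] dot_in_tlen[OF X Y], of q Z]
        by (simp add: act_append dot_assoc)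
      also have "\<dots> = act q (map ((+) d1) ?s3 @ ?s4) (X \<bullet> Y \<bullet> Z)"
      proof (rule act_braid_eq[where d = "d1 + (d2 + d3)", OF _ assms(1)])
        show "braid_of (?s1 @ ?s2) = braid_of (map ((+) d1) ?s3 @ ?s4)"
          unfolding braid_of_append abc[symmetric] by (rule shuf_assoc)
        show "set (?s1 @ ?s2) \<subseteq> {1..<d1 + (d2 + d3)}"
          using abc efg hkl by (auto dest!: set_shuf)
      qed (intro dot_in_tlen X Y Z)
      also have "\<dots> = act q ?s4 (X \<bullet> act q ?s3 (Y \<bullet> Z))"
        using act_dot_right[OF set_shuf_subset[OF efg hkl] X dot_in_tlen[OF Y Z], of q]
        by (simp add: act_append)
      finally show "B_mu q (B_mu q (?x \<otimes> ?y) \<otimes> ?z) = B_mu q (?x \<otimes> B_mu q (?y \<otimes> ?z))"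
        using left right unfolding X_Y_Z_def by (simp add: algebra_simps)
    qed (intro lin_intros)+
  qed (intro lin_intros)+
qed (intro lin_intros)+


section \<open>The algebra structure\<close>

lemma B_unit_bas: "B_unit (bas []) = pack 0 0 0 (bas [])"
  by (simp add: B_unit_def pack_def cut_def)

lemma nat_trans_B_unit:
  fixes q :: "'k::field"
  shows "nat_trans q unit_functor (B q 0) (\<lambda>n. B_unit)"
proof -
  have unit: "B_unit x = pack 0 0 0 x" if "x \<in> tlen 0" for x :: "'k tensor"
    by (rule lin_eq_on_free[where f = B_unit, OF _ lin_pack' _ that])
      (simp_all add: B_unit_def lin_lext pack_def cut_def)
  have lin: "lin (B_unit :: 'k tensor \<Rightarrow> _)"
    by (simp add: B_unit_def lin_lext)
  have "is_map \<lparr>gens = words n 0, rels = {0}\<rparr> (obj (B q 0) n) B_unit" for n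
    unfolding is_map_def
  proof (intro conjI image_subsetI lin)
    fix x :: "'k tensor"
    show "B_unit x \<in> elemsB q 0 n" if "x \<in> elems \<lparr>gens = words n 0, rels = {0}\<rparr>"
      using that pack_in_elems[of x n 0 0 0 0 q] unit[OF tpow_tlen[of x n 0]] by simp
    show "B_unit x \<in> relsB q 0 n" if "x \<in> rels \<lparr>gens = words n 0, rels = {0}\<rparr>"
      using that pm.subspace_0[OF subspace_rels_B] by (simp add: lin_zero[OF lin])
  qed
  moreover have "eqv (obj (B q 0) m) (B_unit (\<phi> x)) (mor (B q 0) n m \<phi> (B_unit x))"
    if "\<phi> \<in> hom q 0 n m" "x \<in> tpow n 0" for \<phi> x n m
    using mor_B_pack[OF that(1), of 0 0 0 x] tpow_tlen[OF that(2)] tpow_tlen[OF hom_in_tpow[OF that(1)]]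
    by (intro eqv_refl subspace_rels_B) (simp only: unit add_0)
  ultimately show ?thesis
    by (simp add: nat_trans_def unit_functor_def deg_B)
qed

lemma pq_algebra_B:
  fixes q :: "'k::field"
  assumes "q \<noteq> 0"
  shows "pq_algebra q (B q) (\<lambda>d1 d2 n. B_mu q) (\<lambda>n. B_unit)"
proof -
  have "nat_trans q (tens_functor q (B q d1) (B q d2)) (B q (d1 + d2)) (\<lambda>n. B_mu q)" for d1 d2
  proof -
    have "eqv (obj (B q (d1 + d2)) m) (B_mu q (mor (tens_functor q (B q d1) (B q d2)) n m \<phi> x))
        (mor (B q (d1 + d2)) n m \<phi> (B_mu q x))"
      if "\<phi> \<in> hom q (d1 + d2) n m" "x \<in> elems (tens_space (obj (B q d1) n) (obj (B q d2) n))" for \<phi> x n m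
      by (rule eqv_refl[OF subspace_rels_B B_mu_natural[OF assms that]])
    then show ?thesis
      using is_map_B_mu[OF assms] by (simp add: nat_trans_def tens_functor_def deg_B)
  qed
  moreover have "eqv (obj (B q d) n) (B_mu q (B_unit (bas []) \<otimes> x)) x"
    and "eqv (obj (B q d) n) (B_mu q (x \<otimes> B_unit (bas []))) x"
    if x: "x \<in> elemsB q d n" for d n x
  proof -
    have lin: "lin (\<lambda>x. B_mu q (B_unit (bas []) \<otimes> x))" "lin (\<lambda>x. B_mu q (x \<otimes> B_unit (bas [])))"
      by (intro lin_intros)+
    have bas: "bas [] \<in> tlen (0 + 0 + 0)"
      by simp
    have w: "bas w \<in> tlen (a + b + c)" if "a + b + c = d" "w \<in> words n d" for w a b c
      using that by (auto simp: words_def)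
    have empty: "shuf 0 0 0 e f = []" "shuf a b c 0 0 = []" for a b c e f
      by (simp_all add: shuf_def)
    have "B_mu q (B_unit (bas []) \<otimes> x) = x"
    proof (rule elems_B_eqI[OF lin(1) lin_ident _ x])
      fix a b c w assume "a + b + c = d" "w \<in> words n d"
      then show "B_mu q (B_unit (bas []) \<otimes> pack a b c (bas w)) = pack a b c (bas w)"
        unfolding B_unit_bas by (subst B_mu_pack[OF bas w]) (simp_all add: empty)
    qed
    then show "eqv (obj (B q d) n) (B_mu q (B_unit (bas []) \<otimes> x)) x"
      by (rule eqv_refl[OF subspace_rels_B])
    have "B_mu q (x \<otimes> B_unit (bas [])) = x"
    proof (rule elems_B_eqI[OF lin(2) lin_ident _ x])
      fix a b c w assume "a + b + c = d" "w \<in> words n d"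
      then show "B_mu q (pack a b c (bas w) \<otimes> B_unit (bas [])) = pack a b c (bas w)"
        unfolding B_unit_bas by (subst B_mu_pack[OF w bas]) (simp_all add: empty)
    qed
    then show "eqv (obj (B q d) n) (B_mu q (x \<otimes> B_unit (bas []))) x"
      by (rule eqv_refl[OF subspace_rels_B])
  qed
  moreover have "eqv (obj (B q (d1 + d2 + d3)) n) (B_mu q (B_mu q (x \<otimes> y) \<otimes> z)) (B_mu q (x \<otimes> B_mu q (y \<otimes> z)))"
    if "x \<in> elemsB q d1 n" "y \<in> elemsB q d2 n" "z \<in> elems (obj (B q d3) n)"
    for d1 d2 d3 n x y z
    by (rule eqv_refl[OF subspace_rels_B B_mu_assoc[OF assms that]])
  ultimately show ?thesis
    by (simp add: pq_algebra_def poly_functor_B deg_B nat_trans_B_unit)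
qed


section \<open>The grading\<close>

definition degree_part :: "nat \<Rightarrow> (Bidx \<Rightarrow>\<^sub>0 'k::field) \<Rightarrow> (Bidx \<Rightarrow>\<^sub>0 'k)"
  where "degree_part i = lext (\<lambda>(\<alpha>, t). if B_deg \<alpha> = i then bas (\<alpha>, t) else 0)"

lemma lin_degree_part [lin_intros]: "lin f \<Longrightarrow> lin (\<lambda>x. degree_part i (f x))"
  unfolding degree_part_def by (rule lin_lext')

lemma lin_degree_part': "lin (degree_part i)"
  by (rule lin_degree_part[OF lin_ident])

lemma degree_part_pack: "degree_part i (pack a b c x) = (if b + 2 * c = i then pack a b c x else 0)"
  by (rule lin_ext[where f = "\<lambda>x. degree_part i (pack a b c x)"
        and g = "\<lambda>x. if b + 2 * c = i then pack a b c x else 0"])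
    (cases "b + 2 * c = i"; simp add: degree_part_def pack_def B_deg_def lin_lext' lin_lext lin_null)+

lemma pack_in_grading:
  assumes "x \<in> tpow n d" "a + b + c = d" "b + 2 * c = i"
  shows "pack a b c x \<in> B_grading q d i n"
proof -
  have "pack a b c x \<in> free {(\<alpha>, t) \<in> gens (obj (B q d) n). B_deg \<alpha> = i}"
    by (rule lin_free_in_subspace[OF lin_pack' subspace_free _ assms(1)])
      (use assms in \<open>auto simp: pack_def cut_def gens_B words_def B_deg_def dest: in_set_takeD in_set_dropD\<close>)
  then show ?thesis
    using pm.subspace_0[OF subspace_rels_B] unfolding B_grading_def by force
qed

lemma subspace_grading: "pm.subspace (B_grading q d i n)"
  unfolding B_grading_def
  by (rule pm.subspace_sums[OF subspace_free subspace_rels_B])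

lemma rels_subset_grading: "relsB q d n \<subseteq> B_grading q d i n"
  using pm.subspace_0[OF subspace_free] unfolding B_grading_def by force

lemma rels_B_subset_elems: "relsB q d n \<subseteq> elemsB q d n"
  using is_space_B unfolding is_space_def by blast

lemma grading_subset_elems: "B_grading q d i n \<subseteq> elemsB q d n"
proof
  fix x assume "x \<in> B_grading q d i n"
  then obtain y r where "x = y + r" "y \<in> free {(\<alpha>, t) \<in> gens (obj (B q d) n). B_deg \<alpha> = i}"
    "r \<in> relsB q d n"
    unfolding B_grading_def by blast
  moreover have "free {(\<alpha>, t) \<in> gens (obj (B q d) n). B_deg \<alpha> = i} \<subseteq> elemsB q d n"
    by (rule free_mono) auto
  ultimately show "x \<in> elemsB q d n"
    using rels_B_subset_elems[of q d n] by (auto intro!: pm.subspace_add[OF subspace_free])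
qed

lemma grading_in_subspace:
  fixes q :: "'k::field"
  assumes "lin f" "pm.subspace R"
    and "\<And>a b c w. a + b + c = d \<Longrightarrow> b + 2 * c = i \<Longrightarrow> w \<in> words n d \<Longrightarrow> f (pack a b c (bas w)) \<in> R"
    and "\<And>r. r \<in> relsB q d n \<Longrightarrow> f r \<in> R"
    and "x \<in> B_grading q d i n"
  shows "f x \<in> R"
proof -
  obtain y r where x: "x = y + r" and y: "y \<in> free {(\<alpha>, t) \<in> gens (obj (B q d) n). B_deg \<alpha> = i}"
    and r: "r \<in> relsB q d n"
    using assms(5) unfolding B_grading_def by blast
  have "f y \<in> R"
  proof (rule lin_free_in_subspace[OF assms(1,2) _ y])
    fix k assume "k \<in> {(\<alpha>, t) \<in> gens (obj (B q d) n). B_deg \<alpha> = i}"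
    then obtain a b c u v w where k: "k = ((a, b, c), (u, v, w))" "a + b + c = d" "b + 2 * c = i"
      "u \<in> words n a" "v \<in> words n b" "w \<in> words n c"
      unfolding gens_B by (auto simp: B_deg_def)
    then have "u @ v @ w \<in> words n d"
      by (auto simp: words_def)
    moreover have "(bas k :: Bidx \<Rightarrow>\<^sub>0 'k) = pack a b c (bas (u @ v @ w))"
      using k by (simp add: pack_bas words_def)
    ultimately show "f (bas k) \<in> R"
      using assms(3) k by metis
  qed
  then show ?thesis
    using assms(4)[OF r] x by (simp add: lin_add[OF assms(1)] pm.subspace_add[OF assms(2)])
qed

lemma degree_part_rels: "r \<in> relsB q d n \<Longrightarrow> degree_part i r \<in> relsB q d n"
  by (rule rels_B_in_subspace[OF lin_degree_part' subspace_rels_B])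
    (auto simp: degree_part_pack pack_in_rels pm.subspace_0[OF subspace_rels_B])

lemma degree_part_grading:
  assumes "x \<in> B_grading q d i n"
  shows "degree_part i x - x \<in> relsB q d n"
    and "i \<noteq> j \<Longrightarrow> degree_part j x \<in> relsB q d n"
proof -
  show "degree_part i x - x \<in> relsB q d n"
    by (rule grading_in_subspace[OF lin_minus[OF lin_degree_part' lin_ident] subspace_rels_B _ _ assms])
      (auto simp: degree_part_pack pm.subspace_0[OF subspace_rels_B]
        intro: pm.subspace_diff[OF subspace_rels_B] degree_part_rels)
  show "degree_part j x \<in> relsB q d n" if "i \<noteq> j"
    by (rule grading_in_subspace[OF lin_degree_part' subspace_rels_B _ _ assms])
      (use that in \<open>auto simp: degree_part_pack pm.subspace_0[OF subspace_rels_B] intro: degree_part_rels\<close>)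
qed

lemma grading_B: "grading q (B q d) (B_grading q d)"
  unfolding grading_def deg_B
proof (intro conjI allI ballI impI)
  fix i n m \<phi> assume \<phi>: "\<phi> \<in> hom q d n m"
  show "mor (B q d) n m \<phi> ` B_grading q d i n \<subseteq> B_grading q d i m"
  proof (rule image_subsetI)
    fix x assume x: "x \<in> B_grading q d i n"
    show "mor (B q d) n m \<phi> x \<in> B_grading q d i m"
    proof (rule grading_in_subspace[OF lin_mor_B subspace_grading _ _ x])
      show "mor (B q d) n m \<phi> r \<in> B_grading q d i m" if "r \<in> relsB q d n" for r
      proof -
        have "mor (B q d) n m \<phi> r \<in> relsB q d m"
          using is_map_mor_B[OF \<phi>] that unfolding is_map_def by blast
        then show ?thesis
          by (rule subsetD[OF rels_subset_grading])
      qed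
      fix a b c w assume abc: "a + b + c = d" "b + 2 * c = i" and w: "w \<in> words n d"
      then have "mor (B q d) n m \<phi> (pack a b c (bas w)) = pack a b c (\<phi> (bas w))"
        by (intro mor_B_pack[OF \<phi>]) (auto simp: words_def)
      then show "mor (B q d) n m \<phi> (pack a b c (bas w)) \<in> B_grading q d i m"
        using pack_in_grading[OF hom_in_tpow[OF \<phi>] abc] by simp
    qed
  qed
next
  fix n x assume x: "x \<in> elemsB q d n"
  have part: "degree_part i x \<in> B_grading q d i n" for i
    by (rule elems_B_in_subspace[OF lin_degree_part' subspace_grading _ x])
      (auto simp: degree_part_pack pack_in_grading pm.subspace_0[OF subspace_grading])
  have "x = (\<Sum>i\<in>{..2 * d}. degree_part i x)"
  proof (rule elems_B_eqI[where f = "\<lambda>x. x" and g = "\<lambda>x. \<Sum>i\<in>{..2 * d}. degree_part i x", OF _ _ _ x])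
    show "pack a b c (bas w) = (\<Sum>i\<in>{..2 * d}. degree_part i (pack a b c (bas w)))"
      if "a + b + c = d" for a b c w
      using that by (simp add: degree_part_pack)
  qed (intro lin_intros)+
  then have "eqv (obj (B q d) n) x (\<Sum>i\<in>{..2 * d}. degree_part i x)"
    by (rule eqv_refl[OF subspace_rels_B])
  then show "\<exists>I c. finite I \<and> (\<forall>i\<in>I. c i \<in> B_grading q d i n) \<and> eqv (obj (B q d) n) x (\<Sum>i\<in>I. c i)"
    using part by (intro exI[of _ "{..2 * d}"] exI[of _ "\<lambda>i. degree_part i x"] conjI) simp_all
next
  fix n I c j assume I: "finite I" "\<forall>i\<in>I. c i \<in> B_grading q d i n"
    and sum: "(\<Sum>i\<in>I. c i) \<in> relsB q d n" and j: "j \<in> I"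
  let ?R = "relsB q d n"
  have "degree_part j (\<Sum>i\<in>I. c i) = degree_part j (c j) + (\<Sum>i\<in>I - {j}. degree_part j (c i))"
    using I(1) j by (simp add: lin_simps[OF lin_degree_part'] sum.remove[of I j])
  moreover have "(\<Sum>i\<in>I - {j}. degree_part j (c i)) \<in> ?R"
  proof (rule pm.subspace_sum[OF subspace_rels_B])
    fix i assume i: "i \<in> I - {j}"
    then have "c i \<in> B_grading q d i n"
      using I(2) by blast
    then show "degree_part j (c i) \<in> ?R"
      by (rule degree_part_grading(2)) (use i in blast)
  qed
  then have "degree_part j (\<Sum>i\<in>I. c i) - (\<Sum>i\<in>I - {j}. degree_part j (c i)) \<in> ?R"
    by (intro pm.subspace_diff[OF subspace_rels_B] degree_part_rels[OF sum])
  ultimately have "degree_part j (c j) \<in> ?R"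
    by simp
  moreover have "degree_part j (c j) - c j \<in> ?R"
    by (rule degree_part_grading(1)) (use I(2) j in blast)
  ultimately have "degree_part j (c j) - (degree_part j (c j) - c j) \<in> ?R"
    by (rule pm.subspace_diff[OF subspace_rels_B])
  then show "c j \<in> ?R"
    by simp
qed (rule subspace_grading rels_subset_grading grading_subset_elems)+

lemma B_mu_grading:
  assumes "q \<noteq> 0" "x \<in> B_grading q d i n" "y \<in> B_grading q d' j n"
  shows "B_mu q (x \<otimes> y) \<in> B_grading q (d + d') (i + j) n"
proof (rule grading_in_subspace[where f = "\<lambda>x. B_mu q (x \<otimes> y)", OF _ subspace_grading _ _ assms(2)])
  have y: "y \<in> elemsB q d' n"
    by (rule subsetD[OF grading_subset_elems assms(3)])
  show "B_mu q (r \<otimes> y) \<in> B_grading q (d + d') (i + j) n" if "r \<in> relsB q d n" for r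
    by (rule subsetD[OF rels_subset_grading B_mu_rels_left[OF assms(1) that y]])
  fix a b c u assume abc: "a + b + c = d" "b + 2 * c = i" and u: "u \<in> words n d"
  show "B_mu q (pack a b c (bas u) \<otimes> y) \<in> B_grading q (d + d') (i + j) n"
  proof (rule grading_in_subspace[where f = "\<lambda>y. B_mu q (pack a b c (bas u) \<otimes> y)",
        OF _ subspace_grading _ _ assms(3)])
    show "B_mu q (pack a b c (bas u) \<otimes> r) \<in> B_grading q (d + d') (i + j) n"
      if "r \<in> relsB q d' n" for r
      by (rule subsetD[OF rels_subset_grading B_mu_rels_right[OF assms(1) pack_in_elems[OF _ abc(1)] that]])
        (simp add: u)
    fix e f g v assume efg: "e + f + g = d'" "f + 2 * g = j" and v: "v \<in> words n d'"
    have "act q (shuf a b c e f) (bas u \<bullet> bas v) \<in> tpow n (d + d')"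
      using u v set_shuf_subset[OF abc(1) efg(1)] by (intro act_in_tpow dot_in_tpow) auto
    then have "pack (a + e) (b + f) (c + g) (act q (shuf a b c e f) (bas u \<bullet> bas v))
        \<in> B_grading q (d + d') (i + j) n"
      by (rule pack_in_grading) (use abc efg in auto)
    moreover have "B_mu q (pack a b c (bas u) \<otimes> pack e f g (bas v))
        = q ^ ((b + c) * e) *\<^sub>v pack (a + e) (b + f) (c + g) (act q (shuf a b c e f) (bas u \<bullet> bas v))"
      using u v abc efg by (intro B_mu_pack) (auto simp: words_def)
    ultimately show "B_mu q (pack a b c (bas u) \<otimes> pack e f g (bas v)) \<in> B_grading q (d + d') (i + j) n"
      using pm.subspace_scale[OF subspace_grading] by metis
  qed (intro lin_intros)
qed (intro lin_intros)

lemma graded_algebra_B: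
  assumes "q \<noteq> 0"
  shows "graded_algebra q (B q) (\<lambda>d1 d2 n. B_mu q) (\<lambda>n. B_unit) (B_grading q)"
proof -
  have "B_unit (bas []) \<in> B_grading q 0 0 n" for n
    unfolding B_unit_bas by (rule pack_in_grading) (auto simp: words_def)
  then show ?thesis
    using pq_algebra_B[OF assms] grading_B[of q] B_mu_grading[OF assms] by (simp add: graded_algebra_def)
qed


section \<open>The differential\<close>

text \<open>The operator inducing the coproduct \<open>\<Delta>\<^sup>(\<^sup>d\<^sup>-\<^sup>1\<^sup>,\<^sup>1\<^sup>)\<close> on the \<open>d\<close> letters after the first \<open>p\<close>.\<close>

definition coproduct :: "'k::field \<Rightarrow> nat \<Rightarrow> nat \<Rightarrow> 'k tensor \<Rightarrow> 'k tensor"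
  where "coproduct q p d x = (\<Sum>i\<in>{1..d}. q ^ (d - i) *\<^sub>v act q [p + i..<p + d] x)"

lemma lin_coproduct [lin_intros]: "lin f \<Longrightarrow> lin (\<lambda>x. coproduct q p d (f x))"
  unfolding coproduct_def by (intro lin_intros)

lemma lin_coproduct': "lin (coproduct q p d)"
  by (rule lin_coproduct[OF lin_ident])

lemma coproduct_0 [simp]: "coproduct q p 0 x = 0"
  by (simp add: coproduct_def)

lemma coproduct_in_tpow: "p + d \<le> l \<Longrightarrow> x \<in> tpow n l \<Longrightarrow> coproduct q p d x \<in> tpow n l"
  unfolding coproduct_def
  by (intro pm.subspace_sum pm.subspace_scale subspace_free act_in_tpow) auto

lemma coproduct_in_tlen: "p + d \<le> l \<Longrightarrow> x \<in> tlen l \<Longrightarrow> coproduct q p d x \<in> tlen l"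
  unfolding coproduct_def
  by (intro pm.subspace_sum pm.subspace_scale subspace_free act_in_tlen) auto

lemma coproduct_hom:
  assumes "\<phi> \<in> hom q l n m" "p + d \<le> l" "x \<in> tpow n l"
  shows "\<phi> (coproduct q p d x) = coproduct q p d (\<phi> x)"
proof -
  have "\<phi> (act q [p + i..<p + d] x) = act q [p + i..<p + d] (\<phi> x)" if "i \<in> {1..d}" for i
    by (rule hom_act[OF assms(1) _ assms(3)]) (use that assms(2) in auto)
  then show ?thesis
    unfolding coproduct_def by (simp add: lin_simps[OF hom_lin[OF assms(1)]])
qed

lemma coproduct_dot_left:
  assumes "p + d \<le> l" "x \<in> tlen l"
  shows "coproduct q p d (x \<bullet> y) = coproduct q p d x \<bullet> y"
proof -
  have "act q [p + i..<p + d] (x \<bullet> y) = act q [p + i..<p + d] x \<bullet> y" if "i \<in> {1..d}" for i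
    by (rule act_dot_left[OF _ assms(2)]) (use that assms(1) in auto)
  then show ?thesis
    unfolding coproduct_def by (simp add: dot_simps)
qed

lemma map_plus_upt: "map ((+) k) [i..<j] = [k + i..<k + j]"
  by (rule nth_equalityI) auto

lemma coproduct_dot_right:
  assumes "p + d \<le> l" "x \<in> tlen k" "y \<in> tlen l"
  shows "coproduct q (k + p) d (x \<bullet> y) = x \<bullet> coproduct q p d y"
proof -
  have "act q [k + p + i..<k + p + d] (x \<bullet> y) = x \<bullet> act q [p + i..<p + d] y" if "i \<in> {1..d}" for i
  proof -
    have "[k + p + i..<k + p + d] = map ((+) k) [p + i..<p + d]"
      by (simp add: map_plus_upt add.assoc)
    then show ?thesis
      using act_dot_right[of "[p + i..<p + d]" l x k y q] that assms by auto
  qed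
  then show ?thesis
    unfolding coproduct_def by (simp add: dot_simps)
qed

text \<open>The letter that is split off comes from the first \<open>d\<close> letters and then crosses the other \<open>e\<close>, or it
  is one of those \<open>e\<close>.\<close>

lemma coproduct_add:
  "coproduct q p (d + e) x = q ^ e *\<^sub>v act q [p + d..<p + d + e] (coproduct q p d x) + coproduct q (p + d) e x"
proof -
  have run: "[p + i..<p + (d + e)] = [p + i..<p + d] @ [p + d..<p + d + e]" if "i \<in> {1..d}" for i
    using that upt_add_eq_append[of "p + i" "p + d" e] by (simp add: add.assoc)
  have power: "q ^ (d + e - i) = q ^ e * q ^ (d - i)" if "i \<in> {1..d}" for i
    using that by (simp add: add.commute flip: power_add)
  have "{1..d + e} = {1..d} \<union> {d + 1..d + e}"
    by auto
  then have "coproduct q p (d + e) x = (\<Sum>i\<in>{1..d}. q ^ (d + e - i) *\<^sub>v act q [p + i..<p + (d + e)] x)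
      + (\<Sum>i\<in>{d + 1..d + e}. q ^ (d + e - i) *\<^sub>v act q [p + i..<p + (d + e)] x)"
    unfolding coproduct_def by (simp add: sum.union_disjoint del: upt_Suc)
  also have "(\<Sum>i\<in>{1..d}. q ^ (d + e - i) *\<^sub>v act q [p + i..<p + (d + e)] x)
      = q ^ e *\<^sub>v act q [p + d..<p + d + e] (coproduct q p d x)"
    unfolding coproduct_def act_simps pm.scale_sum_right
    by (rule sum.cong) (simp_all add: run act_append power)
  also have "(\<Sum>i\<in>{d + 1..d + e}. q ^ (d + e - i) *\<^sub>v act q [p + i..<p + (d + e)] x) = coproduct q (p + d) e x"
    unfolding coproduct_def
    by (rule sum.reindex_bij_witness[of _ "\<lambda>i. i + d" "\<lambda>i. i - d"]) (auto simp: add_ac)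
  finally show ?thesis .
qed


lemma coproduct_far:
  assumes "q \<noteq> 0" "k \<in> {1..<l}" "p + d \<le> l" "k < p \<or> p + d < k" "x \<in> tlen l"
  shows "coproduct q p d (T q k x) = T q k (coproduct q p d x)"
proof -
  have "act q [p + i..<p + d] (T q k x) = T q k (act q [p + i..<p + d] x)" if "i \<in> {1..d}" for i
    by (rule act_intertwine[where d = l], rule braid_of_far_words) (use that assms in auto)
  then show ?thesis
    unfolding coproduct_def T_simps by (intro sum.cong) auto
qed

text \<open>For \<open>i < j\<close> the run carries the generator \<open>j\<close> to \<open>j - 1\<close>; for \<open>i > j + 1\<close> they commute. In both cases
  the result lies among the first \<open>d - 1\<close> letters.\<close>

lemma coproduct_term_shift:
  assumes q: "q \<noteq> 0" and j: "1 \<le> j" "j < d" and pd: "p + d \<le> l" and x: "x \<in> tpow n l"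
    and i: "i \<in> {1..d}" "i \<noteq> j" "i \<noteq> j + 1"
  shows "act q [p + i..<p + d] (T q (p + j) x - q *\<^sub>v x) \<in> Rel q n l {p + 1..<p + d - 1}"
proof -
  let ?A = "[p + i..<p + d]"
  obtain k where k: "k \<in> {p + 1..<p + d - 1}"
    and intertwine: "braid_of [p + j] * braid_of ?A = braid_of ?A * braid_of [k]"
  proof (cases "i < j")
    case True
    obtain j' where j': "j = Suc j'"
      using j by (cases j) auto
    then have "braid_of [p + j] * braid_of ?A = braid_of ?A * braid_of [p + j']"
      using True j ascending_run_shift[of "p + i" "p + j'" "p + d"] by simp
    moreover have "p + j' \<in> {p + 1..<p + d - 1}"
      using True i j j' by auto
    ultimately show thesis
      using that by blast
  next
    case False
    then have "braid_of [p + j] * braid_of ?A = braid_of ?A * braid_of [p + j]"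
      by (intro braid_of_far_words) (use i in auto)
    then show thesis
      using that[of "p + j"] i j False by auto
  qed
  have A: "set ?A \<subseteq> {1..<l}"
    using i pd by auto
  have "act q ?A (T q (p + j) x) = T q k (act q ?A x)"
    by (rule act_intertwine[OF intertwine q _ A tpow_tlen[OF x]]) (use j pd in auto)
  then show ?thesis
    using T_diff_in_Rel[OF k act_in_tpow[OF A x], of q] by (simp add: act_simps)
qed

text \<open>Multiplying \<open>T\<^sub>j - q\<close> into the sum defining the coproduct: the summands \<open>j\<close> and \<open>j + 1\<close> cancel
  by the quadratic relation, the others move the factor to the other side.\<close>

lemma coproduct_Rel:
  assumes q: "q \<noteq> 0" and k: "p < k" "k < p + d" and pd: "p + d \<le> l" and x: "x \<in> tpow n l"
  shows "coproduct q p d (T q k x - q *\<^sub>v x) \<in> Rel q n l {p + 1..<p + d - 1}"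
proof -
  define j where "j = k - p"
  have j: "1 \<le> j" "j < d" "k = p + j"
    using k by (auto simp: j_def)
  define y where "y = T q k x - q *\<^sub>v x"
  let ?t = "\<lambda>i. q ^ (d - i) *\<^sub>v act q [p + i..<p + d] y"
  have kl: "k \<in> {1..<l}"
    using k pd by auto
  have "[p + j..<p + d] = k # [p + (j + 1)..<p + d]"
    using j by (simp add: upt_conv_Cons)
  moreover have "q ^ (d - j) = q ^ (d - (j + 1)) * q"
    using j by (metis Suc_diff_Suc Suc_eq_plus1 power_Suc2)
  ultimately have "?t j + ?t (j + 1) = q ^ (d - (j + 1)) *\<^sub>v act q [p + (j + 1)..<p + d] (q *\<^sub>v T q k y + y)"
    by (simp add: act_Cons act_simps pm.scale_right_distrib del: upt_Suc)
  also have "q *\<^sub>v T q k y + y = 0"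
    unfolding y_def using q
    by (intro poly_mapping_eqI)
      (simp add: T_simps T_quadratic[OF q kl tpow_tlen[OF x]] lookup_add lookup_minus lookup_scale field_simps)
  finally have cancel: "?t j + ?t (j + 1) = 0"
    by (simp add: act_simps)
  \<comment> \<open>The summands \<open>j\<close> and \<open>j + 1\<close> are split off because they cancel.\<close>
  have "coproduct q p d y = ?t j + (?t (j + 1) + (\<Sum>i\<in>{1..d} - {j} - {j + 1}. ?t i))"
    using j unfolding coproduct_def by (subst sum.remove[of _ j], simp, simp, subst sum.remove[of _ "j + 1"]) auto
  also have "\<dots> = (\<Sum>i\<in>{1..d} - {j} - {j + 1}. ?t i)"
    using cancel by (simp add: add.assoc[symmetric])
  also have "\<dots> \<in> Rel q n l {p + 1..<p + d - 1}"
    unfolding y_def j(3)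
    by (intro pm.subspace_sum pm.subspace_scale subspace_Rel coproduct_term_shift q j pd x) auto
  finally show ?thesis
    by (simp add: y_def)
qed

lemma lin_B_delta [lin_intros]: "lin f \<Longrightarrow> lin (\<lambda>x. B_delta q (f x))"
  unfolding B_delta_def by (rule lin_lext')

lemma lin_B_delta': "lin (B_delta q)"
  by (rule lin_B_delta[OF lin_ident])

text \<open>As for the switch: the coproduct of a block is an operator on the whole word, and \<open>H\<close> stands for what
  happens afterwards.\<close>

lemma lext_Delta:
  fixes q :: "'k::field"
  assumes "lin H" "\<And>u' z. length u' = length v - 1 \<Longrightarrow> length (u' @ z) = length v \<Longrightarrow> F u' z = H (bas (u @ (u' @ z) @ t))"
  shows "lext (\<lambda>(u', z). F u' z) (Delta q v) = H (coproduct q (length u) (length v) (bas (u @ v @ t)))"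
proof -
  let ?d = "length v"
  define z where "z = coproduct q 0 ?d (bas v)"
  have v: "(bas v :: 'k tensor) \<in> tlen ?d" and u: "(bas u :: 'k tensor) \<in> tlen (length u)"
    by auto
  have "z \<in> tlen ?d"
    unfolding z_def by (rule coproduct_in_tlen[OF _ v]) simp
  then have "lext (\<lambda>w. F (take (?d - 1) w) (drop (?d - 1) w)) z = H (bas u \<bullet> z \<bullet> bas t)"
  proof (rule lin_eq_on_free[where g = "\<lambda>z. H (bas u \<bullet> z \<bullet> bas t)", rotated -1])
    show "lin (\<lambda>z. H (bas u \<bullet> z \<bullet> bas t))"
      by (rule lin_compose[OF assms(1)]) (intro lin_intros)
    fix w :: "nat list" assume "w \<in> {w. length w = ?d}"
    then show "lext (\<lambda>w. F (take (?d - 1) w) (drop (?d - 1) w)) (bas w) = H (bas u \<bullet> bas w \<bullet> bas t)"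
      by (simp add: assms(2))
  qed (rule lin_lext)
  moreover have "lext (\<lambda>(u', z). F u' z) (Delta q v) = lext (\<lambda>w. F (take (?d - 1) w) (drop (?d - 1) w)) z"
    by (simp add: Delta_def Let_def lext_split z_def coproduct_def)
  moreover have "coproduct q (length u + 0) ?d (bas u \<bullet> (bas v \<bullet> bas t)) = bas u \<bullet> coproduct q 0 ?d (bas v \<bullet> bas t)"
    by (rule coproduct_dot_right[OF _ u, of _ _ "?d + length t"]) auto
  moreover have "coproduct q 0 ?d (bas v \<bullet> bas t) = z \<bullet> bas t"
    unfolding z_def by (rule coproduct_dot_left[OF _ v]) simp
  ultimately show ?thesis
    by simp
qed

lemma B_delta_pack:
  fixes q :: "'k::field"
  assumes "x \<in> tlen (a + b + c)"
  shows "B_delta q (pack a b c x) = pack (a - 1) (b + 1) c (coproduct q 0 a x)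
    + q ^ (2 * b) *\<^sub>v pack a (b - 1) (c + 1) (coproduct q a b x)"
proof (rule lin_eq_on_free[where f = "\<lambda>x. B_delta q (pack a b c x)"
      and g = "\<lambda>x. pack (a - 1) (b + 1) c (coproduct q 0 a x)
    + q ^ (2 * b) *\<^sub>v pack a (b - 1) (c + 1) (coproduct q a b x)", OF _ _ _ assms])
  fix w :: "nat list" assume "w \<in> {w. length w = a + b + c}"
  then have length: "length w = a + b + c"
    by simp
  obtain u v t where w: "w = u @ v @ t" and l: "length u = a" "length v = b" "length t = c"
    using word_3_blocks[OF length] by blast
  have "B_delta1 q ((a, b, c), (u, v, t)) = pack (a - 1) (b + 1) c (coproduct q 0 a (bas w))"
  proof (cases "a = 0")
    case False
    have "lext (\<lambda>(u', z). bas ((a - 1, b + 1, c), (u', z @ v, t))) (Delta q u)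
        = pack (a - 1) (b + 1) c (coproduct q (length ([] :: nat list)) (length u) (bas ([] @ u @ (v @ t))))"
    proof (rule lext_Delta[where F = "\<lambda>u' z. bas ((a - 1, b + 1, c), (u', z @ v, t))", OF lin_pack'])
      fix u' z :: "nat list" assume "length u' = length u - 1" "length (u' @ z) = length u"
      then have "pack (a - 1) (b + 1) c (bas (u' @ (z @ v) @ t)) = (bas ((a - 1, b + 1, c), (u', z @ v, t)) :: Bidx \<Rightarrow>\<^sub>0 'k)"
        using False l by (intro pack_bas) auto
      then show "bas ((a - 1, b + 1, c), (u', z @ v, t)) = (pack (a - 1) (b + 1) c (bas ([] @ (u' @ z) @ v @ t)) :: Bidx \<Rightarrow>\<^sub>0 'k)"
        by simp
    qed
    then show ?thesis
      using False l by (simp add: B_delta1_def w)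
  qed (simp add: B_delta1_def pack_simps)
  moreover have "B_delta2 q ((a, b, c), (u, v, t)) = pack a (b - 1) (c + 1) (coproduct q a b (bas w))"
  proof (cases "b = 0")
    case False
    have "lext (\<lambda>(v', z). bas ((a, b - 1, c + 1), (u, v', z @ t))) (Delta q v)
        = pack a (b - 1) (c + 1) (coproduct q (length u) (length v) (bas (u @ v @ t)))"
    proof (rule lext_Delta[where F = "\<lambda>v' z. bas ((a, b - 1, c + 1), (u, v', z @ t))", OF lin_pack'])
      fix v' z :: "nat list" assume "length v' = length v - 1" "length (v' @ z) = length v"
      then have "pack a (b - 1) (c + 1) (bas (u @ v' @ (z @ t))) = (bas ((a, b - 1, c + 1), (u, v', z @ t)) :: Bidx \<Rightarrow>\<^sub>0 'k)"
        using False l by (intro pack_bas) auto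
      then show "bas ((a, b - 1, c + 1), (u, v', z @ t)) = (pack a (b - 1) (c + 1) (bas (u @ (v' @ z) @ t)) :: Bidx \<Rightarrow>\<^sub>0 'k)"
        by simp
    qed
    then show ?thesis
      using False l by (simp add: B_delta2_def w)
  qed (simp add: B_delta2_def pack_simps)
  ultimately show "B_delta q (pack a b c (bas w)) = pack (a - 1) (b + 1) c (coproduct q 0 a (bas w))
    + q ^ (2 * b) *\<^sub>v pack a (b - 1) (c + 1) (coproduct q a b (bas w))"
    unfolding w pack_bas[OF l(1,2)] by (simp add: B_delta_def power_mult)
qed (intro lin_intros)+

lemma pack_coproduct_in_elems:
  assumes "a + b + c = d" "x \<in> tpow n d"
  shows "pack (a - 1) (b + 1) c (coproduct q 0 a x) \<in> elemsB q' d n"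
    and "pack a (b - 1) (c + 1) (coproduct q a b x) \<in> elemsB q' d n"
  using assms
  by (cases "a = 0"; cases "b = 0";
      simp add: pack_simps pm.subspace_0[OF subspace_free] pack_in_elems coproduct_in_tpow)+

lemma B_delta_in_elems:
  assumes "x \<in> elemsB q d n"
  shows "B_delta q x \<in> elemsB q d n"
proof (rule elems_B_in_subspace[OF lin_B_delta' subspace_free _ assms])
  fix a b c w assume abc: "a + b + c = d" and w: "w \<in> words n d"
  then have "bas w \<in> tlen (a + b + c)"
    by (auto simp: words_def)
  then show "B_delta q (pack a b c (bas w)) \<in> elemsB q d n"
    using pack_coproduct_in_elems[OF abc, of "bas w" n q q] w
    by (simp add: B_delta_pack pm.subspace_add[OF subspace_free] pm.subspace_scale[OF subspace_free])
qed

lemma pack_Rel_coproduct: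
  assumes q: "q \<noteq> 0" and abc: "a + b + c = d" and k: "k \<in> blocks a b c" and x: "x \<in> tpow n d"
  shows "pack (a - 1) (b + 1) c (coproduct q 0 a (T q k x - q *\<^sub>v x)) \<in> relsB q d n"
    and "pack a (b - 1) (c + 1) (coproduct q a b (T q k x - q *\<^sub>v x)) \<in> relsB q d n"
proof -
  have kd: "k \<in> {1..<d}"
    using blocks_subset[OF abc] k by blast
  have far: "coproduct q p e (T q k x - q *\<^sub>v x) \<in> Rel q n d J"
    if "k < p \<or> p + e < k" "p + e \<le> d" "k \<in> J" for p e J
    using coproduct_far[OF q kd that(2,1) tpow_tlen[OF x]]
      T_diff_in_Rel[OF that(3) coproduct_in_tpow[OF that(2) x], of q q]
    by (simp add: lin_simps[OF lin_coproduct'])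
  show "pack (a - 1) (b + 1) c (coproduct q 0 a (T q k x - q *\<^sub>v x)) \<in> relsB q d n"
  proof (cases "a = 0")
    case False
    have "coproduct q 0 a (T q k x - q *\<^sub>v x) \<in> Rel q n d (blocks (a - 1) (b + 1) c)"
    proof (cases "k < a")
      case True
      then have "coproduct q 0 a (T q k x - q *\<^sub>v x) \<in> Rel q n d {0 + 1..<0 + a - 1}"
        using kd abc by (intro coproduct_Rel q x) auto
      moreover have "{0 + 1..<0 + a - 1} \<subseteq> blocks (a - 1) (b + 1) c"
        by (auto simp: blocks_def)
      ultimately show ?thesis
        using Rel_mono by blast
    next
      case k': False
      show ?thesis
        by (rule far) (use k k' abc False in \<open>auto simp: blocks_def\<close>)
    qed
    then show ?thesis
      by (rule pack_in_rels) (use abc False in simp)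
  qed (simp add: pack_simps pm.subspace_0[OF subspace_rels_B])
  show "pack a (b - 1) (c + 1) (coproduct q a b (T q k x - q *\<^sub>v x)) \<in> relsB q d n"
  proof (cases "b = 0")
    case False
    have "coproduct q a b (T q k x - q *\<^sub>v x) \<in> Rel q n d (blocks a (b - 1) (c + 1))"
    proof (cases "a < k \<and> k < a + b")
      case True
      then have "coproduct q a b (T q k x - q *\<^sub>v x) \<in> Rel q n d {a + 1..<a + b - 1}"
        using abc by (intro coproduct_Rel q x) auto
      moreover have "{a + 1..<a + b - 1} \<subseteq> blocks a (b - 1) (c + 1)"
        by (auto simp: blocks_def)
      ultimately show ?thesis
        using Rel_mono by blast
    next
      case k': False
      show ?thesis
        by (rule far) (use k k' abc False in \<open>auto simp: blocks_def\<close>)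
    qed
    then show ?thesis
      by (rule pack_in_rels) (use abc False in simp)
  qed (simp add: pack_simps pm.subspace_0[OF subspace_rels_B])
qed

lemma B_delta_in_rels:
  fixes q :: "'k::field"
  assumes q: "q \<noteq> 0" and x: "x \<in> relsB q d n"
  shows "B_delta q x \<in> relsB q d n"
proof (rule rels_B_in_subspace[OF lin_B_delta' subspace_rels_B _ x])
  fix a b c r assume abc: "a + b + c = d" and r: "r \<in> Rel q n d (blocks a b c)"
  have "lin (\<lambda>r. B_delta q (pack a b c r))"
    by (intro lin_intros)
  then show "B_delta q (pack a b c r) \<in> relsB q d n"
  proof (rule lin_Rel_in_subspace[OF _ subspace_rels_B _ r])
    fix k and x :: "'k tensor" assume k: "k \<in> blocks a b c" and x: "x \<in> tpow n d"
    then have "T q k x - q *\<^sub>v x \<in> tlen (a + b + c)"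
      using tpow_tlen[OF x] T_in_tlen[of k d x q] blocks_subset[OF abc] abc
      by (auto intro!: pm.subspace_diff pm.subspace_scale subspace_free)
    then show "B_delta q (pack a b c (T q k x - q *\<^sub>v x)) \<in> relsB q d n"
      using pack_Rel_coproduct[OF q abc k x]
      by (simp only: B_delta_pack) (intro pm.subspace_add pm.subspace_scale subspace_rels_B)
  qed
qed

lemma nat_trans_B_delta:
  fixes q :: "'k::field"
  assumes q: "q \<noteq> 0"
  shows "nat_trans q (B q d) (B q d) (\<lambda>n. B_delta q)"
proof -
  have "is_map (obj (B q d) n) (obj (B q d) n) (B_delta q)" for n
    using lin_B_delta' B_delta_in_elems B_delta_in_rels[OF q] by (auto simp: is_map_def)
  moreover have "B_delta q (mor (B q d) n m \<phi> x) = mor (B q d) n m \<phi> (B_delta q x)"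
    if \<phi>: "\<phi> \<in> hom q d n m" and x: "x \<in> elemsB q d n" for \<phi> x n m
  proof (rule elems_B_eqI[OF lin_compose[OF lin_B_delta' lin_mor_B] lin_compose[OF lin_mor_B lin_B_delta'] _ x])
    fix a b c w assume abc: "a + b + c = d" and w: "w \<in> words n d"
    define X :: "'k tensor" where "X = bas w"
    have X: "X \<in> tpow n d" "X \<in> tlen d" "X \<in> tlen (a + b + c)"
      using w abc by (auto simp: X_def words_def)
    have "\<phi> X \<in> tlen (a + b + c)"
      using tpow_tlen[OF hom_in_tpow[OF \<phi>]] abc by simp
    then have "B_delta q (mor (B q d) n m \<phi> (pack a b c X))
      = pack (a - 1) (b + 1) c (\<phi> (coproduct q 0 a X)) + q ^ (2 * b) *\<^sub>v pack a (b - 1) (c + 1) (\<phi> (coproduct q a b X))"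
      using coproduct_hom[OF \<phi> _ X(1), of 0 a] coproduct_hom[OF \<phi> _ X(1), of a b] abc
      by (simp add: mor_B_pack[OF \<phi> abc X(2)] B_delta_pack)
    also have "pack (a - 1) (b + 1) c (\<phi> (coproduct q 0 a X))
        = mor (B q d) n m \<phi> (pack (a - 1) (b + 1) c (coproduct q 0 a X))"
    proof (cases "a = 0")
      case False
      then show ?thesis
        using abc coproduct_in_tlen[OF _ X(2), of 0 a] by (simp add: mor_B_pack[OF \<phi>])
    qed (simp add: pack_simps lin_zero[OF hom_lin[OF \<phi>]] lin_zero[OF lin_mor_B])
    also have "pack a (b - 1) (c + 1) (\<phi> (coproduct q a b X))
        = mor (B q d) n m \<phi> (pack a (b - 1) (c + 1) (coproduct q a b X))"
    proof (cases "b = 0")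
      case False
      then show ?thesis
        using abc coproduct_in_tlen[OF _ X(2), of a b] by (simp add: mor_B_pack[OF \<phi>])
    qed (simp add: pack_simps lin_zero[OF hom_lin[OF \<phi>]] lin_zero[OF lin_mor_B])
    finally show "B_delta q (mor (B q d) n m \<phi> (pack a b c (bas w))) = mor (B q d) n m \<phi> (B_delta q (pack a b c (bas w)))"
      using B_delta_pack[OF X(3), of q] by (simp add: X_def lin_simps[OF lin_mor_B])
  qed
  ultimately show ?thesis
    using eqv_refl[OF subspace_rels_B] by (simp add: nat_trans_def deg_B) blast
qed

lemma B_delta_grading:
  assumes q: "q \<noteq> 0" and x: "x \<in> B_grading q d i n"
  shows "B_delta q x \<in> B_grading q d (i + 1) n"
proof (rule grading_in_subspace[OF lin_B_delta' subspace_grading _ _ x])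
  show "B_delta q r \<in> B_grading q d (i + 1) n" if "r \<in> relsB q d n" for r
    by (rule subsetD[OF rels_subset_grading B_delta_in_rels[OF q that]])
  fix a b c w assume abc: "a + b + c = d" "b + 2 * c = i" and w: "w \<in> words n d"
  have w1: "bas w \<in> tpow n d" and w2: "bas w \<in> tlen (a + b + c)"
    using w abc by (auto simp: words_def)
  have 1: "pack (a - 1) (b + 1) c (coproduct q 0 a (bas w)) \<in> B_grading q d (i + 1) n"
  proof (cases "a = 0")
    case False
    then show ?thesis
      using abc by (intro pack_in_grading coproduct_in_tpow w1) auto
  qed (simp add: pack_simps pm.subspace_0[OF subspace_grading])
  have 2: "pack a (b - 1) (c + 1) (coproduct q a b (bas w)) \<in> B_grading q d (i + 1) n"
  proof (cases "b = 0")
    case False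
    then show ?thesis
      using abc by (intro pack_in_grading coproduct_in_tpow w1) auto
  qed (simp add: pack_simps pm.subspace_0[OF subspace_grading])
  show "B_delta q (pack a b c (bas w)) \<in> B_grading q d (i + 1) n"
    unfolding B_delta_pack[OF w2] by (intro pm.subspace_add pm.subspace_scale subspace_grading 1 2)
qed


section \<open>The Leibniz rule\<close>

text \<open>A braid that moves \<open>d\<close> strands in parallel from behind \<open>p'\<close> to behind \<open>p\<close> commutes with taking the
  coproduct of these strands.\<close>

lemma coproduct_intertwine:
  assumes q: "q \<noteq> 0" and js: "set js \<subseteq> {1..<l}" and l: "p + d \<le> l" "p' + d \<le> l" and x: "x \<in> tlen l"
    and strands: "\<And>k. p' < k \<Longrightarrow> k < p' + d \<Longrightarrow>
      braid_of [k] * braid_of js = braid_of js * braid_of [k - p' + p]"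
  shows "coproduct q p d (act q js x) = act q js (coproduct q p' d x)"
proof -
  have "act q [p + i..<p + d] (act q js x) = act q js (act q [p' + i..<p' + d] x)" if i: "i \<in> {1..d}" for i
  proof -
    have "map (\<lambda>k. k - p' + p) [p' + i..<p' + d] = [p + i..<p + d]"
      by (rule nth_equalityI) auto
    then have "braid_of [p' + i..<p' + d] * braid_of js = braid_of js * braid_of [p + i..<p + d]"
      using braid_of_intertwine[of "[p' + i..<p' + d]" "braid_of js" "\<lambda>k. k - p' + p"] strands i by auto
    then have "act q ([p' + i..<p' + d] @ js) x = act q (js @ [p + i..<p + d]) x"
      by (intro act_braid_eq[where d = l] q x) (use i js l in \<open>auto simp: braid_of_append\<close>)
    then show ?thesis
      by (simp add: act_append)
  qed
  then show ?thesis
    unfolding coproduct_def act_simps by (intro sum.cong) auto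
qed

context
  fixes q :: "'k::field" and a b c e f g d d' n :: nat and x y z :: "'k tensor"
  assumes q: "q \<noteq> 0" and abc: "a + b + c = d" and efg: "e + f + g = d'"
    and x: "x \<in> tpow n d" and y: "y \<in> tpow n d'"
  defines "z \<equiv> act q (shuf a b c e f) (x \<bullet> y)"
begin

lemma concat_in_range: "x \<bullet> y \<in> tpow n (d + d')" "x \<bullet> y \<in> tlen (d + d')"
  using dot_in_tpow[OF x y] tpow_tlen by blast+

lemma shuf_in_range: "set (shuf a b c e f) \<subseteq> {1..<d + d'}"
  by (rule set_shuf_subset[OF abc efg])

text \<open>A letter of the first block of \<open>x\<close>, moved to the second block, has to cross the first block of \<open>y\<close>,
  whether it is split off before or after the product is formed: the two braids agree.\<close>

lemma leibniz_1_left: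
  "B_mu q (pack (a - 1) (b + 1) c (coproduct q 0 a x) \<otimes> pack e f g y)
   = q ^ ((b + c) * e + e) *\<^sub>v pack (a + e - 1) (b + f + 1) (c + g) (act q [a..<a + e] (coproduct q 0 a z))"
proof (cases a)
  case (Suc a')
  have D: "coproduct q 0 a x \<in> tlen d"
    by (rule coproduct_in_tlen[OF _ tpow_tlen[OF x]]) (use abc in simp)
  have "coproduct q 0 a z = act q (shuf a b c e f) (coproduct q 0 a (x \<bullet> y))"
    unfolding z_def by (rule coproduct_intertwine[OF q shuf_in_range _ _ concat_in_range(2)])
      (use abc shuf_left_1 in auto)
  also have "coproduct q 0 a (x \<bullet> y) = coproduct q 0 a x \<bullet> y"
    by (rule coproduct_dot_left[OF _ tpow_tlen[OF x]]) (use abc in simp)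
  finally have "act q [a..<a + e] (coproduct q 0 a z)
      = act q (shuf a b c e f @ [a..<a + e]) (coproduct q 0 a x \<bullet> y)"
    by (simp add: act_append)
  also have "\<dots> = act q (shuf a' (b + 1) c e f) (coproduct q 0 a x \<bullet> y)"
    by (rule act_braid_eq[OF _ q _ dot_in_tlen[OF D tpow_tlen[OF y]]])
      (use shuf_in_range shuf_shift_12_left[of a' b c e f] abc efg in \<open>auto simp: braid_of_append Suc\<close>)
  finally have "act q [a..<a + e] (coproduct q 0 a z) = act q (shuf a' (b + 1) c e f) (coproduct q 0 a x \<bullet> y)" .
  moreover have "B_mu q (pack a' (b + 1) c (coproduct q 0 a x) \<otimes> pack e f g y)
      = q ^ ((b + 1 + c) * e) *\<^sub>v pack (a' + e) (b + 1 + f) (c + g)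
          (act q (shuf a' (b + 1) c e f) (coproduct q 0 a x \<bullet> y))"
    by (rule B_mu_pack) (use D tpow_tlen[OF y] abc efg Suc in auto)
  ultimately show ?thesis
    using Suc by (simp add: algebra_simps)
qed (simp add: pack_simps lin_simps[OF lin_B_mu'] act_simps)

text \<open>The same for a letter of the second block of \<open>x\<close>, which crosses the second block of \<open>y\<close>.\<close>

lemma leibniz_2_left:
  "B_mu q (pack a (b - 1) (c + 1) (coproduct q a b x) \<otimes> pack e f g y)
   = q ^ ((b + c) * e) *\<^sub>v pack (a + e) (b + f - 1) (c + g + 1)
       (act q [a + e + b..<a + e + b + f] (coproduct q (a + e) b z))"
proof (cases b)
  case (Suc b')
  have D: "coproduct q a b x \<in> tlen d"
    by (rule coproduct_in_tlen[OF _ tpow_tlen[OF x]]) (use abc in simp)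
  have "coproduct q (a + e) b z = act q (shuf a b c e f) (coproduct q a b (x \<bullet> y))"
    unfolding z_def by (rule coproduct_intertwine[OF q shuf_in_range _ _ concat_in_range(2)])
      (use abc efg shuf_left_2 in \<open>auto simp: add_ac\<close>)
  also have "coproduct q a b (x \<bullet> y) = coproduct q a b x \<bullet> y"
    by (rule coproduct_dot_left[OF _ tpow_tlen[OF x]]) (use abc in simp)
  finally have "act q [a + e + b..<a + e + b + f] (coproduct q (a + e) b z)
      = act q (shuf a b c e f @ [a + e + b..<a + e + b + f]) (coproduct q a b x \<bullet> y)"
    by (simp add: act_append)
  also have "\<dots> = act q (shuf a b' (c + 1) e f) (coproduct q a b x \<bullet> y)"
    by (rule act_braid_eq[OF _ q _ dot_in_tlen[OF D tpow_tlen[OF y]]])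
      (use shuf_in_range shuf_shift_23_left[of a b' c e f] abc efg in \<open>auto simp: braid_of_append Suc\<close>)
  finally have "act q [a + e + b..<a + e + b + f] (coproduct q (a + e) b z)
      = act q (shuf a b' (c + 1) e f) (coproduct q a b x \<bullet> y)" .
  moreover have "B_mu q (pack a b' (c + 1) (coproduct q a b x) \<otimes> pack e f g y)
      = q ^ ((b' + (c + 1)) * e) *\<^sub>v pack (a + e) (b' + f) (c + 1 + g)
          (act q (shuf a b' (c + 1) e f) (coproduct q a b x \<bullet> y))"
    by (rule B_mu_pack) (use D tpow_tlen[OF y] abc efg Suc in auto)
  ultimately show ?thesis
    using Suc by (simp add: algebra_simps)
qed (simp add: pack_simps lin_simps[OF lin_B_mu'] act_simps)

text \<open>If the last part \<open>r\<close> of a braid acts inside the blocks of the target, it contributes only a power of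
  \<open>q\<close>.\<close>

lemma tail_mod_rels:
  assumes total: "A + B' + C = d + d'" and h: "set h \<subseteq> {1..<d + d'}" and r: "set r \<subseteq> blocks A B' C"
    and w: "w \<in> tpow n (d + d')" and coeff: "s * s' = t * q ^ length r"
  shows "s *\<^sub>v s' *\<^sub>v pack A B' C (act q h w) - t *\<^sub>v pack A B' C (act q r (act q h w))
    \<in> relsB q (d + d') n"
proof -
  have "act q r (act q h w) - q ^ length r *\<^sub>v act q h w \<in> Rel q n (d + d') (blocks A B' C)"
    by (rule act_mod_Rel[OF r blocks_subset[OF total] act_in_tpow[OF h w]])
  then have "(- t) *\<^sub>v pack A B' C (act q r (act q h w) - q ^ length r *\<^sub>v act q h w)
      \<in> relsB q (d + d') n"
    by (intro pm.subspace_scale[OF subspace_rels_B] pack_in_rels total)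
  then show ?thesis
    by (simp add: pack_simps pm.scale_right_diff_distrib coeff)
qed

text \<open>A letter of the first block of \<open>y\<close> crosses the second block of \<open>x\<close> if it is split off after the
  product, but not if it is split off before. It ends up in the same block as the letters it has
  crossed, so the crossing amounts to the scalar \<open>q ^ b\<close>.\<close>

lemma leibniz_1_right:
  assumes q3: "q ^ 3 = 1"
  shows "q ^ (2 * (b + 2 * c)) *\<^sub>v B_mu q (pack a b c x \<otimes> pack (e - 1) (f + 1) g (coproduct q 0 e y))
    - q ^ ((b + c) * e) *\<^sub>v pack (a + e - 1) (b + f + 1) (c + g) (coproduct q a e z)
    \<in> relsB q (d + d') n"
proof (cases e)
  case (Suc e')
  define r where "r = cross (a + e') b 1"
  define w where "w = x \<bullet> coproduct q 0 e y"
  let ?h = "shuf a b c e' (f + 1)"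
  have D: "coproduct q 0 e y \<in> tpow n d'"
    by (rule coproduct_in_tpow[OF _ y]) (use efg in simp)
  have w: "w \<in> tpow n (d + d')"
    unfolding w_def by (rule dot_in_tpow[OF x D])
  have "coproduct q a e z = act q (shuf a b c e f) (coproduct q d e (x \<bullet> y))"
    unfolding z_def by (rule coproduct_intertwine[OF q shuf_in_range _ _ concat_in_range(2)])
      (use abc efg shuf_right_1[of a b c _ e f] in \<open>auto simp: algebra_simps\<close>)
  also have "coproduct q d e (x \<bullet> y) = w"
    using coproduct_dot_right[of 0 e d' x d y q] efg tpow_tlen[OF x] tpow_tlen[OF y] by (simp add: w_def)
  also have "act q (shuf a b c e f) w = act q (?h @ r) w"
    using shuf_shift_12_right[of a b c e' f] shuf_in_range
    by (intro act_braid_eq[OF _ q _ tpow_tlen[OF w]]) (auto simp: braid_of_append Suc r_def)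
  finally have z': "coproduct q a e z = act q r (act q ?h w)"
    by (simp add: act_append)
  \<comment> \<open>The exponents differ by \<open>3 c\<close>: here \<open>q\<close> has to be a third root of unity.\<close>
  have coeff: "q ^ (2 * (b + 2 * c)) * q ^ ((b + c) * e') = q ^ ((b + c) * e) * q ^ length r"
  proof -
    have "q ^ (2 * (b + 2 * c)) * q ^ ((b + c) * e') = q ^ ((b + c) * e + b + 3 * c)"
      unfolding power_add[symmetric] by (rule arg_cong[where f = "\<lambda>i. q ^ i"]) (simp add: Suc algebra_simps)
    also have "\<dots> = q ^ ((b + c) * e) * q ^ b * (q ^ 3) ^ c"
      by (simp only: power_add power_mult)
    finally show ?thesis
      by (simp add: q3 r_def del: upt_Suc)
  qed
  have mu: "B_mu q (pack a b c x \<otimes> pack e' (f + 1) g (coproduct q 0 e y))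
      = q ^ ((b + c) * e') *\<^sub>v pack (a + e') (b + (f + 1)) (c + g) (act q ?h w)"
    unfolding w_def by (rule B_mu_pack) (use tpow_tlen[OF x] tpow_tlen[OF D] abc efg Suc in auto)
  have sets: "set ?h \<subseteq> {1..<d + d'}" "set r \<subseteq> blocks (a + e') (b + (f + 1)) (c + g)"
    using abc efg Suc unfolding r_def
    by (auto dest!: set_shuf set_cross simp: blocks_def simp del: cross.simps)
  have pred: "e - 1 = e'" "a + e - 1 = a + e'" "b + f + 1 = b + (f + 1)"
    using Suc by simp_all
  show ?thesis
    unfolding z' pred mu by (rule tail_mod_rels[OF _ sets w coeff]) (use abc efg Suc in simp)
qed (simp add: pack_simps lin_simps[OF lin_B_mu'] pm.subspace_0[OF subspace_rels_B])

text \<open>The same for a letter of the second block of \<open>y\<close> and the third block of \<open>x\<close>.\<close>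

lemma leibniz_2_right:
  assumes q3: "q ^ 3 = 1"
  shows "q ^ (2 * (b + 2 * c) + 2 * f) *\<^sub>v B_mu q (pack a b c x \<otimes> pack e (f - 1) (g + 1) (coproduct q e f y))
    - q ^ ((b + c) * e + 2 * (b + f)) *\<^sub>v pack (a + e) (b + f - 1) (c + g + 1) (coproduct q (a + e + b) f z)
    \<in> relsB q (d + d') n"
proof (cases f)
  case (Suc f')
  define r where "r = cross (a + e + b + f') c 1"
  define w where "w = x \<bullet> coproduct q e f y"
  let ?h = "shuf a b c e f'"
  have D: "coproduct q e f y \<in> tpow n d'"
    by (rule coproduct_in_tpow[OF _ y]) (use efg in simp)
  have w: "w \<in> tpow n (d + d')"
    unfolding w_def by (rule dot_in_tpow[OF x D])
  have "coproduct q (a + e + b) f z = act q (shuf a b c e f) (coproduct q (d + e) f (x \<bullet> y))"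
    unfolding z_def by (rule coproduct_intertwine[OF q shuf_in_range _ _ concat_in_range(2)])
      (use abc efg shuf_right_2[of a b c e _ f] in \<open>auto simp: algebra_simps\<close>)
  also have "coproduct q (d + e) f (x \<bullet> y) = w"
    using coproduct_dot_right[of e f d' x d y q] efg tpow_tlen[OF x] tpow_tlen[OF y] by (simp add: w_def)
  also have "act q (shuf a b c e f) w = act q (?h @ r) w"
    using shuf_shift_23_right[of a b c e f'] shuf_in_range
    by (intro act_braid_eq[OF _ q _ tpow_tlen[OF w]]) (auto simp: braid_of_append Suc r_def)
  finally have z': "coproduct q (a + e + b) f z = act q r (act q ?h w)"
    by (simp add: act_append)
  \<comment> \<open>Again the exponents differ by \<open>3 c\<close>.\<close>
  have coeff: "q ^ (2 * (b + 2 * c) + 2 * f) * q ^ ((b + c) * e) = q ^ ((b + c) * e + 2 * (b + f)) * q ^ length r"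
  proof -
    have "q ^ (2 * (b + 2 * c) + 2 * f) * q ^ ((b + c) * e) = q ^ ((b + c) * e + 2 * (b + f) + c + 3 * c)"
      unfolding power_add[symmetric] by (rule arg_cong[where f = "\<lambda>i. q ^ i"]) (simp add: algebra_simps)
    also have "\<dots> = q ^ ((b + c) * e + 2 * (b + f)) * q ^ c * (q ^ 3) ^ c"
      by (simp only: power_add power_mult)
    finally show ?thesis
      by (simp add: q3 r_def del: upt_Suc)
  qed
  have mu: "B_mu q (pack a b c x \<otimes> pack e f' (g + 1) (coproduct q e f y))
      = q ^ ((b + c) * e) *\<^sub>v pack (a + e) (b + f') (c + (g + 1)) (act q ?h w)"
    unfolding w_def by (rule B_mu_pack) (use tpow_tlen[OF x] tpow_tlen[OF D] abc efg Suc in auto)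
  have sets: "set ?h \<subseteq> {1..<d + d'}" "set r \<subseteq> blocks (a + e) (b + f') (c + (g + 1))"
    using abc efg Suc unfolding r_def
    by (auto dest!: set_shuf set_cross simp: blocks_def simp del: cross.simps)
  have pred: "f - 1 = f'" "b + f - 1 = b + f'" "c + g + 1 = c + (g + 1)"
    using Suc by simp_all
  show ?thesis
    unfolding z' pred mu by (rule tail_mod_rels[OF _ sets w coeff]) (use abc efg Suc in simp)
qed (simp add: pack_simps lin_simps[OF lin_B_mu'] pm.subspace_0[OF subspace_rels_B])

lemma leibniz_pack:
  assumes q3: "q ^ 3 = 1"
  shows "B_mu q (B_delta q (pack a b c x) \<otimes> pack e f g y
      + q ^ (2 * (b + 2 * c)) *\<^sub>v (pack a b c x \<otimes> B_delta q (pack e f g y)))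
    - B_delta q (B_mu q (pack a b c x \<otimes> pack e f g y)) \<in> relsB q (d + d') n"
proof -
  let ?M = "\<lambda>X Y. B_mu q (X \<otimes> Y)" and ?x = "pack a b c x" and ?y = "pack e f g y"
  let ?P1 = "pack (a + e - 1) (b + f + 1) (c + g)" and ?P2 = "pack (a + e) (b + f - 1) (c + g + 1)"
  let ?c = "q ^ ((b + c) * e)" and ?s = "q ^ (2 * (b + 2 * c))"
  let ?x1 = "pack (a - 1) (b + 1) c (coproduct q 0 a x)" and ?x2 = "pack a (b - 1) (c + 1) (coproduct q a b x)"
  let ?y1 = "pack (e - 1) (f + 1) g (coproduct q 0 e y)" and ?y2 = "pack e (f - 1) (g + 1) (coproduct q e f y)"
  have xl: "x \<in> tlen (a + b + c)" and yl: "y \<in> tlen (e + f + g)"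
    using tpow_tlen[OF x] tpow_tlen[OF y] abc efg by simp_all
  have "z \<in> tlen (d + d')"
    unfolding z_def by (rule act_in_tlen[OF shuf_in_range concat_in_range(2)])
  moreover have "(a + e) + (b + f) + (c + g) = d + d'"
    using abc efg by simp
  ultimately have zl: "z \<in> tlen ((a + e) + (b + f) + (c + g))"
    by (simp only:)
  have left: "?M (B_delta q ?x) ?y = ?M ?x1 ?y + q ^ (2 * b) *\<^sub>v ?M ?x2 ?y"
    by (simp add: B_delta_pack[OF xl] lin_simps[OF lin_B_mu'] lin_simps[OF lin_tens_left[OF lin_ident]])
  have right: "?M ?x (B_delta q ?y) = ?M ?x ?y1 + q ^ (2 * f) *\<^sub>v ?M ?x ?y2"
    by (simp add: B_delta_pack[OF yl] lin_simps[OF lin_B_mu'] lin_simps[OF lin_tens_right[OF lin_ident]])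
  have "?M ?x ?y = ?c *\<^sub>v pack (a + e) (b + f) (c + g) z"
    unfolding z_def by (rule B_mu_pack[OF xl yl])
  then have "B_delta q (?M ?x ?y) = ?c *\<^sub>v (?P1 (coproduct q 0 (a + e) z)
      + q ^ (2 * (b + f)) *\<^sub>v ?P2 (coproduct q (a + e) (b + f) z))"
    by (simp add: lin_simps[OF lin_B_delta'] B_delta_pack[OF zl])
  also have "coproduct q 0 (a + e) z = q ^ e *\<^sub>v act q [a..<a + e] (coproduct q 0 a z) + coproduct q a e z"
    using coproduct_add[of q 0 a e z] by simp
  also have "coproduct q (a + e) (b + f) z
      = q ^ f *\<^sub>v act q [a + e + b..<a + e + b + f] (coproduct q (a + e) b z) + coproduct q (a + e + b) f z"
    by (rule coproduct_add)
  finally have expanded: "B_delta q (?M ?x ?y) = ?c *\<^sub>v (?P1 (q ^ e *\<^sub>v act q [a..<a + e] (coproduct q 0 a z) + coproduct q a e z)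
      + q ^ (2 * (b + f)) *\<^sub>v ?P2 (q ^ f *\<^sub>v act q [a + e + b..<a + e + b + f] (coproduct q (a + e) b z)
          + coproduct q (a + e + b) f z))" .
  have total: "B_delta q (?M ?x ?y) = ?M ?x1 ?y + ?c *\<^sub>v ?P1 (coproduct q a e z)
      + (q ^ (2 * b) *\<^sub>v ?M ?x2 ?y + q ^ ((b + c) * e + 2 * (b + f)) *\<^sub>v ?P2 (coproduct q (a + e + b) f z))"
  proof -
    \<comment> \<open>The coproduct contributes \<open>q ^ f\<close>, and the exponents of \<open>q ^ 2\<close> differ by \<open>f\<close>.\<close>
    have "q ^ (2 * (b + f)) * q ^ f = q ^ (2 * b + 3 * f)"
      unfolding power_add[symmetric] by (rule arg_cong[where f = "\<lambda>i. q ^ i"]) simp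
    also have "\<dots> = q ^ (2 * b)"
      by (simp add: power_add power_mult q3)
    finally have "?c * (q ^ (2 * (b + f)) * q ^ f) = q ^ (2 * b) * ?c"
      by (simp add: mult.commute)
    then show ?thesis
      unfolding expanded leibniz_1_left leibniz_2_left
      by (simp add: pack_simps pm.scale_right_distrib power_add mult.assoc)
  qed
  have "B_mu q (B_delta q ?x \<otimes> ?y + ?s *\<^sub>v (?x \<otimes> B_delta q ?y)) - B_delta q (?M ?x ?y)
    = (?s *\<^sub>v ?M ?x ?y1 - ?c *\<^sub>v ?P1 (coproduct q a e z))
      + (q ^ (2 * (b + 2 * c) + 2 * f) *\<^sub>v ?M ?x ?y2
          - q ^ ((b + c) * e + 2 * (b + f)) *\<^sub>v ?P2 (coproduct q (a + e + b) f z))"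
    unfolding total by (simp add: lin_simps[OF lin_B_mu'] left right pm.scale_right_distrib power_add algebra_simps)
  also have "\<dots> \<in> relsB q (d + d') n"
    by (intro pm.subspace_add subspace_rels_B leibniz_1_right[OF q3] leibniz_2_right[OF q3])
  finally show ?thesis .
qed

end

lemma B_tens_delta_bas:
  "B_tens_delta q (bas i \<otimes> bas j) = B_delta q (bas i) \<otimes> bas j
    + q ^ (2 * B_deg (fst i)) *\<^sub>v (bas i \<otimes> B_delta q (bas j))"
  by (simp add: B_tens_delta_def case_prod_unfold)

lemma B_mu_B_tens_delta:
  fixes q :: "'k::field"
  assumes "q \<noteq> 0" "q ^ 3 = 1" and z: "z \<in> elems (tens_space (obj (B q d) n) (obj (B q d') n))"
  shows "eqv (obj (B q (d + d')) n) (B_mu q (B_tens_delta q z)) (B_delta q (B_mu q z))"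
  unfolding eqv_def
proof (rule lin_free_in_subspace[where f = "\<lambda>z. B_mu q (B_tens_delta q z) - B_delta q (B_mu q z)",
      OF _ subspace_rels_B _ z])
  show "lin (\<lambda>z. B_mu q (B_tens_delta q z) - B_delta q (B_mu q z))"
    unfolding B_tens_delta_def by (intro lin_intros)
  fix k assume "k \<in> gens (tens_space (obj (B q d) n) (obj (B q d') n))"
  then obtain i j where k: "k = (i, j)" and ij: "i \<in> gens (obj (B q d) n)" "j \<in> gens (obj (B q d') n)"
    by (auto simp: tens_space_def)
  from ij(1) obtain a b c u v w where i: "i = ((a, b, c), (u, v, w))" "a + b + c = d"
    "u \<in> words n a" "v \<in> words n b" "w \<in> words n c"
    unfolding gens_B by blast
  from ij(2) obtain e f g u' v' w' where j: "j = ((e, f, g), (u', v', w'))" "e + f + g = d'"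
    "u' \<in> words n e" "v' \<in> words n f" "w' \<in> words n g"
    unfolding gens_B by blast
  have "(bas i :: Bidx \<Rightarrow>\<^sub>0 'k) = pack a b c (bas (u @ v @ w))" "bas (u @ v @ w) \<in> tpow n d"
    using i by (auto simp: pack_bas words_def)
  moreover have "(bas j :: Bidx \<Rightarrow>\<^sub>0 'k) = pack e f g (bas (u' @ v' @ w'))" "bas (u' @ v' @ w') \<in> tpow n d'"
    using j by (auto simp: pack_bas words_def)
  moreover have "B_deg (fst i) = b + 2 * c"
    using i by (simp add: B_deg_def)
  ultimately show "B_mu q (B_tens_delta q (bas k)) - B_delta q (B_mu q (bas k)) \<in> relsB q (d + d') n"
    unfolding k tens_bas[symmetric] B_tens_delta_bas
    using leibniz_pack[OF assms(1) i(2) j(2) _ _ assms(2)] by simp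
qed

lemma leibniz_graded:
  fixes q :: "'k::field"
  assumes q: "q \<noteq> 0" "q ^ 3 = 1" and x: "x \<in> B_grading q d i n" and y: "y \<in> B_grading q d' j n"
  shows "eqv (obj (B q (d + d')) n)
    (B_mu q (B_delta q x \<otimes> y + q ^ (2 * i) *\<^sub>v (x \<otimes> B_delta q y))) (B_delta q (B_mu q (x \<otimes> y)))"
  unfolding eqv_def
proof (rule grading_in_subspace[where f = "\<lambda>x. B_mu q (B_delta q x \<otimes> y + q ^ (2 * i) *\<^sub>v (x \<otimes> B_delta q y))
      - B_delta q (B_mu q (x \<otimes> y))", OF _ subspace_rels_B _ _ x])
  have y': "y \<in> elemsB q d' n"
    by (rule subsetD[OF grading_subset_elems y])
  show "B_mu q (B_delta q r \<otimes> y + q ^ (2 * i) *\<^sub>v (r \<otimes> B_delta q y)) - B_delta q (B_mu q (r \<otimes> y))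
      \<in> relsB q (d + d') n" if r: "r \<in> relsB q d n" for r
    unfolding lin_add[OF lin_B_mu'] lin_scale[OF lin_B_mu']
    by (intro pm.subspace_diff pm.subspace_add pm.subspace_scale subspace_rels_B B_mu_rels_left[OF q(1)]
        B_delta_in_rels[OF q(1)] B_delta_in_elems r y')
  fix a b c w assume abc: "a + b + c = d" "b + 2 * c = i" and w: "w \<in> words n d"
  let ?x = "pack a b c (bas w) :: Bidx \<Rightarrow>\<^sub>0 'k"
  show "B_mu q (B_delta q ?x \<otimes> y + q ^ (2 * i) *\<^sub>v (?x \<otimes> B_delta q y)) - B_delta q (B_mu q (?x \<otimes> y))
      \<in> relsB q (d + d') n"
  proof (rule elems_B_in_subspace[where f = "\<lambda>y. B_mu q (B_delta q ?x \<otimes> y + q ^ (2 * i) *\<^sub>v (?x \<otimes> B_delta q y))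
      - B_delta q (B_mu q (?x \<otimes> y))", OF _ subspace_rels_B _ y'])
    fix e f g w' assume efg: "e + f + g = d'" and w': "w' \<in> words n d'"
    show "B_mu q (B_delta q ?x \<otimes> pack e f g (bas w') + q ^ (2 * i) *\<^sub>v (?x \<otimes> B_delta q (pack e f g (bas w'))))
        - B_delta q (B_mu q (?x \<otimes> pack e f g (bas w'))) \<in> relsB q (d + d') n"
      using leibniz_pack[OF q(1) abc(1) efg _ _ q(2), of "bas w" n "bas w'"] w w' abc(2) by simp
  qed (intro lin_intros)
qed (intro lin_intros)

lemma graded_differential_algebra_B:
  assumes "q \<noteq> 0" "q ^ 3 = 1"
  shows "graded_differential_algebra q (B q) (\<lambda>d1 d2 n. B_mu q) (\<lambda>n. B_unit) (B_grading q) (\<lambda>d n. B_delta q)"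
  unfolding graded_differential_algebra_def
  using graded_algebra_B[OF assms(1)] nat_trans_B_delta[OF assms(1)] B_delta_grading[OF assms(1)]
    leibniz_graded[OF assms] by blast


section \<open>Surjectivity of the product\<close>

text \<open>By the quadratic relation, \<open>T - (q - inverse q)\<close> is inverse to \<open>T\<close>.\<close>

lemma act_surj:
  assumes q: "q \<noteq> 0" and "set is \<subseteq> {1..<d}" "z \<in> tpow n d"
  shows "\<exists>x\<in>tpow n d. act q is x = z"
  using assms(2,3)
proof (induction "is")
  case (Cons i "is")
  then obtain y where y: "y \<in> tpow n d" "act q is y = z"
    by auto
  have i: "i \<in> {1..<d}"
    using Cons.prems by simp
  define x where "x = T q i y - (q - inverse q) *\<^sub>v y"
  have "x \<in> tpow n d"
    unfolding x_def by (intro pm.subspace_diff pm.subspace_scale subspace_free T_in_tpow i y)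
  moreover have "T q i x = y"
    unfolding x_def by (simp add: T_simps T_quadratic[OF q i tpow_tlen[OF y(1)]])
  ultimately show ?case
    using y(2) by (auto simp: act_Cons)
qed auto

text \<open>The first triple is filled greedily from the left.\<close>

lemma split_bound:
  fixes A B' C d d' :: nat
  assumes "A + B' + C = d + d'"
  obtains a b c e f g where "A = a + e" "B' = b + f" "C = c + g" "a + b + c = d" "e + f + g = d'"
proof -
  define a where "a = min A d"
  define b where "b = min B' (d - a)"
  define c where "c = d - a - b"
  have "a \<le> A" "b \<le> B'" "c \<le> C" "a + b + c = d"
    using assms by (auto simp: a_def b_def c_def)
  then show thesis
    using that[of a "A - a" b "B' - b" c "C - c"] assms by auto
qed

lemma surj_B_mu:
  fixes q :: "'k::field"
  assumes q: "q \<noteq> 0"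
  shows "surj_map (tens_space (obj (B q d) n) (obj (B q d') n)) (obj (B q (d + d')) n) (B_mu q)"
proof -
  let ?X = "tens_space (obj (B q d) n) (obj (B q d') n)"
  have "y \<in> B_mu q ` elems ?X" if y: "y \<in> elemsB q (d + d') n" for y
  proof (rule elems_B_in_subspace[where f = "\<lambda>y. y", OF lin_ident _ _ y])
    show "pm.subspace (B_mu q ` elems ?X)"
      by (rule lin_image_subspace[OF lin_B_mu' subspace_free])
    fix A B' C w assume sum: "A + B' + C = d + d'" and w: "w \<in> words n (d + d')"
    obtain a b c e f g where ABC: "A = a + e" "B' = b + f" "C = c + g"
      and abc: "a + b + c = d" and efg: "e + f + g = d'"
      by (rule split_bound[OF sum])
    \<comment> \<open>A section of concatenation: words are cut after \<open>d\<close> letters.\<close>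
    define s :: "'k tensor \<Rightarrow> _"
      where "s = lext (\<lambda>w. pack a b c (bas (take d w)) \<otimes> pack e f g (bas (drop d w)))"
    have lin_s: "lin s"
      unfolding s_def by (rule lin_lext)
    have s_elems: "s x \<in> elems ?X" if "x \<in> tpow n (d + d')" for x
    proof (rule lin_free_in_subspace[OF lin_s subspace_free _ that])
      fix w assume "w \<in> words n (d + d')"
      then have "bas (take d w) \<in> tpow n d" "bas (drop d w) \<in> tpow n d'"
        by (auto simp: words_def dest: in_set_takeD in_set_dropD)
      then show "s (bas w) \<in> elems ?X"
        unfolding s_def lext_bas tens_space_def space.select_convs
        by (intro tens_in_free pack_in_elems abc efg)
    qed
    have mu_s: "B_mu q (s x) = q ^ ((b + c) * e) *\<^sub>v pack A B' C (act q (shuf a b c e f) x)"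
      if "x \<in> tpow n (d + d')" for x
    proof (rule lin_eq_on_free[where f = "\<lambda>x. B_mu q (s x)"
          and g = "\<lambda>x. q ^ ((b + c) * e) *\<^sub>v pack A B' C (act q (shuf a b c e f) x)", OF _ _ _ that])
      show "lin (\<lambda>x. B_mu q (s x))"
        by (rule lin_compose[OF lin_B_mu' lin_s])
      show "lin (\<lambda>x. q ^ ((b + c) * e) *\<^sub>v pack A B' C (act q (shuf a b c e f) x))"
        by (intro lin_intros)
      fix w assume "w \<in> words n (d + d')"
      then have "length w = d + d'"
        by (simp add: words_def)
      then have "B_mu q (pack a b c (bas (take d w)) \<otimes> pack e f g (bas (drop d w)))
          = q ^ ((b + c) * e) *\<^sub>v pack A B' C (act q (shuf a b c e f) (bas (take d w) \<bullet> bas (drop d w)))"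
        unfolding ABC by (intro B_mu_pack) (use abc efg in auto)
      then show "B_mu q (s (bas w)) = q ^ ((b + c) * e) *\<^sub>v pack A B' C (act q (shuf a b c e f) (bas w))"
        by (simp add: s_def)
    qed
    obtain x where x: "x \<in> tpow n (d + d')" "act q (shuf a b c e f) x = bas w"
      using act_surj[OF q set_shuf_subset[OF abc efg], of "bas w" n] w by auto
    let ?x = "inverse q ^ ((b + c) * e) *\<^sub>v x"
    have x': "?x \<in> tpow n (d + d')"
      by (rule pm.subspace_scale[OF subspace_free x(1)])
    have "B_mu q (s ?x) = pack A B' C (bas w)"
      using q unfolding mu_s[OF x'] by (simp add: act_simps x(2) pack_simps flip: power_mult_distrib)
    then show "pack A B' C (bas w) \<in> B_mu q ` elems ?X"
      using s_elems[OF x'] by (metis imageI)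
  qed
  then show ?thesis
    unfolding surj_map_def by (auto intro: eqv_refl[OF subspace_rels_B])
qed


section \<open>The exponential property\<close>

text \<open>No correction term occurs when letters are exchanged in increasing order.\<close>

lemma act_descending_run_sorted:
  assumes "\<And>k. k \<in> set y \<Longrightarrow> k < l"
  shows "act q (rev [length x + 1..<length x + length y + 1]) (bas (x @ y @ l # t)) = bas (x @ l # y @ t)"
  using assms
proof (induction y arbitrary: t rule: rev_induct)
  case (snoc k y)
  let ?p = "length x + length y"
  have "rev [length x + 1..<length x + length (y @ [k]) + 1] = (?p + 1) # rev [length x + 1..<?p + 1]"
    by simp
  moreover have "T q (?p + 1) (bas (x @ (y @ [k]) @ l # t)) = bas (x @ y @ l # k # t)"
    using snoc.prems T_bas[of q "x @ y" k l t] by simp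
  moreover have "act q (rev [length x + 1..<?p + 1]) (bas (x @ y @ l # k # t)) = bas (x @ l # y @ k # t)"
    by (rule snoc.IH) (use snoc.prems in auto)
  ultimately show ?case
    by (simp add: act_Cons del: upt_Suc)
qed simp

lemma act_cross_sorted:
  assumes "\<And>k l. k \<in> set y \<Longrightarrow> l \<in> set z \<Longrightarrow> k < l" "length x = p" "length y = d" "length z = e"
  shows "act q (cross p d e) (bas (x @ y @ z @ t)) = bas (x @ z @ y @ t)"
  using assms(1,4)
proof (induction z arbitrary: t e rule: rev_induct)
  case (snoc l z)
  have "act q (cross p d (length z)) (bas (x @ y @ z @ (l # t))) = bas (x @ z @ y @ (l # t))"
    by (rule snoc.IH) (use snoc.prems in auto)
  moreover have "act q (rev [length (x @ z) + 1..<length (x @ z) + length y + 1]) (bas ((x @ z) @ y @ l # t))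
      = bas ((x @ z) @ l # y @ t)"
    by (rule act_descending_run_sorted) (use snoc.prems in auto)
  ultimately show ?case
    using snoc.prems(2) assms(2,3) by (auto simp: act_append add_ac simp del: upt_Suc)
qed simp

lemma act_shuf_sorted:
  assumes "\<And>k l. k \<in> set (u1 @ u2 @ u3) \<Longrightarrow> l \<in> set (v1 @ v2 @ v3) \<Longrightarrow> k < l"
    and "length u1 = a" "length u2 = b" "length u3 = c" "length v1 = e" "length v2 = f"
  shows "act q (shuf a b c e f) (bas ((u1 @ u2 @ u3) @ (v1 @ v2 @ v3)))
    = bas ((u1 @ v1) @ (u2 @ v2) @ (u3 @ v3))"
proof -
  have "act q (cross (a + b) c e) (bas ((u1 @ u2) @ u3 @ v1 @ (v2 @ v3))) = bas ((u1 @ u2) @ v1 @ u3 @ (v2 @ v3))"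
    by (rule act_cross_sorted) (use assms in auto)
  moreover have "act q (cross a b e) (bas (u1 @ u2 @ v1 @ (u3 @ v2 @ v3))) = bas (u1 @ v1 @ u2 @ (u3 @ v2 @ v3))"
    by (rule act_cross_sorted) (use assms in auto)
  moreover have "act q (cross (a + e + b) c f) (bas ((u1 @ v1 @ u2) @ u3 @ v2 @ v3)) = bas ((u1 @ v1 @ u2) @ v2 @ u3 @ v3)"
    by (rule act_cross_sorted) (use assms in auto)
  ultimately show ?thesis
    by (simp add: shuf_def act_append)
qed

lemma incl_bas: "w \<in> words n d \<Longrightarrow> incl s n d (bas w) = bas (map ((+) s) w)"
  by (simp add: incl_def)

lemma incl_in_hom:
  fixes q :: "'k::field"
  assumes "s + n \<le> m"
  shows "incl s n d \<in> hom q d n m"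
proof -
  have lin: "lin (incl s n d :: 'k tensor \<Rightarrow> _)"
    unfolding incl_def by (rule lin_lext)
  have "incl s n d x \<in> tpow m d" if "x \<in> tpow n d" for x :: "'k tensor"
    by (rule lin_free_in_subspace[OF lin subspace_free _ that])
      (use assms in \<open>fastforce simp: incl_bas words_def\<close>)
  moreover have "incl s n d (T q i x) = T q i (incl s n d x)" if i: "i \<in> {1..<d}" and x: "x \<in> tpow n d" for i x
  proof (rule lin_eq_on_free[where f = "\<lambda>x. incl s n d (T q i x)" and g = "\<lambda>x. T q i (incl s n d x)", OF _ _ _ x])
    fix w assume w: "w \<in> words n d"
    then have len: "length w = d"
      by (simp add: words_def)
    obtain u a b v where w': "w = u @ a # b # v" "i = Suc (length u)"
      by (rule word_at[OF i len])
    then have "u @ b # a # v \<in> words n d"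
      using w by (auto simp: words_def)
    then show "incl s n d (T q i (bas w)) = T q i (incl s n d (bas w))"
      using w T_bas[of q "map ((+) s) u" "s + a" "s + b" "map ((+) s) v"]
      unfolding w' by (auto simp: T_bas incl_bas lin_simps[OF lin])
  qed (rule lin_compose[OF lin lin_T'] lin_T[OF lin])+
  ultimately show ?thesis
    using lin by (auto simp: hom_def incl_def)
qed

subsection \<open>Separating small and large letters\<close>

definition low :: "nat \<Rightarrow> nat list \<Rightarrow> nat list"
  where "low n w = filter (\<lambda>k. k \<le> n) w"

definition high :: "nat \<Rightarrow> nat list \<Rightarrow> nat list"
  where "high n w = map (\<lambda>k. k - n) (filter (\<lambda>k. n < k) w)"

text \<open>Only pairs of a letter above \<open>n\<close> and a later letter at most \<open>n\<close> are counted: these are the pairs that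
  change places when the small letters are moved to the front.\<close>

fun inversions :: "nat \<Rightarrow> nat list \<Rightarrow> nat" where
  "inversions n [] = 0"
| "inversions n (k # w) = (if n < k then length (low n w) else 0) + inversions n w"

lemma low_append [simp]: "low n (u @ v) = low n u @ low n v"
  and high_append [simp]: "high n (u @ v) = high n u @ high n v"
  by (simp_all add: low_def high_def)

lemma low_Cons: "low n (k # w) = (if k \<le> n then k # low n w else low n w)"
  and high_Cons: "high n (k # w) = (if n < k then (k - n) # high n w else high n w)"
  by (simp_all add: low_def high_def)

lemma low_Nil [simp]: "low n [] = []" and high_Nil [simp]: "high n [] = []"
  by (simp_all add: low_def high_def)

lemma inversions_append:
  "inversions n (u @ v) = inversions n u + inversions n v + length (high n u) * length (low n v)"
  by (induction u) (auto simp: low_Cons high_Cons)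

lemma length_low_high: "length (low n w) + length (high n w) = length w"
  by (induction w) (auto simp: low_Cons high_Cons)

lemma low_in_words: "w \<in> words (n + m) d \<Longrightarrow> low n w \<in> words n (length (low n w))"
  and high_in_words: "w \<in> words (n + m) d \<Longrightarrow> high n w \<in> words m (length (high n w))"
  by (fastforce simp: words_def low_def high_def)+

lemma low_small: "set w \<subseteq> {1..n} \<Longrightarrow> low n w = w"
  and high_small: "set w \<subseteq> {1..n} \<Longrightarrow> high n w = []"
  and inversions_small: "set w \<subseteq> {1..n} \<Longrightarrow> inversions n w = 0"
  by (induction w) (auto simp: low_Cons high_Cons)

lemma low_large: "0 \<notin> set w \<Longrightarrow> low n (map ((+) n) w) = []"
  and high_large: "0 \<notin> set w \<Longrightarrow> high n (map ((+) n) w) = w"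
  by (induction w) (auto simp: low_Cons high_Cons)

lemma inversions_large: "0 \<notin> set w \<Longrightarrow> inversions n (map ((+) n) w) = 0"
  by (induction w) (auto simp: low_large)

lemma map_plus_high: "map ((+) n) (high n w) = filter (\<lambda>k. n < k) w"
  by (induction w) (auto simp: high_Cons)

text \<open>A large first letter has to pass all small letters of the word. That is a crossing in increasing
  order, hence a plain permutation of letters, and modulo the relations it is a power of \<open>q\<close>.\<close>

lemma separated_mod_Rel:
  fixes q :: "'k::field"
  assumes "set w \<subseteq> {1..l}"
  shows "bas w - q ^ inversions n w *\<^sub>v bas (low n w @ map ((+) n) (high n w))
    \<in> Rel q l (length w) {1..<length w}"
  using assms
proof (induction w)
  case Nil
  then show ?case
    by (simp add: pm.subspace_0[OF subspace_Rel])
next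
  case (Cons k w)
  let ?L = "low n w" and ?H = "map ((+) n) (high n w)"
  let ?R = "Rel q l (Suc (length w)) {1..<Suc (length w)}"
  have k: "bas [k] \<in> tpow l 1" and LH: "length ?L + length ?H = length w"
    using Cons.prems length_low_high[of n w] by (auto simp: words_def)
  have "bas [k] \<bullet> (bas w - q ^ inversions n w *\<^sub>v bas (?L @ ?H)) \<in> Rel q l (1 + length w) ((+) 1 ` {1..<length w})"
    by (rule dot_Rel_right[OF Cons.IH _ k]) (use Cons.prems in auto)
  moreover have "Rel q l (1 + length w) ((+) 1 ` {1..<length w}) \<subseteq> Rel q l (1 + length w) {1..<Suc (length w)}"
    by (rule Rel_mono) auto
  ultimately have first: "bas (k # w) - q ^ inversions n w *\<^sub>v bas (k # ?L @ ?H) \<in> ?R"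
    by (auto simp: dot_simps)
  show ?case
  proof (cases "n < k")
    case False
    with first show ?thesis
      by (simp add: low_Cons high_Cons)
  next
    case True
    define r where "r = cross 0 (length ?L) 1"
    have r: "length r = length ?L"
      by (simp add: r_def del: upt_Suc)
    have rset: "set r \<subseteq> {1..<length ?L + 1}"
      unfolding r_def by (auto dest!: set_cross simp del: cross.simps)
    have Lk: "bas (?L @ [k]) \<in> tpow l (length ?L + 1)" and H: "bas ?H \<in> tpow l (length ?H)"
      using Cons.prems by (auto simp: words_def low_def map_plus_high)
    have "act q r (bas ([] @ ?L @ [k] @ [])) = bas ([] @ [k] @ ?L @ [])"
      unfolding r_def by (rule act_cross_sorted) (use True in \<open>auto simp: low_def\<close>)
    then have "bas (k # ?L) - q ^ length ?L *\<^sub>v bas (?L @ [k]) \<in> Rel q l (length ?L + 1) {1..<length ?L + 1}"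
      using act_mod_Rel[OF rset _ Lk, of q] by (simp add: r)
    then have "(bas (k # ?L) - q ^ length ?L *\<^sub>v bas (?L @ [k])) \<bullet> bas ?H
        \<in> Rel q l (length ?L + 1 + length ?H) {1..<length ?L + 1}"
      by (rule dot_Rel_left[OF _ _ H]) simp
    moreover have "Rel q l (length ?L + 1 + length ?H) {1..<length ?L + 1} \<subseteq> ?R"
      using LH by (simp add: Rel_mono)
    ultimately have "bas (k # ?L @ ?H) - q ^ length ?L *\<^sub>v bas (?L @ k # ?H) \<in> ?R"
      by (auto simp: dot_simps)
    then have "(bas (k # w) - q ^ inversions n w *\<^sub>v bas (k # ?L @ ?H))
        + q ^ inversions n w *\<^sub>v (bas (k # ?L @ ?H) - q ^ length ?L *\<^sub>v bas (?L @ k # ?H)) \<in> ?R"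
      by (intro pm.subspace_add pm.subspace_scale subspace_Rel first)
    with True show ?thesis
      by (simp add: low_Cons high_Cons pm.scale_right_diff_distrib power_add mult.commute)
  qed
qed


text \<open>The source of the exponential map, a sum over all ways to distribute the degree.\<close>

definition pairs_space :: "'k::field \<Rightarrow> nat \<Rightarrow> nat \<Rightarrow> nat \<Rightarrow> ((nat \<times> nat) \<times> (Bidx \<times> Bidx), 'k) space"
  where "pairs_space q d n m =
    dsum_space {(d1, d2). d1 + d2 = d} (\<lambda>(d1, d2). tens_space (obj (B q d1) n) (obj (B q d2) m))"

lemma dinj_tens_in_elems:
  assumes "x \<in> elemsB q d1 n" "y \<in> elemsB q d2 m" "d1 + d2 = d"
  shows "dinj (d1, d2) (x \<otimes> y) \<in> elems (pairs_space q d n m)"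
proof (rule bilin_free_in_subspace[where f = "\<lambda>x y. dinj (d1, d2) (x \<otimes> y)", OF _ _ subspace_free _ assms(1,2)])
  show "dinj (d1, d2) (bas i \<otimes> bas j) \<in> elems (pairs_space q d n m)"
    if "i \<in> gens (obj (B q d1) n)" "j \<in> gens (obj (B q d2) m)" for i j
    using that assms(3) by (simp add: pairs_space_def dsum_space_def tens_space_def)
qed (intro lin_intros)+

lemma subspace_rels_pairs: "pm.subspace (rels (pairs_space q d n m))"
  by (simp add: pairs_space_def dsum_space_def pm.subspace_span)

lemma dinj_tens_in_rels:
  assumes "x \<in> relsB q d1 n \<and> y \<in> elemsB q d2 m
      \<or> x \<in> elemsB q d1 n \<and> y \<in> relsB q d2 m" and "d1 + d2 = d"
  shows "dinj (d1, d2) (x \<otimes> y) \<in> rels (pairs_space q d n m)"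
proof -
  have "x \<otimes> y \<in> rels (tens_space (obj (B q d1) n) (obj (B q d2) m))"
    unfolding tens_space_def space.select_convs by (rule pm.span_base) (use assms(1) in blast)
  then show ?thesis
    using assms(2) unfolding pairs_space_def dsum_space_def space.select_convs
    by (intro pm.span_base UN_I[of "(d1, d2)"]) auto
qed

abbreviation join :: "'k::field \<Rightarrow> nat \<Rightarrow> nat \<Rightarrow> ((nat \<times> nat) \<times> (Bidx \<times> Bidx) \<Rightarrow>\<^sub>0 'k) \<Rightarrow> (Bidx \<Rightarrow>\<^sub>0 'k)"
  where "join q n m \<equiv> exp_map (B q) (\<lambda>d1 d2 n. B_mu q) n m"

lemma lin_join: "lin (join q n m)"
  unfolding exp_map_def by (rule lin_lext)

lemma join_dinj:
  "join q n m (dinj (d1, d2) (x \<otimes> y))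
   = B_mu q (mor (B q d1) n (n + m) (incl 0 n d1) x \<otimes> mor (B q d2) m (n + m) (incl n m d2) y)"
proof (rule bilin_ext[where f = "\<lambda>x y. join q n m (dinj (d1, d2) (x \<otimes> y))"
      and g = "\<lambda>x y. B_mu q (mor (B q d1) n (n + m) (incl 0 n d1) x \<otimes> mor (B q d2) m (n + m) (incl n m d2) y)"])
  show "lin (\<lambda>x. join q n m (dinj (d1, d2) (x \<otimes> y)))" "lin (\<lambda>y. join q n m (dinj (d1, d2) (x \<otimes> y)))" for x y
    by (rule lin_compose[OF lin_join]; intro lin_intros)+
  show "lin (\<lambda>x. B_mu q (mor (B q d1) n (n + m) (incl 0 n d1) x \<otimes> mor (B q d2) m (n + m) (incl n m d2) y))" for y
    by (rule lin_B_mu[OF lin_tens_left[OF lin_mor_B]])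
  show "lin (\<lambda>y. B_mu q (mor (B q d1) n (n + m) (incl 0 n d1) x \<otimes> mor (B q d2) m (n + m) (incl n m d2) y))" for x
    by (rule lin_B_mu[OF lin_tens_right[OF lin_mor_B]])
qed (simp add: exp_map_def)

lemma is_map_join:
  fixes q :: "'k::field"
  assumes q: "q \<noteq> 0"
  shows "is_map (pairs_space q d n m) (obj (B q d) (n + m)) (join q n m)"
proof -
  have left: "mor (B q d1) n (n + m) (incl 0 n d1) x \<in> elemsB q d1 (n + m)" if "x \<in> elemsB q d1 n" for d1 x
    using is_map_mor_B[OF incl_in_hom, of 0 n "n + m" q d1] that unfolding is_map_def by auto
  have left': "mor (B q d1) n (n + m) (incl 0 n d1) x \<in> relsB q d1 (n + m)" if "x \<in> relsB q d1 n" for d1 x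
    using is_map_mor_B[OF incl_in_hom, of 0 n "n + m" q d1] that unfolding is_map_def by auto
  have right: "mor (B q d2) m (n + m) (incl n m d2) x \<in> elemsB q d2 (n + m)" if "x \<in> elemsB q d2 m" for d2 x
    using is_map_mor_B[OF incl_in_hom, of n m "n + m" q d2] that unfolding is_map_def by auto
  have right': "mor (B q d2) m (n + m) (incl n m d2) x \<in> relsB q d2 (n + m)" if "x \<in> relsB q d2 m" for d2 x
    using is_map_mor_B[OF incl_in_hom, of n m "n + m" q d2] that unfolding is_map_def by auto
  have summand: "is_map (tens_space (obj (B q d1) n) (obj (B q d2) m)) (obj (B q d) (n + m))
      (\<lambda>z. join q n m (dinj (d1, d2) z))" if "d1 + d2 = d" for d1 d2
    unfolding that[symmetric]
    by (rule is_map_tens[OF lin_compose[OF lin_join lin_dinj[OF lin_ident]] is_space_B], unfold join_dinj)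
      (intro B_mu_in_elems B_mu_rels_left[OF q] B_mu_rels_right[OF q] left left' right right'; assumption)+
  show ?thesis
    unfolding is_map_def
  proof (intro conjI image_subsetI lin_join)
    fix x assume x: "x \<in> elems (pairs_space q d n m)"
    show "join q n m x \<in> elemsB q d (n + m)"
    proof (rule lin_free_in_subspace[OF lin_join subspace_free _ x])
      fix k assume "k \<in> gens (pairs_space q d n m)"
      then obtain d1 d2 t where k: "k = ((d1, d2), t)" "d1 + d2 = d"
        and t: "t \<in> gens (tens_space (obj (B q d1) n) (obj (B q d2) m))"
        by (auto simp: pairs_space_def dsum_space_def)
      have "(bas t :: _ \<Rightarrow>\<^sub>0 'k) \<in> elems (tens_space (obj (B q d1) n) (obj (B q d2) m))"
        using t by simp
      then have "join q n m (dinj (d1, d2) (bas t)) \<in> elemsB q d (n + m)"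
        using summand[OF k(2)] unfolding is_map_def by blast
      then show "join q n m (bas k) \<in> elemsB q d (n + m)"
        by (simp add: k)
    qed
  next
    fix x assume x: "x \<in> rels (pairs_space q d n m)"
    show "join q n m x \<in> relsB q d (n + m)"
      using lin_join subspace_rels_B _ x[unfolded pairs_space_def dsum_space_def space.select_convs]
    proof (rule lin_span_in_subspace)
      fix r assume "r \<in> (\<Union>p\<in>{(d1, d2). d1 + d2 = d}.
        dinj p ` rels (case p of (d1, d2) \<Rightarrow> tens_space (obj (B q d1) n) (obj (B q d2) m)))"
      then obtain d1 d2 z where r: "r = dinj (d1, d2) z" "d1 + d2 = d"
        and z: "z \<in> rels (tens_space (obj (B q d1) n) (obj (B q d2) m))"
        by auto
      then show "join q n m r \<in> relsB q d (n + m)"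
        using summand[OF r(2)] unfolding is_map_def r(1) by blast
    qed
  qed
qed

text \<open>The letters of the second factor are shifted above those of the first, so the shuffle of the product
  just permutes the blocks.\<close>

lemma join_words:
  fixes q :: "'k::field"
  assumes "u1 \<in> words n a" "u2 \<in> words n b" "u3 \<in> words n c"
    and "v1 \<in> words m e" "v2 \<in> words m f" "v3 \<in> words m g"
  shows "join q n m (bas ((a + b + c, e + f + g), (((a, b, c), (u1, u2, u3)), ((e, f, g), (v1, v2, v3)))))
    = q ^ ((b + c) * e) *\<^sub>v pack (a + e) (b + f) (c + g)
        (bas ((u1 @ map ((+) n) v1) @ (u2 @ map ((+) n) v2) @ (u3 @ map ((+) n) v3)))"
proof -
  let ?d = "a + b + c" and ?d' = "e + f + g"
  let ?u = "u1 @ u2 @ u3" and ?v = "v1 @ v2 @ v3"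
  let ?v' = "map ((+) n) v1 @ map ((+) n) v2 @ map ((+) n) v3"
  have u: "?u \<in> words n ?d" and v: "?v \<in> words m ?d'"
    using assms by (auto simp: words_def)
  have "bas ((?d, ?d'), (((a, b, c), (u1, u2, u3)), ((e, f, g), (v1, v2, v3))))
      = (dinj (?d, ?d') (pack a b c (bas ?u) \<otimes> pack e f g (bas ?v)) :: _ \<Rightarrow>\<^sub>0 'k)"
    using assms by (simp add: pack_bas words_def)
  moreover have "mor (B q ?d) n (n + m) (incl 0 n ?d) (pack a b c (bas ?u)) = pack a b c (bas ?u)"
    using u mor_B_pack[OF incl_in_hom, of 0 n "n + m" a b c ?d "bas ?u" q]
    by (simp add: incl_bas map_idI words_def)
  moreover have "mor (B q ?d') m (n + m) (incl n m ?d') (pack e f g (bas ?v)) = pack e f g (bas ?v')"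
    using v mor_B_pack[OF incl_in_hom, of n m "n + m" e f g ?d' "bas ?v" q]
    by (simp add: incl_bas words_def)
  moreover have "B_mu q (pack a b c (bas ?u) \<otimes> pack e f g (bas ?v'))
      = q ^ ((b + c) * e) *\<^sub>v pack (a + e) (b + f) (c + g) (act q (shuf a b c e f) (bas ?u \<bullet> bas ?v'))"
    by (rule B_mu_pack) (use assms in \<open>auto simp: words_def\<close>)
  moreover have "act q (shuf a b c e f) (bas (?u @ ?v'))
      = bas ((u1 @ map ((+) n) v1) @ (u2 @ map ((+) n) v2) @ (u3 @ map ((+) n) v3))"
    by (rule act_shuf_sorted) (use assms in \<open>fastforce simp: words_def\<close>)+
  ultimately show ?thesis
    by (simp add: join_dinj)
qed

text \<open>The inverse of \<open>join\<close>: moving the letters at most \<open>n\<close> to the front of each of the three words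
  costs a factor \<open>q\<close> for every
  inversion, as in a quantum affine space; the other scalar cancels that of the product.\<close>

definition separate :: "'k::field \<Rightarrow> nat \<Rightarrow> (Bidx \<Rightarrow>\<^sub>0 'k) \<Rightarrow> ((nat \<times> nat) \<times> (Bidx \<times> Bidx) \<Rightarrow>\<^sub>0 'k)"
  where "separate q n = lext (\<lambda>(\<alpha>, (w1, w2, w3)).
    let a = length (low n w1); b = length (low n w2); c = length (low n w3);
        e = length (high n w1); f = length (high n w2); g = length (high n w3)
    in (q ^ (inversions n w1 + inversions n w2 + inversions n w3) * inverse q ^ ((b + c) * e)) *\<^sub>v
      bas ((a + b + c, e + f + g),
        (((a, b, c), (low n w1, low n w2, low n w3)), ((e, f, g), (high n w1, high n w2, high n w3)))))"

lemma lin_separate: "lin (separate q n)"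
  unfolding separate_def by (rule lin_lext)

lemma separate_bas:
  assumes "length w1 = A" "length w2 = B'" "length w3 = C"
    and "length (low n w1) = a" "length (low n w2) = b" "length (low n w3) = c"
    and "length (high n w1) = e" "length (high n w2) = f" "length (high n w3) = g"
  shows "separate q n (pack A B' C (bas (w1 @ w2 @ w3)))
    = (q ^ (inversions n w1 + inversions n w2 + inversions n w3) * inverse q ^ ((b + c) * e)) *\<^sub>v
      dinj (a + b + c, e + f + g)
        (pack a b c (bas (low n (w1 @ w2 @ w3))) \<otimes> pack e f g (bas (high n (w1 @ w2 @ w3))))"
  using assms by (simp add: separate_def pack_bas Let_def)

lemma separate_in_elems:
  fixes q :: "'k::field"
  assumes "x \<in> elemsB q d (n + m)"
  shows "separate q n x \<in> elems (pairs_space q d n m)"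
proof (rule elems_B_in_subspace[OF lin_separate subspace_free _ assms])
  fix A B' C w assume ABC: "A + B' + C = d" and w: "w \<in> words (n + m) d"
  then have length: "length w = A + B' + C"
    by (simp add: words_def)
  obtain w1 w2 w3 where w': "w = w1 @ w2 @ w3" and l: "length w1 = A" "length w2 = B'" "length w3 = C"
    using word_3_blocks[OF length] by blast
  have "bas (low n w) \<in> tpow n (length (low n w))" "bas (high n w) \<in> tpow m (length (high n w))"
    using low_in_words[OF w] high_in_words[OF w] by auto
  then have "dinj (length (low n w), length (high n w))
    (pack (length (low n w1)) (length (low n w2)) (length (low n w3)) (bas (low n w)) \<otimes>
     pack (length (high n w1)) (length (high n w2)) (length (high n w3)) (bas (high n w)))
    \<in> elems (pairs_space q d n m)"
    using length_low_high[of n w] ABC length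
    by (intro dinj_tens_in_elems pack_in_elems) (auto simp: w')
  then show "separate q n (pack A B' C (bas w)) \<in> elems (pairs_space q d n m)"
    unfolding w' separate_bas[OF l refl refl refl refl refl refl]
    by (intro pm.subspace_scale[OF subspace_free]) (simp add: add.assoc)
qed

lemma separate_join:
  fixes q :: "'k::field"
  assumes q: "q \<noteq> 0" and x: "x \<in> elems (pairs_space q d n m)"
  shows "separate q n (join q n m x) = x"
proof (rule lin_eq_on_free[where f = "\<lambda>x. separate q n (join q n m x)" and g = "\<lambda>x. x", OF _ lin_ident _ x])
  show "lin (\<lambda>x. separate q n (join q n m x))"
    by (rule lin_compose[OF lin_separate lin_join])
  fix k assume "k \<in> gens (pairs_space q d n m)"
  then obtain d1 d2 i j where k: "k = ((d1, d2), (i, j))" "d1 + d2 = d"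
    and ij: "i \<in> gens (obj (B q d1) n)" "j \<in> gens (obj (B q d2) m)"
    by (auto simp: pairs_space_def dsum_space_def tens_space_def)
  from ij(1) obtain a b c u1 u2 u3 where i: "i = ((a, b, c), (u1, u2, u3))" "a + b + c = d1"
    "u1 \<in> words n a" "u2 \<in> words n b" "u3 \<in> words n c"
    unfolding gens_B by blast
  from ij(2) obtain e f g v1 v2 v3 where j: "j = ((e, f, g), (v1, v2, v3))" "e + f + g = d2"
    "v1 \<in> words m e" "v2 \<in> words m f" "v3 \<in> words m g"
    unfolding gens_B by blast
  let ?s = "map ((+) n)"
  have block: "low n (u @ ?s v) = u" "high n (u @ ?s v) = v" "inversions n (u @ ?s v) = 0"
    if u: "u \<in> words n r" and v: "v \<in> words m s" for u v r s
  proof -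
    have "set u \<subseteq> {1..n}" "0 \<notin> set v"
      using u v by (auto simp: words_def)
    then show "low n (u @ ?s v) = u" "high n (u @ ?s v) = v" "inversions n (u @ ?s v) = 0"
      by (simp_all add: low_small high_small inversions_small low_large high_large inversions_large
          inversions_append)
  qed
  note blocks = block[OF i(3) j(3)] block[OF i(4) j(4)] block[OF i(5) j(5)]
  have l: "length u1 = a" "length u2 = b" "length u3 = c" "length v1 = e" "length v2 = f" "length v3 = g"
    using i j by (auto simp: words_def)
  have "separate q n (pack (a + e) (b + f) (c + g) (bas ((u1 @ ?s v1) @ (u2 @ ?s v2) @ (u3 @ ?s v3))))
      = inverse q ^ ((b + c) * e) *\<^sub>v bas k"
    by (subst separate_bas[where a = a and b = b and c = c and e = e and f = f and g = g])
      (simp_all only: blocks low_append[of n "u1 @ ?s v1"] high_append[of n "u1 @ ?s v1"]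
        low_append[of n "u2 @ ?s v2"] high_append[of n "u2 @ ?s v2"],
        simp_all add: l k i(1,2) j(1,2) pack_bas)
  moreover have "join q n m (bas k) = q ^ ((b + c) * e) *\<^sub>v pack (a + e) (b + f) (c + g)
        (bas ((u1 @ ?s v1) @ (u2 @ ?s v2) @ (u3 @ ?s v3)))"
    using join_words[OF i(3-5) j(3-5), of q] by (simp only: k i(1,2) j(1,2))
  ultimately have "separate q n (join q n m (bas k)) = (q ^ ((b + c) * e) * inverse q ^ ((b + c) * e)) *\<^sub>v bas k"
    by (simp add: lin_simps[OF lin_separate])
  also have "q ^ ((b + c) * e) * inverse q ^ ((b + c) * e) = 1"
    using q by (simp flip: power_mult_distrib)
  finally show "separate q n (join q n m (bas k)) = bas k"
    by simp
qed

lemma join_separate: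
  fixes q :: "'k::field"
  assumes q: "q \<noteq> 0" and x: "x \<in> elemsB q d (n + m)"
  shows "join q n m (separate q n x) - x \<in> relsB q d (n + m)"
proof (rule elems_B_in_subspace[where f = "\<lambda>x. join q n m (separate q n x) - x", OF _ subspace_rels_B _ x])
  show "lin (\<lambda>x. join q n m (separate q n x) - x)"
    by (rule lin_minus[OF lin_compose[OF lin_join lin_separate] lin_ident])
  fix A B' C w assume ABC: "A + B' + C = d" and w: "w \<in> words (n + m) d"
  then have length: "length w = A + B' + C"
    by (simp add: words_def)
  obtain w1 w2 w3 where w': "w = w1 @ w2 @ w3" and l: "length w1 = A" "length w2 = B'" "length w3 = C"
    using word_3_blocks[OF length] by blast
  have words: "w1 \<in> words (n + m) A" "w2 \<in> words (n + m) B'" "w3 \<in> words (n + m) C"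
    using w l by (auto simp: w' words_def)
  let ?s = "\<lambda>w. low n w @ map ((+) n) (high n w)"
  let ?i1 = "inversions n w1" and ?i2 = "inversions n w2" and ?i3 = "inversions n w3"
  have tp: "bas (?s v) \<in> tpow (n + m) (length v)" if "v \<in> words (n + m) r" for v r
    using that length_low_high[of n v] by (auto simp: words_def low_def map_plus_high high_def)
  let ?R = "Rel q (n + m) d (blocks A B' C)"
  have Rel: "r \<in> ?R" if "r \<in> Rel q (n + m) d J" "J \<subseteq> blocks A B' C" for r J
    using that Rel_mono by blast
  have block: "bas v - q ^ inversions n v *\<^sub>v bas (?s v) \<in> Rel q (n + m) r {1..<r}"
    if "v \<in> words (n + m) r" for v r
    using that separated_mod_Rel[of v "n + m" q n] by (auto simp: words_def)
  have bw: "bas w1 \<in> tpow (n + m) A" "bas w2 \<in> tpow (n + m) B'" "bas w3 \<in> tpow (n + m) C"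
    "bas (?s w1) \<in> tpow (n + m) A" "bas (?s w2) \<in> tpow (n + m) B'"
    using words tp[OF words(1)] tp[OF words(2)] l by auto
  \<comment> \<open>The blocks are sorted one after another, and the three differences telescope.\<close>
  have "(bas w1 - q ^ ?i1 *\<^sub>v bas (?s w1)) \<bullet> bas w2 \<bullet> bas w3 \<in> ?R"
  proof (rule Rel)
    show "(bas w1 - q ^ ?i1 *\<^sub>v bas (?s w1)) \<bullet> bas w2 \<bullet> bas w3 \<in> Rel q (n + m) d {1..<A}"
      using dot_Rel_left[OF block[OF words(1)] _ dot_in_tpow[OF bw(2,3)]] ABC by (simp add: add.assoc)
  qed (auto simp: blocks_def)
  moreover have "bas (?s w1) \<bullet> (bas w2 - q ^ ?i2 *\<^sub>v bas (?s w2)) \<bullet> bas w3 \<in> ?R"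
  proof (rule Rel)
    show "bas (?s w1) \<bullet> (bas w2 - q ^ ?i2 *\<^sub>v bas (?s w2)) \<bullet> bas w3 \<in> Rel q (n + m) d ((+) A ` {1..<B'})"
      using dot_Rel_right[OF dot_Rel_left[OF block[OF words(2)] _ bw(3)] _ bw(4)] ABC
      by (simp add: add.assoc)
  qed (auto simp: blocks_def)
  moreover have "bas (?s w1) \<bullet> bas (?s w2) \<bullet> (bas w3 - q ^ ?i3 *\<^sub>v bas (?s w3)) \<in> ?R"
  proof (rule Rel)
    show "bas (?s w1) \<bullet> bas (?s w2) \<bullet> (bas w3 - q ^ ?i3 *\<^sub>v bas (?s w3)) \<in> Rel q (n + m) d ((+) (A + B') ` {1..<C})"
      using dot_Rel_right[OF block[OF words(3)] _ dot_in_tpow[OF bw(4,5)]] ABC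
      by (simp add: dot_assoc del: dot_bas)
  qed (auto simp: blocks_def)
  ultimately have "(bas w1 - q ^ ?i1 *\<^sub>v bas (?s w1)) \<bullet> bas w2 \<bullet> bas w3
      + q ^ ?i1 *\<^sub>v (bas (?s w1) \<bullet> (bas w2 - q ^ ?i2 *\<^sub>v bas (?s w2)) \<bullet> bas w3)
      + q ^ (?i1 + ?i2) *\<^sub>v (bas (?s w1) \<bullet> bas (?s w2) \<bullet> (bas w3 - q ^ ?i3 *\<^sub>v bas (?s w3))) \<in> ?R"
    by (intro pm.subspace_add pm.subspace_scale subspace_Rel)
  then have "bas w - q ^ (?i1 + ?i2 + ?i3) *\<^sub>v bas (?s w1 @ ?s w2 @ ?s w3) \<in> ?R"
    by (simp add: w' dot_simps pm.scale_right_diff_distrib power_add)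
  then have "- (bas w - q ^ (?i1 + ?i2 + ?i3) *\<^sub>v bas (?s w1 @ ?s w2 @ ?s w3)) \<in> ?R"
    by (rule pm.subspace_neg[OF subspace_Rel])
  then have sorted: "q ^ (?i1 + ?i2 + ?i3) *\<^sub>v pack A B' C (bas (?s w1 @ ?s w2 @ ?s w3)) - pack A B' C (bas w)
      \<in> relsB q d (n + m)"
    using pack_in_rels[OF _ ABC] by (simp only: minus_diff_eq pack_simps[symmetric])
  define a b c e f g where lengths: "a = length (low n w1)" "b = length (low n w2)" "c = length (low n w3)"
    "e = length (high n w1)" "f = length (high n w2)" "g = length (high n w3)"
  have total: "a + e = A" "b + f = B'" "c + g = C"
    using l length_low_high[of n w1] length_low_high[of n w2] length_low_high[of n w3] by (simp_all add: lengths)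
  have "separate q n (pack A B' C (bas w)) = (q ^ (?i1 + ?i2 + ?i3) * inverse q ^ ((b + c) * e)) *\<^sub>v
      bas ((a + b + c, e + f + g), (((a, b, c), (low n w1, low n w2, low n w3)), ((e, f, g), (high n w1, high n w2, high n w3))))"
    using l by (simp add: w' separate_def pack_bas Let_def lengths)
  moreover have "join q n m (bas ((a + b + c, e + f + g), (((a, b, c), (low n w1, low n w2, low n w3)), ((e, f, g), (high n w1, high n w2, high n w3)))))
      = q ^ ((b + c) * e) *\<^sub>v pack (a + e) (b + f) (c + g) (bas (?s w1 @ ?s w2 @ ?s w3))"
    unfolding lengths by (intro join_words low_in_words[OF words(1)] low_in_words[OF words(2)]
        low_in_words[OF words(3)] high_in_words[OF words(1)] high_in_words[OF words(2)] high_in_words[OF words(3)])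
  ultimately have "join q n m (separate q n (pack A B' C (bas w)))
      = (q ^ (?i1 + ?i2 + ?i3) * (inverse q ^ ((b + c) * e) * q ^ ((b + c) * e))) *\<^sub>v pack A B' C (bas (?s w1 @ ?s w2 @ ?s w3))"
    by (simp add: lin_simps[OF lin_join] total mult.assoc)
  also have "inverse q ^ ((b + c) * e) * q ^ ((b + c) * e) = 1"
    using q by (simp flip: power_mult_distrib)
  finally show "join q n m (separate q n (pack A B' C (bas w))) - pack A B' C (bas w) \<in> relsB q d (n + m)"
    using sorted by simp
qed

text \<open>For letters \<open>k < l\<close> the relation at either of the two words \<open>..k l..\<close> and \<open>..l k..\<close> says that the
  second is \<open>q\<close> times the first, because \<open>(T - q)\<close> on the second is \<open>-inverse q\<close> times \<open>(T - q)\<close> on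
  the first.\<close>

lemma lin_Rel_letters:
  fixes q :: "'k::field"
  assumes q: "q \<noteq> 0" and "lin f" "pm.subspace R" and J: "J \<subseteq> {1..<d}" and r: "r \<in> Rel q n d J"
    and swap: "\<And>u k l v. k < l \<Longrightarrow> Suc (length u) \<in> J \<Longrightarrow> u @ k # l # v \<in> words n d \<Longrightarrow>
      f (bas (u @ l # k # v)) - q *\<^sub>v f (bas (u @ k # l # v)) \<in> R"
  shows "f r \<in> R"
proof (rule lin_Rel_in_subspace[OF assms(2,3) _ r])
  fix i and x :: "'k tensor" assume i: "i \<in> J" and x: "x \<in> tpow n d"
  have "lin (\<lambda>x. f (T q i x - q *\<^sub>v x))"
    by (rule lin_compose[OF assms(2)]) (intro lin_intros)
  then show "f (T q i x - q *\<^sub>v x) \<in> R"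
  proof (rule lin_free_in_subspace[OF _ assms(3) _ x])
    fix w assume w: "w \<in> words n d"
    then have len: "length w = d"
      by (simp add: words_def)
    have "i \<in> {1..<d}"
      using i J by blast
    then obtain u k l v where w': "w = u @ k # l # v" "i = Suc (length u)"
      by (rule word_at[OF _ len])
    consider "k < l" | "k = l" | "l < k"
      by linarith
    then show "f (T q i (bas w) - q *\<^sub>v bas w) \<in> R"
    proof cases
      case 1
      then show ?thesis
        using swap[of k l u v] i w by (simp add: w' T_bas lin_simps[OF assms(2)])
    next
      case 2
      then show ?thesis
        by (simp add: w' T_bas lin_zero[OF assms(2)] pm.subspace_0[OF assms(3)])
    next
      case 3
      have "u @ l # k # v \<in> words n d"
        using w by (auto simp: w' words_def)
      then have "f (bas (u @ k # l # v)) - q *\<^sub>v f (bas (u @ l # k # v)) \<in> R"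
        using swap[of l k u v] i 3 by (simp add: w')
      then have "(- inverse q) *\<^sub>v (f (bas (u @ k # l # v)) - q *\<^sub>v f (bas (u @ l # k # v))) \<in> R"
        by (rule pm.subspace_scale[OF assms(3)])
      also have "(- inverse q) *\<^sub>v (f (bas (u @ k # l # v)) - q *\<^sub>v f (bas (u @ l # k # v)))
          = f (T q i (bas w) - q *\<^sub>v bas w)"
        using 3 q by (simp add: w' T_bas lin_simps[OF assms(2)] pm.scale_right_diff_distrib
            pm.scale_left_diff_distrib)
      finally show ?thesis .
    qed
  qed
qed

lemma swap_in_Rel:
  assumes "k < l" "Suc (length u) \<in> J" "u @ k # l # v \<in> words n d"
  shows "bas (u @ l # k # v) - q *\<^sub>v bas (u @ k # l # v) \<in> Rel q n d J"
  using T_diff_in_Rel[OF assms(2), of "bas (u @ k # l # v)" n d q] assms by (simp add: T_bas)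

text \<open>Exchanging neighbouring letters \<open>k < l\<close> of a block: if \<open>n\<close> lies between them, then there is one more
  inversion and the factor \<open>q\<close> appears; if both are at most \<open>n\<close> or both are above \<open>n\<close>, they are still
  neighbours in the word of the small or of the large letters, and the relation holds there. The
  hypotheses on the three words record that the exchange takes place within a block.\<close>

lemma separate_swap:
  fixes q :: "'k::field"
  assumes q: "q \<noteq> 0" and kl: "k < l" and w: "u @ k # l # v \<in> words (n + m) d"
    and eq: "w1 @ w2 @ w3 = u @ k # l # v" "w1' @ w2' @ w3' = u @ l # k # v"
    and len: "length w1 = A" "length w2 = B'" "length w3 = C"
    and len': "length w1' = A" "length w2' = B'" "length w3' = C"
    and low: "length (low n w1) = a" "length (low n w2) = b" "length (low n w3) = c"
    and low': "length (low n w1') = a" "length (low n w2') = b" "length (low n w3') = c"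
    and high: "length (high n w1) = e" "length (high n w2) = f" "length (high n w3) = g"
    and high': "length (high n w1') = e" "length (high n w2') = f" "length (high n w3') = g"
    and inv: "inversions n w1' + inversions n w2' + inversions n w3'
      = inversions n w1 + inversions n w2 + inversions n w3 + (if k \<le> n \<and> n < l then 1 else 0)"
    and low_pos: "l \<le> n \<Longrightarrow> Suc (length (low n u)) \<in> blocks a b c"
    and high_pos: "n < k \<Longrightarrow> Suc (length (high n u)) \<in> blocks e f g"
  shows "separate q n (pack A B' C (bas (u @ l # k # v))) - q *\<^sub>v separate q n (pack A B' C (bas (u @ k # l # v)))
    \<in> rels (pairs_space q d n m)"
proof -
  let ?w = "u @ k # l # v" and ?w' = "u @ l # k # v"
  define s where "s = inversions n w1 + inversions n w2 + inversions n w3"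
  define s' where "s' = inversions n w1' + inversions n w2' + inversions n w3'"
  define p where "p = inverse q ^ ((b + c) * e)"
  define P where "P = (\<lambda>w. pack a b c (bas (low n w)) :: Bidx \<Rightarrow>\<^sub>0 'k)"
  define Q where "Q = (\<lambda>w. pack e f g (bas (high n w)) :: Bidx \<Rightarrow>\<^sub>0 'k)"
  let ?D = "\<lambda>x y. dinj (a + b + c, e + f + g) (x \<otimes> y) :: _ \<Rightarrow>\<^sub>0 'k"
  have sep: "separate q n (pack A B' C (bas ?w)) = (q ^ s * p) *\<^sub>v ?D (P ?w) (Q ?w)"
    unfolding eq(1)[symmetric] s_def p_def P_def Q_def by (rule separate_bas[OF len low high])
  have sep': "separate q n (pack A B' C (bas ?w')) = (q ^ s' * p) *\<^sub>v ?D (P ?w') (Q ?w')"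
    unfolding eq(2)[symmetric] s'_def p_def P_def Q_def by (rule separate_bas[OF len' low' high'])
  have lowlen: "length (low n ?w) = a + b + c" and highlen: "length (high n ?w) = e + f + g"
    unfolding eq(1)[symmetric] using low high by simp_all
  have loww: "low n ?w \<in> words n (a + b + c)" and highw: "high n ?w \<in> words m (e + f + g)"
    using low_in_words[OF w] high_in_words[OF w] unfolding lowlen highlen by simp_all
  have d: "(a + b + c) + (e + f + g) = d"
    using length_low_high[of n ?w] w unfolding lowlen highlen by (simp add: words_def)
  have PQ: "P ?w \<in> elemsB q (a + b + c) n" "Q ?w \<in> elemsB q (e + f + g) m"
    unfolding P_def Q_def using loww highw by (auto intro!: pack_in_elems)
  consider "k \<le> n" "n < l" | "l \<le> n" | "n < k"
    by linarith
  then show ?thesis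
  proof cases
    case 1
    then have "s' = Suc s" "P ?w' = P ?w" "Q ?w' = Q ?w"
      using inv by (simp_all add: s_def s'_def P_def Q_def low_Cons high_Cons)
    then show ?thesis
      unfolding sep sep' by (simp add: mult.assoc pm.subspace_0[OF subspace_rels_pairs])
  next
    case 2
    then have "s' = s" "Q ?w' = Q ?w"
      using inv kl by (simp_all add: s_def s'_def Q_def high_Cons)
    moreover have "P ?w' - q *\<^sub>v P ?w \<in> relsB q (a + b + c) n"
    proof -
      have "bas (low n u @ l # k # low n v) - q *\<^sub>v bas (low n u @ k # l # low n v)
          \<in> Rel q n (a + b + c) (blocks a b c)"
        by (rule swap_in_Rel[OF kl low_pos[OF 2]]) (use loww 2 kl in \<open>simp add: low_Cons\<close>)
      then have "pack a b c (bas (low n u @ l # k # low n v) - q *\<^sub>v bas (low n u @ k # l # low n v))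
          \<in> relsB q (a + b + c) n"
        by (rule pack_in_rels) simp
      then show ?thesis
        using 2 kl by (simp add: P_def low_Cons pack_simps)
    qed
    ultimately have "(q ^ s * p) *\<^sub>v ?D (P ?w' - q *\<^sub>v P ?w) (Q ?w) \<in> rels (pairs_space q d n m)"
      using PQ by (intro pm.subspace_scale[OF subspace_rels_pairs] dinj_tens_in_rels d) auto
    with \<open>s' = s\<close> \<open>Q ?w' = Q ?w\<close> show ?thesis
      unfolding sep sep'
      by (simp add: lin_simps[OF lin_dinj[OF lin_tens_left[OF lin_ident]]] pm.scale_right_diff_distrib mult.commute)
  next
    case 3
    then have "s' = s" "P ?w' = P ?w"
      using inv kl by (simp_all add: s_def s'_def P_def low_Cons)
    moreover have "Q ?w' - q *\<^sub>v Q ?w \<in> relsB q (e + f + g) m"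
    proof -
      have "bas (high n u @ (l - n) # (k - n) # high n v) - q *\<^sub>v bas (high n u @ (k - n) # (l - n) # high n v)
          \<in> Rel q m (e + f + g) (blocks e f g)"
        by (rule swap_in_Rel[OF _ high_pos[OF 3]]) (use highw 3 kl in \<open>simp_all add: high_Cons\<close>)
      then have "pack e f g (bas (high n u @ (l - n) # (k - n) # high n v) - q *\<^sub>v bas (high n u @ (k - n) # (l - n) # high n v))
          \<in> relsB q (e + f + g) m"
        by (rule pack_in_rels) simp
      then show ?thesis
        using 3 kl by (simp add: Q_def high_Cons pack_simps)
    qed
    ultimately have "(q ^ s * p) *\<^sub>v ?D (P ?w) (Q ?w' - q *\<^sub>v Q ?w) \<in> rels (pairs_space q d n m)"
      using PQ by (intro pm.subspace_scale[OF subspace_rels_pairs] dinj_tens_in_rels d) auto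
    with \<open>s' = s\<close> \<open>P ?w' = P ?w\<close> show ?thesis
      unfolding sep sep'
      by (simp add: lin_simps[OF lin_dinj[OF lin_tens_right[OF lin_ident]]] pm.scale_right_diff_distrib mult.commute)
  qed
qed

lemma separate_in_rels:
  fixes q :: "'k::field"
  assumes q: "q \<noteq> 0" and x: "x \<in> relsB q d (n + m)"
  shows "separate q n x \<in> rels (pairs_space q d n m)"
proof (rule rels_B_in_subspace[OF lin_separate subspace_rels_pairs _ x])
  fix A B' C r assume ABC: "A + B' + C = d" and r: "r \<in> Rel q (n + m) d (blocks A B' C)"
  show "separate q n (pack A B' C r) \<in> rels (pairs_space q d n m)"
  proof (rule lin_Rel_letters[OF q lin_compose[OF lin_separate lin_pack'] subspace_rels_pairs blocks_subset[OF ABC] r])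
    fix u k l v assume kl: "k < l" and pos: "Suc (length u) \<in> blocks A B' C"
      and w: "u @ k # l # v \<in> words (n + m) d"
    have len: "length u + 2 + length v = d"
      using w by (simp add: words_def)
    from pos consider "Suc (length u) < A" | "A < Suc (length u)" "Suc (length u) < A + B'"
      | "A + B' < Suc (length u)" "Suc (length u) < A + B' + C"
      by (auto simp: blocks_def)
    then show "separate q n (pack A B' C (bas (u @ l # k # v))) - q *\<^sub>v separate q n (pack A B' C (bas (u @ k # l # v)))
        \<in> rels (pairs_space q d n m)"
    proof cases
      case 1
      then have "length v = (A - length u - 2) + B' + C"
        using len ABC by simp
      from word_3_blocks[OF this] obtain t w2 w3 where v: "v = t @ w2 @ w3"
        "length t = A - length u - 2" "length w2 = B'" "length w3 = C"
        by blast
      show ?thesis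
        by (rule separate_swap[OF q kl w, of "u @ k # l # t" w2 w3 "u @ l # k # t" w2 w3 _ _ _
              "length (low n (u @ k # l # t))" "length (low n w2)" "length (low n w3)"
              "length (high n (u @ k # l # t))" "length (high n w2)" "length (high n w3)"])
          (use v 1 kl in \<open>auto simp: low_Cons high_Cons inversions_append blocks_def\<close>)
    next
      case 2
      define w1 s t w3 where blocks: "w1 = take A u" "s = drop A u"
        "t = take (A + B' - length u - 2) v" "w3 = drop (A + B' - length u - 2) v"
      have uv: "u = w1 @ s" "v = t @ w3"
        "length w1 = A" "length s = length u - A" "length t = A + B' - length u - 2" "length w3 = C"
        using 2 len ABC by (simp_all add: blocks)
      show ?thesis
        by (rule separate_swap[OF q kl w, of w1 "s @ k # l # t" w3 w1 "s @ l # k # t" w3 _ _ _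
              "length (low n w1)" "length (low n (s @ k # l # t))" "length (low n w3)"
              "length (high n w1)" "length (high n (s @ k # l # t))" "length (high n w3)"])
          (use uv 2 kl in \<open>auto simp: low_Cons high_Cons inversions_append blocks_def\<close>)
    next
      case 3
      then have "length u = A + B' + (length u - A - B')"
        by simp
      from word_3_blocks[OF this] obtain w1 w2 s where u: "u = w1 @ w2 @ s"
        "length w1 = A" "length w2 = B'" "length s = length u - A - B'"
        by blast
      show ?thesis
        by (rule separate_swap[OF q kl w, of w1 w2 "s @ k # l # v" w1 w2 "s @ l # k # v" _ _ _
              "length (low n w1)" "length (low n w2)" "length (low n (s @ k # l # v))"
              "length (high n w1)" "length (high n w2)" "length (high n (s @ k # l # v))"])
          (use u 3 kl len ABC in \<open>auto simp: low_Cons high_Cons inversions_append blocks_def\<close>)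
    qed
  qed
qed

lemma iso_join:
  fixes q :: "'k::field"
  assumes q: "q \<noteq> 0"
  shows "iso_map (pairs_space q d n m) (obj (B q d) (n + m)) (join q n m)"
proof -
  have "eqv (pairs_space q d n m) x y"
    if x: "x \<in> elems (pairs_space q d n m)" and y: "y \<in> elems (pairs_space q d n m)"
      and eqv: "eqv (obj (B q d) (n + m)) (join q n m x) (join q n m y)" for x y
  proof -
    have "separate q n (join q n m x - join q n m y) \<in> rels (pairs_space q d n m)"
      by (rule separate_in_rels[OF q]) (use eqv in \<open>simp add: eqv_def\<close>)
    then show ?thesis
      by (simp add: lin_diff[OF lin_separate] separate_join[OF q x] separate_join[OF q y] eqv_def)
  qed
  moreover have "\<exists>x\<in>elems (pairs_space q d n m). eqv (obj (B q d) (n + m)) (join q n m x) y"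
    if y: "y \<in> elemsB q d (n + m)" for y
    using separate_in_elems[OF y] join_separate[OF q y] unfolding eqv_def by blast
  ultimately show ?thesis
    using is_map_join[OF q] by (simp add: iso_map_def inj_map_def surj_map_def)
qed

lemma exponential_functor_B:
  assumes "q \<noteq> 0"
  shows "exponential_functor q (B q) (\<lambda>d1 d2 n. B_mu q) (\<lambda>n. B_unit)"
  using pq_algebra_B[OF assms] iso_join[OF assms] by (simp add: exponential_functor_def pairs_space_def)

theorem lemma3p9:
  fixes q :: "'k::field"
  assumes "q ^ 3 = 1" and "\<And>k. 0 < k \<Longrightarrow> k < 3 \<Longrightarrow> q ^ k \<noteq> 1"
  shows "graded_differential_algebra q (B q) (\<lambda>d1 d2 n. B_mu q) (\<lambda>n. B_unit) (B_grading q)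
           (\<lambda>d n. B_delta q)
       \<and> graded_exponential_functor q (B q) (\<lambda>d1 d2 n. B_mu q) (\<lambda>n. B_unit) (B_grading q)
       \<and> (\<forall>d1 d2 n. surj_map (tens_space (obj (B q d1) n) (obj (B q d2) n))
              (obj (B q (d1 + d2)) n) (B_mu q))
       \<and> (\<forall>d1 d2 n. \<forall>x\<in>elems (tens_space (obj (B q d1) n) (obj (B q d2) n)).
              eqv (obj (B q (d1 + d2)) n) (B_mu q (B_tens_delta q x)) (B_delta q (B_mu q x)))"
proof -
  have q: "q \<noteq> 0"
    using assms(1) by auto
  then have "graded_exponential_functor q (B q) (\<lambda>d1 d2 n. B_mu q) (\<lambda>n. B_unit) (B_grading q)"
    unfolding graded_exponential_functor_def using graded_algebra_B exponential_functor_B by blast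
  then show ?thesis
    by (intro conjI allI ballI graded_differential_algebra_B[OF q assms(1)] surj_B_mu[OF q]
        B_mu_B_tens_delta[OF q assms(1)])
qed

end
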